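(* Let $T^2=\mathbb R^2/\mathbb Z^2$ with symplectic form $\omega=dx\wedge dy$. Any finite energy symplectic homeomorphism $h$ of $(T^2,\omega)$ with trivial flux (i.e. $L_\omega(h)=0$) is a finite energy Hamiltonian homeomorphism of $(T^2,\omega)$.
   Context: Fix a Riemannian metric on $T^2$ with injectivity radius $r$, and $\kappa>0$. A symplectic isotopy $\Phi=\{\phi^t\}$ starting at $\mathrm{Id}$ is generated by a pair $(U,\mathcal H)$, where $U=\{U^t\}$ is a smooth family of functions and $\mathcal H=\{\mathcal H^t\}$ a smooth family of harmonic 1-forms with $\iota_{\dot\phi^t}\omega=dU^t+\mathcal H^t$. Its Hofer-like length is $l(\Phi)=\int_0^1\big(\mathrm{osc}(U^t)+\kappa\|\mathcal H^t\|_{L^2}\big)dt$, with $\mathrm{osc}=\max-\min$. If $\mathcal H\equiv0$, $\Phi$ is a Hamiltonian isotopy and $l(\Phi)=\int_0^1\mathrm{osc}(U^t)dt$ is its Hofer length. A homeomorphism $\phi$ is a finite energy symplectic (resp. Hamiltonian) homeomorphism if there is a sequence $(\Phi_i)$ of symplectic (resp. Hamiltonian) isotopies starting at $\mathrm{Id}$ such that the time-one maps $\phi_i^1$ converge to $\phi$ in the $C^0$ topology and the lengths $l(\Phi_i)$ are bounded uniformly in $i$. Extended flux, with $M=T^2$, $\Omega=\omega$: $\mathrm{Homeo}_0(M,\Omega)$ is the identity component ($C^0$ topology) of the group of $\Omega$-preserving homeomorphisms, and $\mathcal P\mathrm{Homeo}_0(M,\Omega)$ the set of continuous paths $H$ in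 it from $\mathrm{Id}$. Fix $\delta\in\,]0,r[$. $\mathfrak{AHom}_\delta(H)$ is the set of smooth isotopies $\Phi$ from $\mathrm{Id}$ homotopic relative to fixed endpoints to a continuous path $\Theta$ of diffeomorphisms from $\mathrm{Id}$ with $\sup_{t,x}d(\theta_t(x),h_t(x))<\delta$. For a closed 1-form $\alpha$ let $\mathcal F_\alpha(\Phi)(t)=\int_0^t\Phi_s^*(\iota_{\dot\Phi_s}\alpha)ds$. Put $\mathbf R_\delta(H,\alpha)(p)=\mathcal F_\alpha(H)(1)(p)$ if $H$ is a smooth isotopy and $\mathbf R_\delta(H,\alpha)(p)=\mathcal F_\alpha(\Phi)(1)(p)+\int_{\chi_\delta^p}\alpha$ otherwise, where $\Phi\in\mathfrak{AHom}_\delta(H)$ and $\chi^p_\delta$ is the minimizing geodesic from $\Phi(1,p)$ to $H(1,p)$ (independent of the choice of $\Phi$). Then $\widetilde L_\Omega^\delta(H)\in H^1(T^2,\mathbb R)$ is determined by $\int_M\alpha\wedge\widetilde L_\Omega^\delta(H)=\int_M\mathbf R_\delta(H,\alpha)\Omega$ for all closed $\alpha$. With $\tilde\Gamma_\Omega^\delta$ the image under $\widetilde L_\Omega^\delta$ of the loops at $\mathrm{Id}$, the map $L_\omega=L_\Omega^\delta:\mathrm{Homeo}_0(M,\Omega)\to H^1(T^2,\mathbb R)/\tilde\Gamma_\Omega^\delta$ sends $h$ to the class of $\widetilde L_\Omega^\delta(H)$ for any path $H$ from $\mathrm{Id}$ to $h$. *)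

theory Defs
  imports "HOL-Analysis.Analysis" "HOL-Algebra.Coset"
begin

section \<open>The torus\<close>

definition torus_rel :: "real^2 \<Rightarrow> real^2 \<Rightarrow> bool" where
  "torus_rel x y \<longleftrightarrow> (\<forall>i. x $ i - y $ i \<in> \<int>)"

lemma equivp_torus_rel: "equivp torus_rel"
proof (rule equivpI)
  show "reflp torus_rel" by (simp add: reflp_def torus_rel_def)
  show "symp torus_rel"
    unfolding symp_def torus_rel_def by (metis Ints_minus minus_diff_eq)
  show "transp torus_rel"
    unfolding transp_def torus_rel_def
  proof (intro allI impI)
    fix x y z :: "real^2" and i
    assume "\<forall>i. x $ i - y $ i \<in> \<int>" "\<forall>i. y $ i - z $ i \<in> \<int>"
    then have "(x $ i - y $ i) + (y $ i - z $ i) \<in> \<int>" by (intro Ints_add) auto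
    then show "x $ i - z $ i \<in> \<int>" by simp
  qed
qed

quotient_type torus = "real^2" / torus_rel
  morphisms rep_torus proj
  by (rule equivp_torus_rel)

lemma proj_eq_iff: "proj x = proj y \<longleftrightarrow> (\<forall>i. x $ i - y $ i \<in> \<int>)"
  using torus.abs_eq_iff by (simp add: torus_rel_def)

lemma proj_rep_torus [simp]: "proj (rep_torus p) = p"
  by (rule Quotient_abs_rep[OF Quotient_torus])

lemma proj_add_cong: "proj x = proj y \<Longrightarrow> proj (x + z) = proj (y + z)"
  by (simp add: proj_eq_iff)

lemma closed_fibre: "closed (proj -` {p})"
proof -
  have "proj -` {p} = (\<Inter>i. (\<lambda>x. x $ i - rep_torus p $ i) -` \<int>)"
    using proj_eq_iff[of _ "rep_torus p"] by auto
  moreover have "closed ((\<lambda>x::real^2. x $ i - rep_torus p $ i) -` \<int>)" for i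
    by (intro closed_vimage closed_Ints continuous_intros)
  ultimately show ?thesis by auto
qed

lemma setdist_fibre_le:
  assumes "proj x = p"
  shows "setdist {x} (proj -` {q}) \<le> setdist (proj -` {p}) (proj -` {q})"
proof (rule le_setdistI)
  show "proj -` {p} \<noteq> {}" "proj -` {q} \<noteq> {}"
    using proj_rep_torus by (metis empty_iff vimage_singleton_eq)+
  fix a b assume ab: "a \<in> proj -` {p}" "b \<in> proj -` {q}"
  have "proj (b + (x - a)) = q"
    using ab assms proj_add_cong[of x a "b - a"]
    by (simp add: algebra_simps)
  then have "setdist {x} (proj -` {q}) \<le> dist x (b + (x - a))"
    by (intro setdist_le_dist) auto
  also have "\<dots> = dist a b" by (simp add: dist_norm)
  finally show "setdist {x} (proj -` {q}) \<le> dist a b" .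
qed

lemma setdist_fibre:
  assumes "proj x = p"
  shows "setdist {x} (proj -` {q}) = setdist (proj -` {p}) (proj -` {q})"
  using setdist_fibre_le[OF assms] setdist_le_sing[of x "proj -` {p}"] assms
  by (metis antisym vimage_singleton_eq)

instantiation torus :: metric_space
begin

definition dist_torus :: "torus \<Rightarrow> torus \<Rightarrow> real" where
  "dist_torus p q = setdist (proj -` {p}) (proj -` {q})"

definition uniformity_torus :: "(torus \<times> torus) filter" where
  "uniformity_torus = (INF e\<in>{0 <..}. principal {(p, q). dist p q < e})"

definition open_torus :: "torus set \<Rightarrow> bool" where
  "open_torus U \<longleftrightarrow> (\<forall>p\<in>U. eventually (\<lambda>(p', q). p' = p \<longrightarrow> q \<in> U) uniformity)"

instance
proof
  fix p q s :: torus
  show "dist p q = 0 \<longleftrightarrow> p = q"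
  proof
    assume "dist p q = 0"
    then have "setdist {rep_torus p} (proj -` {q}) = 0"
      by (simp add: dist_torus_def setdist_fibre)
    then have "rep_torus p \<in> proj -` {q}"
      using setdist_eq_0_closed[OF closed_fibre]
      by (metis empty_iff proj_rep_torus vimage_singleton_eq)
    then show "p = q" by simp
  next
    assume "p = q" then show "dist p q = 0" by (simp add: dist_torus_def setdist_refl)
  qed
  show "dist p q \<le> dist p s + dist q s"
    using setdist_triangle[of "proj -` {p}" "proj -` {q}" "rep_torus s"]
    by (simp add: dist_torus_def setdist_fibre setdist_sym)
qed (auto simp: uniformity_torus_def open_torus_def)

end

text \<open>The metric above induces the quotient topology.\<close>

lemma dist_proj_le: "dist (proj x) (proj y) \<le> dist x y"
  unfolding dist_torus_def by (intro setdist_le_dist) auto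

lemma dist_proj_ltE:
  assumes "dist (proj x) q < e"
  obtains y where "proj y = q" "dist x y < e"
proof -
  have "setdist {x} (proj -` {q}) < e"
    using assms by (simp add: dist_torus_def setdist_fibre)
  moreover have "proj -` {q} \<noteq> {}"
    using proj_rep_torus by (metis empty_iff vimage_singleton_eq)
  ultimately show thesis
    using setdist_ltE[of "{x}" "proj -` {q}" e] that by blast
qed

lemma continuous_on_proj: "continuous_on A proj"
  unfolding continuous_on_iff using dist_proj_le le_less_trans by blast

lemma open_torus_iff_quotient: "open U \<longleftrightarrow> open (proj -` U)"
proof
  show "open U \<Longrightarrow> open (proj -` U)"
    by (intro open_vimage continuous_on_proj)
next
  assume op: "open (proj -` U)"
  show "open U" unfolding open_dist
  proof
    fix p assume "p \<in> U"
    then have "rep_torus p \<in> proj -` U" by simp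
    then obtain e where e: "e > 0" "\<And>y. dist y (rep_torus p) < e \<Longrightarrow> proj y \<in> U"
      using op unfolding open_dist by (metis vimageE vimageI2)
    show "\<exists>e>0. \<forall>q. dist q p < e \<longrightarrow> q \<in> U"
    proof (intro exI[of _ e] conjI allI impI e(1))
      fix q assume "dist q p < e"
      then have "dist (proj (rep_torus p)) q < e" by (simp add: dist_commute)
      then show "q \<in> U" by (metis dist_proj_ltE e(2) dist_commute)
    qed
  qed
qed

lemma compact_UNIV_torus: "compact (UNIV :: torus set)"
proof -
  have "p \<in> proj ` cbox 0 1" for p
  proof -
    let ?y = "(\<chi> i. frac (rep_torus p $ i)) :: real^2"
    have "proj ?y = proj (rep_torus p)"
      unfolding proj_eq_iff by (simp add: frac_def)
    moreover have "?y \<in> cbox 0 1"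
      by (simp add: mem_box_cart frac_lt_1 less_imp_le)
    ultimately show ?thesis by (metis imageI proj_rep_torus)
  qed
  then have "UNIV = proj ` cbox 0 1" by blast
  then show ?thesis
    using compact_continuous_image[OF continuous_on_proj compact_cbox] by metis
qed

text \<open>The measure on the torus given by the area form \<open>dx \<and> dy\<close>.\<close>

definition torus_measure :: "torus measure" where
  "torus_measure = distr (restrict_space lborel (cbox 0 1)) borel proj"

section \<open>Smoothness\<close>

primrec Ck :: "nat \<Rightarrow> ('a::euclidean_space \<Rightarrow> 'b::real_normed_vector) \<Rightarrow> bool" where
  "Ck 0 f \<longleftrightarrow> continuous_on UNIV f"
| "Ck (Suc k) f \<longleftrightarrow> f differentiable_on UNIV \<and> (\<forall>v. Ck k (\<lambda>x. frechet_derivative f (at x) v))"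

definition smooth :: "('a::euclidean_space \<Rightarrow> 'b::real_normed_vector) \<Rightarrow> bool" where
  "smooth f \<longleftrightarrow> (\<forall>k. Ck k f)"

text \<open>
  The tangent and cotangent bundles of the torus are trivialised by the coordinate frames.
  Thus a vector at a point is an element of \<^typ>\<open>real^2\<close>, a 1-form
  \<open>\<alpha>\<^sub>1 dx + \<alpha>\<^sub>2 dy\<close> is a map \<^typ>\<open>torus \<Rightarrow> real^2\<close>, and a metric tensor is a map
  \<^typ>\<open>torus \<Rightarrow> real^2^2\<close>.
\<close>

type_synonym form = "torus \<Rightarrow> real^2"

definition smooth_torus :: "(torus \<Rightarrow> 'b::real_normed_vector) \<Rightarrow> bool" where
  "smooth_torus f \<longleftrightarrow> smooth (\<lambda>x. f (proj x))"

text \<open>Smoothness on \<open>[0,1] \<times> T\<^sup>2\<close> is the existence of a smooth extension to all times.\<close>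

definition smooth_family :: "(real \<Rightarrow> torus \<Rightarrow> 'b::real_normed_vector) \<Rightarrow> bool" where
  "smooth_family F \<longleftrightarrow>
     (\<exists>G :: real \<times> (real^2) \<Rightarrow> 'b. smooth G \<and> (\<forall>t\<in>{0..1}. \<forall>x. F t (proj x) = G (t, x)))"

definition partial :: "2 \<Rightarrow> (torus \<Rightarrow> 'b::real_normed_vector) \<Rightarrow> torus \<Rightarrow> 'b" where
  "partial i f p = frechet_derivative (\<lambda>x. f (proj x)) (at (rep_torus p)) (axis i 1)"

definition differential :: "(torus \<Rightarrow> real) \<Rightarrow> form" where
  "differential f p = (\<chi> i. partial i f p)"

definition is_lift :: "(real^2 \<Rightarrow> real^2) \<Rightarrow> (torus \<Rightarrow> torus) \<Rightarrow> bool" where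
  "is_lift F f \<longleftrightarrow> (\<forall>x. proj (F x) = f (proj x))"

definition smooth_map :: "(torus \<Rightarrow> torus) \<Rightarrow> bool" where
  "smooth_map f \<longleftrightarrow> (\<exists>F. smooth F \<and> is_lift F f)"

definition diffeo :: "(torus \<Rightarrow> torus) \<Rightarrow> bool" where
  "diffeo f \<longleftrightarrow> smooth_map f \<and> (\<exists>k. smooth_map k \<and> (\<forall>p. k (f p) = p) \<and> (\<forall>p. f (k p) = p))"

text \<open>Two continuous lifts of a curve differ by a constant, so the choice is immaterial.\<close>

definition lift_curve :: "(real \<Rightarrow> torus) \<Rightarrow> real \<Rightarrow> real^2" where
  "lift_curve c = (SOME \<gamma>. continuous_on {0..1} \<gamma> \<and> (\<forall>t\<in>{0..1}. proj (\<gamma> t) = c t))"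

definition velocity :: "(real \<Rightarrow> torus) \<Rightarrow> real \<Rightarrow> real^2" where
  "velocity c t = vector_derivative (lift_curve c) (at t within {0..1})"

definition line_integral :: "form \<Rightarrow> (real \<Rightarrow> torus) \<Rightarrow> real" where
  "line_integral \<alpha> c = integral {0..1} (\<lambda>t. \<alpha> (c t) \<bullet> velocity c t)"

section \<open>Riemannian metrics\<close>

type_synonym metric_tensor = "torus \<Rightarrow> real^2^2"

definition riemannian_metric :: "metric_tensor \<Rightarrow> bool" where
  "riemannian_metric g \<longleftrightarrow> smooth_torus g \<and>
     (\<forall>p. transpose (g p) = g p \<and> (\<forall>v. v \<noteq> 0 \<longrightarrow> v \<bullet> (g p *v v) > 0))"

definition gnorm :: "metric_tensor \<Rightarrow> torus \<Rightarrow> real^2 \<Rightarrow> real" where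
  "gnorm g p v = sqrt (v \<bullet> (g p *v v))"

text \<open>Curves are described by their lifts to the plane.\<close>

definition curve_length :: "metric_tensor \<Rightarrow> (real \<Rightarrow> real^2) \<Rightarrow> real" where
  "curve_length g \<gamma> = integral {0..1} (\<lambda>t. gnorm g (proj (\<gamma> t)) (vector_derivative \<gamma> (at t)))"

definition riem_dist :: "metric_tensor \<Rightarrow> torus \<Rightarrow> torus \<Rightarrow> real" where
  "riem_dist g p q =
     Inf {curve_length g \<gamma> |\<gamma>. \<gamma> C1_differentiable_on {0..1} \<and> proj (\<gamma> 0) = p \<and> proj (\<gamma> 1) = q}"

definition christoffel :: "metric_tensor \<Rightarrow> torus \<Rightarrow> 2 \<Rightarrow> 2 \<Rightarrow> 2 \<Rightarrow> real" where
  "christoffel g p k i j = (1/2) * (\<Sum>l\<in>UNIV. matrix_inv (g p) $ k $ l *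
     (partial i (\<lambda>q. g q $ j $ l) p + partial j (\<lambda>q. g q $ i $ l) p - partial l (\<lambda>q. g q $ i $ j) p))"

definition geodesic :: "metric_tensor \<Rightarrow> (real \<Rightarrow> real^2) \<Rightarrow> bool" where
  "geodesic g \<gamma> \<longleftrightarrow> (\<exists>\<gamma>'. \<forall>t.
     (\<gamma> has_vector_derivative \<gamma>' t) (at t) \<and>
     (\<gamma>' has_vector_derivative
        (\<chi> k. - (\<Sum>i\<in>UNIV. \<Sum>j\<in>UNIV. christoffel g (proj (\<gamma> t)) k i j * \<gamma>' t $ i * \<gamma>' t $ j))) (at t))"

definition minimizing_geodesic ::
    "metric_tensor \<Rightarrow> (real \<Rightarrow> real^2) \<Rightarrow> torus \<Rightarrow> torus \<Rightarrow> bool" where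
  "minimizing_geodesic g \<gamma> p q \<longleftrightarrow> geodesic g \<gamma> \<and> proj (\<gamma> 0) = p \<and> proj (\<gamma> 1) = q \<and>
     curve_length g \<gamma> = riem_dist g p q"

text \<open>The exponential map at \<^term>\<open>proj x\<close>, lifted to the plane.\<close>

definition riem_exp :: "metric_tensor \<Rightarrow> real^2 \<Rightarrow> real^2 \<Rightarrow> real^2" where
  "riem_exp g x v = (THE y. \<exists>\<gamma>. geodesic g \<gamma> \<and> \<gamma> 0 = x \<and>
     (\<gamma> has_vector_derivative v) (at 0) \<and> \<gamma> 1 = y)"

text \<open>
  The supremum of the radii for which every exponential map is a diffeomorphism from the ball
  onto its image, that is, an injective local diffeomorphism.
\<close>

definition injectivity_radius :: "metric_tensor \<Rightarrow> real" where
  "injectivity_radius g = Sup {\<rho>. \<rho> > 0 \<and> (\<forall>x.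
     inj_on (\<lambda>v. proj (riem_exp g x v)) {v. gnorm g (proj x) v < \<rho>} \<and>
     (\<forall>v. gnorm g (proj x) v < \<rho> \<longrightarrow>
        (\<exists>D. (riem_exp g x has_derivative D) (at v) \<and> bij D)))}"

section \<open>Differential forms and cohomology\<close>

definition closed_form :: "form \<Rightarrow> bool" where
  "closed_form \<alpha> \<longleftrightarrow> smooth_torus \<alpha> \<and>
     (\<forall>p. partial 1 (\<lambda>q. \<alpha> q $ 2) p = partial 2 (\<lambda>q. \<alpha> q $ 1) p)"

definition exact_form :: "form \<Rightarrow> bool" where
  "exact_form \<alpha> \<longleftrightarrow> (\<exists>f. smooth_torus f \<and> \<alpha> = differential f)"

text \<open>
  A form is coclosed if the divergence of the dual vector field vanishes (up to the factor
  \<open>1 / sqrt (det g)\<close>).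
\<close>

definition coclosed_form :: "metric_tensor \<Rightarrow> form \<Rightarrow> bool" where
  "coclosed_form g \<alpha> \<longleftrightarrow>
     (\<forall>p. (\<Sum>i\<in>UNIV. partial i (\<lambda>q. sqrt (det (g q)) * (matrix_inv (g q) *v \<alpha> q) $ i) p) = 0)"

definition harmonic_form :: "metric_tensor \<Rightarrow> form \<Rightarrow> bool" where
  "harmonic_form g \<alpha> \<longleftrightarrow> closed_form \<alpha> \<and> coclosed_form g \<alpha>"

definition L2_norm_form :: "metric_tensor \<Rightarrow> form \<Rightarrow> real" where
  "L2_norm_form g \<alpha> =
     sqrt (LINT p|torus_measure. (\<alpha> p \<bullet> (matrix_inv (g p) *v \<alpha> p)) * sqrt (det (g p)))"

definition wedge_integral :: "form \<Rightarrow> form \<Rightarrow> real" where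
  "wedge_integral \<alpha> \<beta> = (LINT p|torus_measure. \<alpha> p $ 1 * \<beta> p $ 2 - \<alpha> p $ 2 * \<beta> p $ 1)"

text \<open>First de Rham cohomology; its elements are the cosets of the exact forms.\<close>

definition closed_forms :: "form monoid" where
  "closed_forms = \<lparr>carrier = Collect closed_form, mult = (\<lambda>\<alpha> \<beta> p. \<alpha> p + \<beta> p), one = (\<lambda>p. 0)\<rparr>"

definition H1 :: "form set monoid" where
  "H1 = closed_forms Mod Collect exact_form"

section \<open>Isotopies and their lengths\<close>

definition smooth_isotopy :: "(real \<Rightarrow> torus \<Rightarrow> torus) \<Rightarrow> bool" where
  "smooth_isotopy \<Phi> \<longleftrightarrow> \<Phi> 0 = id \<and> (\<forall>t\<in>{0..1}. diffeo (\<Phi> t)) \<and>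
     (\<exists>G :: real \<times> (real^2) \<Rightarrow> real^2. smooth G \<and>
        (\<forall>t\<in>{0..1}. is_lift (\<lambda>x. G (t, x)) (\<Phi> t)))"

definition omega :: "real^2 \<Rightarrow> real^2 \<Rightarrow> real" where
  "omega u v = u $ 1 * v $ 2 - u $ 2 * v $ 1"

definition symplectic_diffeo :: "(torus \<Rightarrow> torus) \<Rightarrow> bool" where
  "symplectic_diffeo f \<longleftrightarrow> diffeo f \<and> (\<exists>F. smooth F \<and> is_lift F f \<and>
     (\<forall>x u v. omega (frechet_derivative F (at x) u) (frechet_derivative F (at x) v) = omega u v))"

definition symplectic_isotopy :: "(real \<Rightarrow> torus \<Rightarrow> torus) \<Rightarrow> bool" where
  "symplectic_isotopy \<Phi> \<longleftrightarrow> smooth_isotopy \<Phi> \<and> (\<forall>t\<in>{0..1}. symplectic_diffeo (\<Phi> t))"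

text \<open>The 1-form \<open>\<iota>\<^sub>X \<omega>\<close>.\<close>

definition contract_omega :: "real^2 \<Rightarrow> real^2" where
  "contract_omega X = (\<chi> i. omega X (axis i 1))"

definition generated_by ::
    "(real \<Rightarrow> torus \<Rightarrow> torus) \<Rightarrow> (real \<Rightarrow> torus \<Rightarrow> real) \<Rightarrow> (real \<Rightarrow> form) \<Rightarrow> bool" where
  "generated_by \<Phi> U \<H> \<longleftrightarrow> smooth_family U \<and> smooth_family \<H> \<and>
     (\<forall>t\<in>{0..1}. \<forall>p. contract_omega (velocity (\<lambda>s. \<Phi> s p) t) =
        differential (U t) (\<Phi> t p) + \<H> t (\<Phi> t p))"

definition osc :: "(torus \<Rightarrow> real) \<Rightarrow> real" where
  "osc f = (SUP p. f p) - (INF p. f p)"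

definition hofer_like_length ::
    "metric_tensor \<Rightarrow> real \<Rightarrow> (real \<Rightarrow> torus \<Rightarrow> real) \<Rightarrow> (real \<Rightarrow> form) \<Rightarrow> real" where
  "hofer_like_length g \<kappa> U \<H> = integral {0..1} (\<lambda>t. osc (U t) + \<kappa> * L2_norm_form g (\<H> t))"

definition hofer_length :: "(real \<Rightarrow> torus \<Rightarrow> real) \<Rightarrow> real" where
  "hofer_length U = integral {0..1} (\<lambda>t. osc (U t))"

definition torus_homeo :: "(torus \<Rightarrow> torus) \<Rightarrow> bool" where
  "torus_homeo h \<longleftrightarrow> (\<exists>k. homeomorphism UNIV UNIV h k)"

definition finite_energy_symplectic :: "metric_tensor \<Rightarrow> real \<Rightarrow> (torus \<Rightarrow> torus) \<Rightarrow> bool" where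
  "finite_energy_symplectic g \<kappa> h \<longleftrightarrow> torus_homeo h \<and>
     (\<exists>\<Phi> U \<H>. (\<forall>i::nat. symplectic_isotopy (\<Phi> i) \<and> generated_by (\<Phi> i) (U i) (\<H> i) \<and>
            (\<forall>t\<in>{0..1}. harmonic_form g (\<H> i t))) \<and>
        uniform_limit UNIV (\<lambda>i. \<Phi> i 1) h sequentially \<and>
        (\<exists>C. \<forall>i. hofer_like_length g \<kappa> (U i) (\<H> i) \<le> C))"

definition finite_energy_hamiltonian :: "(torus \<Rightarrow> torus) \<Rightarrow> bool" where
  "finite_energy_hamiltonian h \<longleftrightarrow> torus_homeo h \<and>
     (\<exists>\<Phi> U. (\<forall>i::nat. symplectic_isotopy (\<Phi> i) \<and> generated_by (\<Phi> i) (U i) (\<lambda>t p. 0)) \<and>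
        uniform_limit UNIV (\<lambda>i. \<Phi> i 1) h sequentially \<and>
        (\<exists>C. \<forall>i. hofer_length (U i) \<le> C))"

section \<open>The extended flux\<close>

text \<open>
  The \<open>C\<^sup>0\<close> topology is that of \<^typ>\<open>torus \<Rightarrow>\<^sub>C torus\<close>; as the torus is compact,
  \<^const>\<open>Bcontfun\<close> embeds all continuous maps.
\<close>

definition homeo_Omega :: "(torus \<Rightarrow> torus) set" where
  "homeo_Omega = {h. torus_homeo h \<and> distr torus_measure borel h = torus_measure}"

definition homeo0 :: "(torus \<Rightarrow> torus) set" where
  "homeo0 = {h \<in> homeo_Omega. connected_component (Bcontfun ` homeo_Omega) (Bcontfun id) (Bcontfun h)}"

definition path_homeo0 :: "(real \<Rightarrow> torus \<Rightarrow> torus) set" where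
  "path_homeo0 = {H. H 0 = id \<and> (\<forall>t\<in>{0..1}. H t \<in> homeo0) \<and> path (\<lambda>t. Bcontfun (H t))}"

definition AHom :: "metric_tensor \<Rightarrow> real \<Rightarrow> (real \<Rightarrow> torus \<Rightarrow> torus) \<Rightarrow> (real \<Rightarrow> torus \<Rightarrow> torus) set" where
  "AHom g \<delta> H = {\<Phi>. smooth_isotopy \<Phi> \<and> (\<exists>\<Theta>. \<Theta> 0 = id \<and> (\<forall>t\<in>{0..1}. diffeo (\<Theta> t)) \<and>
     homotopic_paths (Bcontfun ` Collect diffeo) (\<lambda>t. Bcontfun (\<Phi> t)) (\<lambda>t. Bcontfun (\<Theta> t)) \<and>
     (SUP (t, x)\<in>{0..1} \<times> UNIV. riem_dist g (\<Theta> t x) (H t x)) < \<delta>)}"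

text \<open>\<open>\<F>\<^sub>\<alpha>(\<Phi>)(t)\<close>: the pull-back of \<open>\<iota> \<alpha>\<close> evaluates \<open>\<alpha>\<close> on the velocity of the orbit of \<open>p\<close>.\<close>

definition flux_function :: "form \<Rightarrow> (real \<Rightarrow> torus \<Rightarrow> torus) \<Rightarrow> real \<Rightarrow> torus \<Rightarrow> real" where
  "flux_function \<alpha> \<Phi> t p = integral {0..t} (\<lambda>s. \<alpha> (\<Phi> s p) \<bullet> velocity (\<lambda>s. \<Phi> s p) s)"

text \<open>
  \<open>flux_density g \<delta> H R\<close> states that \<open>R\<close> is the map \<open>\<alpha> \<mapsto> \<^bold>R\<^sub>\<delta>(H, \<alpha>)\<close>. The isotopy \<open>\<Phi>\<close> and the
  geodesics \<open>\<sigma> p\<close> on which \<open>R\<close> nominally depends are existentially quantified, the value being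
  independent of them. The flux of a path is likewise given by its graph.
\<close>

definition flux_density ::
    "metric_tensor \<Rightarrow> real \<Rightarrow> (real \<Rightarrow> torus \<Rightarrow> torus) \<Rightarrow> (form \<Rightarrow> torus \<Rightarrow> real) \<Rightarrow> bool" where
  "flux_density g \<delta> H R \<longleftrightarrow>
     (if smooth_isotopy H then R = (\<lambda>\<alpha> p. flux_function \<alpha> H 1 p)
      else \<exists>\<Phi>\<in>AHom g \<delta> H. \<exists>\<sigma>. (\<forall>p. minimizing_geodesic g (\<sigma> p) (\<Phi> 1 p) (H 1 p)) \<and>
        R = (\<lambda>\<alpha> p. flux_function \<alpha> \<Phi> 1 p + line_integral \<alpha> (\<lambda>t. proj (\<sigma> p t))))"

definition has_path_flux ::
    "metric_tensor \<Rightarrow> real \<Rightarrow> (real \<Rightarrow> torus \<Rightarrow> torus) \<Rightarrow> form set \<Rightarrow> bool" where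
  "has_path_flux g \<delta> H c \<longleftrightarrow> c \<in> carrier H1 \<and> (\<exists>R. flux_density g \<delta> H R \<and>
     (\<forall>\<alpha>. closed_form \<alpha> \<longrightarrow>
        (\<forall>\<beta>\<in>c. wedge_integral \<alpha> \<beta> = (LINT p|torus_measure. R \<alpha> p))))"

definition flux_group :: "metric_tensor \<Rightarrow> real \<Rightarrow> form set set" where
  "flux_group g \<delta> = {c. \<exists>H\<in>path_homeo0. H 1 = id \<and> has_path_flux g \<delta> H c}"

text \<open>
  The map \<open>L\<^sub>\<Omega>\<^sup>\<delta>\<close> into \<^term>\<open>H1 Mod flux_group g \<delta>\<close>. All paths from the identity to \<open>h\<close> yield
  the same coset, so the union is that coset.
\<close>

definition flux :: "metric_tensor \<Rightarrow> real \<Rightarrow> (torus \<Rightarrow> torus) \<Rightarrow> form set set" where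
  "flux g \<delta> h = \<Union> {flux_group g \<delta> #>\<^bsub>H1\<^esub> c |H c. H \<in> path_homeo0 \<and> H 1 = h \<and> has_path_flux g \<delta> H c}"

end

theory Submission
  imports Defs
begin

text \<open>
  The period class of the harmonic part of the generator determines a curve of translations whose
  composition with a given symplectic isotopy is Hamiltonian; the time-one map changes by the
  translation by the mean displacement of a lift. Harmonic forms are a finite-dimensional space,
  so the oscillation of the additional Hamiltonian is bounded by their \<open>L\<^sup>2\<close> norm and the energy
  stays bounded. If the maps converge to \<open>h\<close>, their mean displacements converge modulo the lattice to
  that of \<open>h\<close>, which is what the flux of \<open>h\<close> measures: pairing with the constant forms \<open>dx\<close> and \<open>dy\<close>
  gives the mean of a displacement of \<open>h\<close>. So for vanishing flux the translations tend to the
  identity modulo the lattice.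

  For paths that are not smooth the flux involves minimizing geodesics shorter than the injectivity
  radius. That their displacements depend continuously on the point is shown with the exponential
  map; this needs existence, uniqueness and smooth dependence for the geodesic equation, and in
  particular that the set of radii in the definition of the injectivity radius is not empty (its
  supremum is unspecified otherwise).
\<close>

section \<open>Calculus of smooth maps\<close>

text \<open>Every closed form differs by an exact form from the constant form with the same periods,
  and a constant form generates translations. Translations preserve constant forms and oscillations,
  so undoing them removes the harmonic part and replaces \<open>U t\<close> by a translate of
  \<open>U t\<close> plus a periodic potential. The translation can be read off from the maps
  because an isotopy without harmonic part has mean displacement zero. If two maps are close on the
  torus, their displacements differ by almost a lattice vector, and by connectedness by almost the
  same one everywhere. Averaging then compares the means directly, so continuity of the extended
  flux never enters; the lattice vector itself is harmless because translating by it is the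
  identity. Flux is a class modulo loops: its vanishing says that some path to \<open>h\<close>
  shares its class with a loop. A displacement of the endpoint of a loop is lattice valued, hence
  constant, and is subtracted. For this the displacements must be continuous functions of the point,
  which is the reason for the study of geodesics.\<close>

lemma Ck_continuous: "Ck k f \<Longrightarrow> continuous_on UNIV f"
  by (cases k) (auto intro: differentiable_imp_continuous_on)

lemma Ck_Suc_D: "Ck (Suc k) f \<Longrightarrow> Ck k f"
  by (induction k arbitrary: f) (auto intro: differentiable_imp_continuous_on)

lemma Ck_has_derivative:
  "Ck (Suc k) f \<Longrightarrow> (f has_derivative frechet_derivative f (at x)) (at x)"
  by (simp add: differentiable_on_def flip: frechet_derivative_works)

text \<open>\<open>Ck\<close> is defined through the chosen \<open>frechet_derivative\<close>. By
  uniqueness of derivatives any explicit formula may be supplied instead, which is what the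
  inductions below do.\<close>

lemma Ck_SucI:
  assumes "\<And>x. (f has_derivative D x) (at x)" "\<And>v. Ck k (\<lambda>x. D x v)"
  shows "Ck (Suc k) f"
proof -
  have "frechet_derivative f (at x) = D x" for x
    using assms(1) by (metis frechet_derivative_at)
  then show ?thesis
    using assms by (auto simp: differentiable_on_def differentiable_def)
qed

lemma Ck_const [simp]: "Ck k (\<lambda>x. c)"
proof (induction k arbitrary: c)
  case (Suc k)
  show ?case by (rule Ck_SucI[where D="\<lambda>x v. 0"]) (auto simp: Suc)
qed simp

lemma Ck_bounded_linear:
  assumes "bounded_linear L" shows "Ck k L"
proof (cases k)
  case 0
  then show ?thesis using linear_continuous_on[OF assms] by simp
next
  case (Suc k)
  show ?thesis unfolding Suc
    by (rule Ck_SucI[where D="\<lambda>x v. L v"]) (auto intro: bounded_linear_imp_has_derivative assms)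
qed

lemma Ck_linear_compose:
  assumes "bounded_linear L" "Ck k f"
  shows "Ck k (\<lambda>x. L (f x))"
  using assms(2)
proof (induction k arbitrary: f)
  case 0
  then show ?case by (auto intro: bounded_linear.continuous_on[OF assms(1)])
next
  case (Suc k)
  show ?case
    by (rule Ck_SucI[where D="\<lambda>x v. L (frechet_derivative f (at x) v)"])
      (use Suc in \<open>auto intro!: bounded_linear.has_derivative[OF assms(1)] Ck_has_derivative[of k]\<close>)
qed

lemma Ck_add: "Ck k f \<Longrightarrow> Ck k g \<Longrightarrow> Ck k (\<lambda>x. f x + g x)"
proof (induction k arbitrary: f g)
  case (Suc k)
  show ?case
    by (rule Ck_SucI[where D="\<lambda>x v. frechet_derivative f (at x) v + frechet_derivative g (at x) v"])
      (use Suc in \<open>auto intro!: has_derivative_add Ck_has_derivative[of k]\<close>)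
qed (auto intro: continuous_intros)

lemma Ck_bilinear:
  assumes "bounded_bilinear b" "Ck k f" "Ck k g"
  shows "Ck k (\<lambda>x. b (f x) (g x))"
proof -
  interpret bounded_bilinear b by fact
  show ?thesis using assms(2,3)
  proof (induction k arbitrary: f g)
    case 0
    then show ?case by (auto intro: continuous_on)
  next
    case (Suc k)
    have "Ck k f" "Ck k g"
      using Suc.prems by (blast intro: Ck_Suc_D)+
    moreover have "Ck k (\<lambda>x. frechet_derivative f (at x) v)" "Ck k (\<lambda>x. frechet_derivative g (at x) v)" for v
      using Suc.prems by simp_all
    ultimately have "Ck k (\<lambda>x. b (f x) (frechet_derivative g (at x) v) + b (frechet_derivative f (at x) v) (g x))" for v
      by (intro Ck_add Suc.IH)
    then show ?case
      by (intro Ck_SucI[OF FDERIV[OF Ck_has_derivative[OF Suc.prems(1)] Ck_has_derivative[OF Suc.prems(2)]]])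
  qed
qed

lemmas Ck_scaleR = Ck_bilinear[OF bounded_bilinear_scaleR]
lemmas Ck_mult = Ck_bilinear[OF bounded_bilinear_mult]
lemmas Ck_inner = Ck_bilinear[OF bounded_bilinear_inner]

lemma Ck_minus: "Ck k f \<Longrightarrow> Ck k (\<lambda>x. - f x)"
  by (rule Ck_linear_compose[of uminus]) (auto intro: bounded_linear_minus[OF bounded_linear_ident])

lemma Ck_diff: "Ck k f \<Longrightarrow> Ck k g \<Longrightarrow> Ck k (\<lambda>x. f x - g x)"
  using Ck_add[OF _ Ck_minus, of k f g] by simp

lemma Ck_sum: "(\<And>i. i \<in> I \<Longrightarrow> Ck k (f i)) \<Longrightarrow> Ck k (\<lambda>x. \<Sum>i\<in>I. f i x)"
  by (induction I rule: infinite_finite_induct) (auto intro: Ck_add)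

lemma Ck_compose:
  fixes f :: "'b::euclidean_space \<Rightarrow> 'c::real_normed_vector" and g :: "'a::euclidean_space \<Rightarrow> 'b"
  shows "Ck k f \<Longrightarrow> Ck k g \<Longrightarrow> Ck k (\<lambda>x. f (g x))"
proof (induction k arbitrary: f g)
  case 0
  then show ?case using continuous_on_compose2[of UNIV f UNIV g] by simp
next
  case (Suc k)
  let ?D = "\<lambda>x v. frechet_derivative f (at (g x)) (frechet_derivative g (at x) v)"
  have f: "(f has_derivative frechet_derivative f (at y)) (at y)"
    and g: "(g has_derivative frechet_derivative g (at x)) (at x)" for x y
    using Suc.prems by (auto intro!: Ck_has_derivative[of k])
  \<comment> \<open>\<open>Ck\<close> controls derivatives in fixed directions, whereas the chain
    rule applies the derivative of \<open>f\<close> to a direction that varies with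
    \<open>x\<close>. Expanding that direction in the basis leaves sums of products to which the
    induction hypothesis applies.\<close>
  have "?D x v = (\<Sum>b\<in>Basis. (frechet_derivative g (at x) v \<bullet> b) *\<^sub>R frechet_derivative f (at (g x)) b)" for x v
  proof -
    interpret bounded_linear "frechet_derivative f (at (g x))"
      by (rule has_derivative_bounded_linear[OF f])
    show ?thesis
      by (subst euclidean_representation[symmetric, of "frechet_derivative g (at x) v"])
        (simp only: sum scaleR)
  qed
  moreover have "Ck k (\<lambda>x. \<Sum>b\<in>Basis. (frechet_derivative g (at x) v \<bullet> b) *\<^sub>R frechet_derivative f (at (g x)) b)" for v
    using Suc.prems(1) Suc.prems(2)[THEN Ck_Suc_D] Suc.prems(2)
    by (intro Ck_sum Ck_scaleR Ck_inner Ck_const Suc.IH[of _ g]) simp_all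
  ultimately have "Ck k (\<lambda>x. ?D x v)" for v by presburger
  then show ?case
    by (intro Ck_SucI[where D="?D"] has_derivative_compose[OF g f])
qed

lemma Ck_inverse:
  fixes f :: "'a::euclidean_space \<Rightarrow> real"
  assumes nz: "\<And>x. f x \<noteq> 0"
  shows "Ck k f \<Longrightarrow> Ck k (\<lambda>x. inverse (f x))"
proof (induction k)
  case 0
  then show ?case using nz by (auto intro: continuous_intros)
next
  case (Suc k)
  have f: "(f has_derivative frechet_derivative f (at x)) (at x)" for x
    using Suc.prems by (rule Ck_has_derivative)
  have "Ck k (\<lambda>x. inverse (f x))" by (rule Suc.IH[OF Ck_Suc_D[OF Suc.prems]])
  then show ?case
    using Suc.prems
    by (intro Ck_SucI[where D="\<lambda>x v. - (inverse (f x) * frechet_derivative f (at x) v * inverse (f x))"]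
       Deriv.has_derivative_inverse[OF nz f] Ck_minus Ck_mult) simp_all
qed

lemma Ck_sqrt:
  fixes f :: "'a::euclidean_space \<Rightarrow> real"
  assumes pos: "\<And>x. f x > 0"
  shows "Ck k f \<Longrightarrow> Ck k (\<lambda>x. sqrt (f x))"
proof (induction k)
  case 0
  then show ?case by (auto intro: continuous_intros)
next
  case (Suc k)
  have f: "(f has_derivative frechet_derivative f (at x)) (at x)" for x
    using Suc.prems by (rule Ck_has_derivative)
  have ck: "Ck k (\<lambda>x. sqrt (f x))" by (rule Suc.IH[OF Ck_Suc_D[OF Suc.prems]])
  have nz: "sqrt (f x) \<noteq> 0" for x using pos[of x] by simp
  show ?case
  proof (rule Ck_SucI[where D="\<lambda>x v. inverse (sqrt (f x)) / 2 * frechet_derivative f (at x) v"])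
    show "((\<lambda>x. sqrt (f x)) has_derivative (\<lambda>v. inverse (sqrt (f x)) / 2 * frechet_derivative f (at x) v)) (at x)" for x
      using has_derivative_real_sqrt[OF pos f, of x] by (simp add: mult.commute)
    show "Ck k (\<lambda>x. inverse (sqrt (f x)) / 2 * frechet_derivative f (at x) v)" for v
      unfolding divide_inverse
      using Suc.prems by (intro Ck_mult Ck_inverse[OF nz] ck Ck_const) simp
  qed
qed

section \<open>Integrals depending on a parameter\<close>

lemma continuous_on_integral_parameter:
  fixes K :: "'a::euclidean_space \<times> 'b::euclidean_space \<Rightarrow> 'c::banach"
  assumes "continuous_on UNIV K"
  shows "continuous_on UNIV (\<lambda>z. integral (cbox a b) (\<lambda>s. K (z, s)))"
proof -
  have "continuous_on (UNIV \<times> cbox a b) (\<lambda>(z, s). K (z, s))"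
    using continuous_on_subset[OF assms] by simp
  from integral_continuous_on_param[OF this] show ?thesis .
qed

lemma has_derivative_integral_parameter:
  fixes K :: "'a::euclidean_space \<times> 'b::euclidean_space \<Rightarrow> 'c::banach"
  assumes K: "Ck (Suc 0) K"
  shows "((\<lambda>z. integral (cbox a b) (\<lambda>s. K (z, s))) has_derivative
    (\<lambda>v. integral (cbox a b) (\<lambda>s. frechet_derivative K (at (z, s)) (v, 0)))) (at z)"
proof -
  let ?D = "\<lambda>z s v. frechet_derivative K (at (z, s)) (v, 0)"
  have d: "(K has_derivative frechet_derivative K (at x)) (at x)" for x
    using K by (rule Ck_has_derivative)
  have d': "((\<lambda>z. K (z, s)) has_derivative ?D z s) (at z)" for z s
    by (rule has_derivative_compose[where g=K, OF _ d]) (auto intro!: derivative_eq_intros)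
  have bl: "bounded_linear (?D z s)" for z s by (rule has_derivative_bounded_linear[OF d'])
  \<comment> \<open>\<open>leibniz_rule\<close> asks for the derivative as a continuous map into the
    bounded linear maps; in finite dimension this may be tested on each vector separately.\<close>
  define fx where "fx z s = Blinfun (?D z s)" for z s
  have fx: "blinfun_apply (fx z s) = ?D z s" for z s
    unfolding fx_def by (rule bounded_linear_Blinfun_apply[OF bl])
  have cont: "continuous_on UNIV (\<lambda>x. frechet_derivative K (at x) w)" for w
    using K by (auto simp del: split_paired_All)
  have cfx: "continuous_on (UNIV \<times> cbox a b) (\<lambda>(z, s). fx z s)"
    by (rule continuous_on_blinfun_componentwise)
      (use cont in \<open>auto simp: fx split_beta' intro: continuous_on_subset\<close>)
  have "continuous_on UNIV K" using K by (rule Ck_continuous)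
  then have ci: "continuous_on UNIV (\<lambda>s. K (z, s))" for z
    by (rule continuous_on_compose2) (auto intro: continuous_intros)
  have "((\<lambda>z. integral (cbox a b) (\<lambda>s. K (z, s))) has_derivative integral (cbox a b) (fx z)) (at z within UNIV)"
    by (rule leibniz_rule[OF _ _ cfx])
      (auto simp: fx intro: d' integrable_continuous continuous_on_subset[OF ci])
  moreover have "fx z integrable_on cbox a b"
  proof (rule integrable_continuous)
    have "continuous_on (cbox a b) ((\<lambda>(z, s). fx z s) \<circ> Pair z)"
      by (intro continuous_on_compose continuous_on_subset[OF cfx] continuous_intros) auto
    then show "continuous_on (cbox a b) (fx z)" by (simp add: o_def)
  qed
  then have "blinfun_apply (integral (cbox a b) (fx z)) = (\<lambda>v. integral (cbox a b) (\<lambda>s. ?D z s v))"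
    by (simp add: fun_eq_iff blinfun_apply_integral fx)
  ultimately show ?thesis by simp
qed

lemma Ck_integral:
  fixes K :: "'a::euclidean_space \<times> 'b::euclidean_space \<Rightarrow> 'c::banach"
  shows "Ck k K \<Longrightarrow> Ck k (\<lambda>z. integral (cbox a b) (\<lambda>s. K (z, s)))"
proof (induction k arbitrary: K)
  case 0
  then show ?case using continuous_on_integral_parameter by simp
next
  case (Suc k)
  have "Ck (Suc 0) K" using Suc.prems by (auto dest: Ck_continuous)
  then show ?case
    using Suc.prems
    by (intro Ck_SucI[OF has_derivative_integral_parameter] Suc.IH) simp_all
qed

section \<open>Closure properties of smooth maps\<close>

lemma smooth_Ck: "smooth f \<Longrightarrow> Ck k f"
  by (simp add: smooth_def)

lemma smooth_continuous: "smooth f \<Longrightarrow> continuous_on UNIV f"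
  using smooth_Ck[of f 0] by simp

lemma smooth_has_derivative: "smooth f \<Longrightarrow> (f has_derivative frechet_derivative f (at x)) (at x)"
  using Ck_has_derivative smooth_Ck by blast

lemma smooth_frechet: "smooth f \<Longrightarrow> smooth (\<lambda>x. frechet_derivative f (at x) v)"
  unfolding smooth_def by (metis Ck.simps(2))

lemma smooth_frechet_continuous: "smooth f \<Longrightarrow> continuous_on UNIV (\<lambda>x. frechet_derivative f (at x) v)"
  by (intro smooth_continuous smooth_frechet)

lemma smooth_const: "smooth (\<lambda>x. c)"
  by (simp add: smooth_def)

lemma smooth_add: "smooth f \<Longrightarrow> smooth f' \<Longrightarrow> smooth (\<lambda>x. f x + f' x)"
  by (simp add: smooth_def Ck_add)

lemma smooth_diff: "smooth f \<Longrightarrow> smooth f' \<Longrightarrow> smooth (\<lambda>x. f x - f' x)"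
  by (simp add: smooth_def Ck_diff)

lemma smooth_minus: "smooth f \<Longrightarrow> smooth (\<lambda>x. - f x)"
  by (simp add: smooth_def Ck_minus)

lemma smooth_sum: "(\<And>i. i \<in> I \<Longrightarrow> smooth (F i)) \<Longrightarrow> smooth (\<lambda>x. \<Sum>i\<in>I. F i x)"
  unfolding smooth_def by (blast intro: Ck_sum)

lemma smooth_linear: "bounded_linear L \<Longrightarrow> smooth f \<Longrightarrow> smooth (\<lambda>x. L (f x))"
  by (simp add: smooth_def Ck_linear_compose)

lemma smooth_bounded_linear: "bounded_linear L \<Longrightarrow> smooth L"
  by (simp add: smooth_def Ck_bounded_linear)

lemma smooth_ident: "smooth (\<lambda>x. x)"
  by (rule smooth_bounded_linear[OF bounded_linear_ident])

lemma smooth_bilinear: "bounded_bilinear b \<Longrightarrow> smooth f \<Longrightarrow> smooth f' \<Longrightarrow> smooth (\<lambda>x. b (f x) (f' x))"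
  by (simp add: smooth_def Ck_bilinear)

lemmas smooth_scaleR = smooth_bilinear[OF bounded_bilinear_scaleR]
lemmas smooth_mult = smooth_bilinear[OF bounded_bilinear_mult]
lemmas smooth_inner = smooth_bilinear[OF bounded_bilinear_inner]

lemma smooth_compose: "smooth f \<Longrightarrow> smooth f' \<Longrightarrow> smooth (\<lambda>x. f (f' x))"
  by (simp add: smooth_def Ck_compose)

lemma smooth_inverse: "(\<And>x. f x \<noteq> 0) \<Longrightarrow> smooth f \<Longrightarrow> smooth (\<lambda>x. inverse (f x :: real))"
  and smooth_sqrt: "(\<And>x. f x > 0) \<Longrightarrow> smooth f \<Longrightarrow> smooth (\<lambda>x. sqrt (f x))"
  by (simp_all add: smooth_def Ck_inverse Ck_sqrt)

lemma smooth_integral: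
  fixes K :: "'a::euclidean_space \<times> 'b::euclidean_space \<Rightarrow> 'c::banach"
  shows "smooth K \<Longrightarrow> smooth (\<lambda>z. integral (cbox a b) (\<lambda>s. K (z, s)))"
  by (simp add: smooth_def Ck_integral)

lemma smooth_vec_nth: "smooth f \<Longrightarrow> smooth (\<lambda>x. f x $ i)"
  by (rule smooth_linear[OF bounded_linear_vec_nth])

lemma smooth_vec_lambda:
  fixes f :: "'n::finite \<Rightarrow> 'a::euclidean_space \<Rightarrow> real"
  assumes "\<And>i. smooth (f i)"
  shows "smooth (\<lambda>x. \<chi> i. f i x)"
proof -
  have "(\<lambda>x. \<chi> i. f i x) = (\<lambda>x. \<Sum>i\<in>UNIV. f i x *\<^sub>R axis i 1)"
    by (auto simp: vec_eq_iff axis_def if_distrib cong: if_cong)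
  then show ?thesis
    using assms by (auto intro!: smooth_sum smooth_scaleR smooth_const)
qed

lemma smooth_Pair:
  fixes f :: "'a::euclidean_space \<Rightarrow> 'b::real_normed_vector" and f' :: "'a \<Rightarrow> 'c::real_normed_vector"
  assumes "smooth f" "smooth f'" shows "smooth (\<lambda>x. (f x, f' x))"
proof -
  have "smooth (\<lambda>x. (f x, 0::'c) + (0::'b, f' x))"
    by (intro smooth_add smooth_linear[of "\<lambda>y. (y, 0)" f] smooth_linear[of "\<lambda>y. (0, y)" f'] assms
        bounded_linear_Pair bounded_linear_ident bounded_linear_zero)
  then show ?thesis by simp
qed

lemma smooth_fst: "smooth f \<Longrightarrow> smooth (\<lambda>x. fst (f x))"
  and smooth_snd: "smooth f \<Longrightarrow> smooth (\<lambda>x. snd (f x))"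
  using smooth_linear[OF bounded_linear_fst] smooth_linear[OF bounded_linear_snd] by blast+

lemmas smooth_intros = smooth_const smooth_ident smooth_add smooth_diff smooth_minus smooth_sum smooth_scaleR
  smooth_mult smooth_inner smooth_vec_nth smooth_vec_lambda smooth_Pair smooth_fst smooth_snd

section \<open>Functions and curves on the torus\<close>

definition lattice2 :: "(real^2) set" where
  "lattice2 = {k. \<forall>i. k $ i \<in> \<int>}"

definition periodic :: "(real^2 \<Rightarrow> 'b) \<Rightarrow> bool" where
  "periodic f \<longleftrightarrow> (\<forall>x. \<forall>k\<in>lattice2. f (x + k) = f x)"

lemma proj_eq_lattice: "proj x = proj y \<longleftrightarrow> x - y \<in> lattice2"
  by (simp add: proj_eq_iff lattice2_def)

lemma lattice2_0 [simp]: "0 \<in> lattice2"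
  and lattice2_diff: "k \<in> lattice2 \<Longrightarrow> l \<in> lattice2 \<Longrightarrow> k - l \<in> lattice2"
  and lattice2_minus: "k \<in> lattice2 \<Longrightarrow> - k \<in> lattice2"
  by (simp_all add: lattice2_def)

lemma lattice2_axis: "axis i 1 \<in> lattice2"
  by (auto simp: lattice2_def axis_def)

lemma proj_add_lattice [simp]: "k \<in> lattice2 \<Longrightarrow> proj (x + k) = proj x"
  by (simp add: proj_eq_lattice)

lemma proj_cases: obtains x where "p = proj x"
  by (metis proj_rep_torus)

lemma periodic_proj: "periodic (\<lambda>x. f (proj x))"
  by (simp add: periodic_def)

lemma periodicD: "periodic f \<Longrightarrow> k \<in> lattice2 \<Longrightarrow> f (x + k) = f x"
  by (simp add: periodic_def)

lemma periodic_eq: "periodic f \<Longrightarrow> proj x = proj y \<Longrightarrow> f x = f y"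
  unfolding proj_eq_lattice using periodicD[of f "x - y" y] by simp

lemma periodic_rep_torus: "periodic f \<Longrightarrow> f (rep_torus (proj x)) = f x"
  by (rule periodic_eq) simp_all

lemma norm_lattice2_ge_1:
  assumes "k \<in> lattice2" "k \<noteq> 0" shows "1 \<le> norm k"
proof -
  obtain i where "k $ i \<noteq> 0" using assms(2) by (auto simp: vec_eq_iff)
  moreover have "k $ i \<in> \<int>" using assms(1) by (simp add: lattice2_def)
  ultimately have "1 \<le> \<bar>k $ i\<bar>" by (rule Ints_nonzero_abs_ge1[rotated])
  also have "\<dots> \<le> norm k" by (rule component_le_norm_cart)
  finally show ?thesis .
qed

text \<open>A continuous integer-valued function on a connected set is constant. Since two lifts of
  one map differ by lattice vectors, this is the tool for comparing lifts, in space as well as in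
  time.\<close>

lemma lattice2_valued_constant:
  fixes u :: "'a::topological_space \<Rightarrow> real^2"
  assumes "connected S" "continuous_on S u" "\<And>x. x \<in> S \<Longrightarrow> u x \<in> lattice2" "x \<in> S" "y \<in> S"
  shows "u x = u y"
proof -
  have "(\<lambda>x. u x $ i) constant_on S" for i
  proof (rule continuous_discrete_range_constant[OF assms(1)])
    show "continuous_on S (\<lambda>x. u x $ i)" by (intro continuous_intros assms(2))
    have "u x $ i \<in> \<int>" if "x \<in> S" for x using assms(3)[OF that] by (simp add: lattice2_def)
    then show "\<exists>e>0. \<forall>y. y \<in> S \<and> u y $ i \<noteq> u x $ i \<longrightarrow> e \<le> norm (u y $ i - u x $ i)" if "x \<in> S" for x
      using that by (intro exI[of _ 1]) (auto intro!: Ints_nonzero_abs_ge1)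
  qed
  then show ?thesis
    using assms(4,5) unfolding constant_on_def vec_eq_iff by metis
qed

text \<open>The universal property of the quotient topology; it moves continuity questions to the
  plane.\<close>

lemma continuous_on_torus_iff:
  "continuous_on UNIV f \<longleftrightarrow> continuous_on UNIV (\<lambda>x. f (proj x))"
proof
  show "continuous_on UNIV f \<Longrightarrow> continuous_on UNIV (\<lambda>x. f (proj x))"
    by (rule continuous_on_compose2[OF _ continuous_on_proj]) auto
next
  assume "continuous_on UNIV (\<lambda>x. f (proj x))"
  then have "open (proj -` f -` B)" if "open B" for B
    using that by (simp add: continuous_on_open_vimage vimage_def)
  then show "continuous_on UNIV f"
    by (simp add: continuous_on_open_vimage flip: open_torus_iff_quotient)
qed

lemma periodic_continuous_bounded:
  fixes f :: "real^2 \<Rightarrow> 'b::real_normed_vector"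
  assumes "periodic f" "continuous_on UNIV f"
  obtains B where "B > 0" "\<And>x. norm (f x) \<le> B"
proof -
  have eq: "f x = f (rep_torus (proj x))" for x using periodic_rep_torus[OF assms(1)] by simp
  have "continuous_on UNIV (\<lambda>p. f (rep_torus p))"
    unfolding continuous_on_torus_iff using assms(2) by (simp flip: eq)
  then have "bounded (range (\<lambda>p. f (rep_torus p)))"
    using compact_UNIV_torus compact_continuous_image compact_imp_bounded by blast
  then obtain B where "B > 0" "\<And>p. norm (f (rep_torus p)) \<le> B"
    unfolding bounded_pos by auto
  then show thesis using that eq by metis
qed

lemma has_derivative_translate:
  "(f has_derivative D) (at (x + k)) \<longleftrightarrow> ((\<lambda>x. f (x + k)) has_derivative D) (at x)"
proof
  assume "(f has_derivative D) (at (x + k))"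
  then show "((\<lambda>x. f (x + k)) has_derivative D) (at x)"
    by (rule has_derivative_compose[rotated]) (auto intro!: derivative_eq_intros)
next
  assume "((\<lambda>x. f (x + k)) has_derivative D) (at x)"
  then have "((\<lambda>x. f (x + k)) has_derivative D) (at (x + k - k))" by simp
  then have "((\<lambda>x. f (x - k + k)) has_derivative D) (at (x + k))"
    by (rule has_derivative_compose[rotated]) (auto intro!: derivative_eq_intros)
  then show "(f has_derivative D) (at (x + k))" by simp
qed

text \<open>\<open>frechet_derivative\<close> chooses from the set of derivatives at a point, and
  this set is the same at points that differ by a lattice vector. So the value is periodic whether
  or not a derivative exists.\<close>

lemma periodic_frechet:
  assumes "periodic f" shows "periodic (\<lambda>x. frechet_derivative f (at x) v)"
  using assms by (simp add: periodic_def frechet_derivative_def has_derivative_translate)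

lemma partial_proj: "partial i f (proj x) = frechet_derivative (\<lambda>x. f (proj x)) (at x) (axis i 1)"
  unfolding partial_def
  by (rule periodic_rep_torus[OF periodic_frechet]) (rule periodic_proj)

text \<open>\<open>velocity\<close> refers to a lift picked by a choice operator. Any lift at hand
  differs from it by a constant on the unit interval, hence has the same derivative, one-sided at
  the ends.\<close>

lemma velocity_lift:
  assumes \<gamma>: "continuous_on {0..1} \<gamma>" "\<And>t. t \<in> {0..1} \<Longrightarrow> proj (\<gamma> t) = c t"
    and t: "t \<in> {0..1}" and d: "(\<gamma> has_vector_derivative d) (at t within {0..1})"
  shows "velocity c t = d"
proof -
  let ?l = "lift_curve c"
  have l: "continuous_on {0..1} ?l \<and> (\<forall>t\<in>{0..1}. proj (?l t) = c t)"
    unfolding lift_curve_def by (rule someI[of _ \<gamma>]) (use \<gamma> in simp)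
  have "?l s - \<gamma> s = ?l t - \<gamma> t" if "s \<in> {0..1}" for s
    by (rule lattice2_valued_constant[of "{0..1}" "\<lambda>s. ?l s - \<gamma> s"])
      (use l \<gamma> t that in \<open>auto intro!: continuous_intros simp flip: proj_eq_lattice\<close>)
  then have eq: "\<gamma> s + (?l t - \<gamma> t) = ?l s" if "s \<in> {0..1}" for s
    using that by (metis diff_add_cancel add.commute)
  have "((\<lambda>s. \<gamma> s + (?l t - \<gamma> t)) has_vector_derivative d) (at t within {0..1})"
    using d by (auto intro!: derivative_eq_intros)
  then have "(?l has_vector_derivative d) (at t within {0..1})"
    by (rule has_vector_derivative_transform[OF t, rotated]) (simp add: eq)
  then show ?thesis
    unfolding velocity_def using vector_derivative_within_cbox[of 0 1 t] t by simp
qed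

section \<open>Integration on the torus\<close>

lemma proj_measurable: "proj \<in> borel_measurable (restrict_space lborel (cbox 0 1))"
  by (rule measurable_restrict_space1) (simp add: borel_measurable_continuous_onI continuous_on_proj)

lemma integral_torus_measure:
  fixes f :: "torus \<Rightarrow> 'b::euclidean_space"
  assumes "continuous_on UNIV f"
  shows "(LINT p|torus_measure. f p) = integral (cbox 0 1) (\<lambda>x. f (proj x))"
proof -
  have f: "continuous_on (cbox 0 1) (\<lambda>x. f (proj x))"
    using assms continuous_on_torus_iff continuous_on_subset by blast
  have s: "set_integrable lborel (cbox 0 1) (\<lambda>x. f (proj x))"
    unfolding set_integrable_def by (rule borel_integrable_compact[OF compact_cbox f])
  have "(LINT p|torus_measure. f p) = (LINT x|restrict_space lborel (cbox 0 1). f (proj x))"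
    unfolding torus_measure_def using assms
    by (intro integral_distr proj_measurable borel_measurable_continuous_onI)
  also have "\<dots> = (LINT x:cbox 0 1|lborel. f (proj x))"
    by (simp add: integral_restrict_space set_lebesgue_integral_def)
  finally show ?thesis by (simp add: set_borel_integral_eq_integral(2)[OF s])
qed

text \<open>The translated cell is cut where \<open>x $ i = 1\<close>. Moved back by one period, the
  part beyond the cut is \<open>cbox 0 c\<close>, exactly the slab of width \<open>s\<close> that
  the translation has left.\<close>

lemma integral_periodic_translate_nonneg:
  fixes f :: "real^2 \<Rightarrow> 'b::banach"
  assumes f: "periodic f" "continuous_on UNIV f" and s: "0 \<le> s" "s \<le> 1"
  shows "integral (cbox 0 1) (\<lambda>x. f (x + s *\<^sub>R axis i 1)) = integral (cbox 0 1) f"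
proof -
  let ?k = "axis i 1 :: real^2"
  define c :: "real^2" where "c = (\<chi> j. if j = i then s else 1)"
  have int: "f integrable_on cbox a b" for a b
    by (rule integrable_continuous) (rule continuous_on_subset[OF f(2)], simp)
  have kB: "?k \<in> Basis" by simp
  have ip: "x \<bullet> ?k = x $ i" for x by (simp add: inner_axis)
  have ax: "(axis i 1 :: real^2) $ j = (if j = i then 1 else 0)" for i j by (simp add: axis_def)
  have mem: "x \<in> cbox a b \<longleftrightarrow> a $ 1 \<le> x $ 1 \<and> x $ 1 \<le> b $ 1 \<and> a $ 2 \<le> x $ 2 \<and> x $ 2 \<le> b $ 2"
    for a b x :: "real^2" by (auto simp: mem_box_cart forall_2)
  have "integral (cbox 0 1) (\<lambda>x. f (x + s *\<^sub>R ?k)) = integral (cbox (s *\<^sub>R ?k) (1 + s *\<^sub>R ?k)) f"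
    using integral_shift_cbox_plus[of 0 1 f "s *\<^sub>R ?k"] by (simp add: o_def add.commute)
  also have "\<dots> = integral (cbox (s *\<^sub>R ?k) (1 + s *\<^sub>R ?k) \<inter> {x. x \<bullet> ?k \<le> 1}) f
      + integral (cbox (s *\<^sub>R ?k) (1 + s *\<^sub>R ?k) \<inter> {x. x \<bullet> ?k \<ge> 1}) f"
    by (rule integral_split[OF int kB])
  also have "cbox (s *\<^sub>R ?k) (1 + s *\<^sub>R ?k) \<inter> {x. x \<bullet> ?k \<le> 1} = cbox 0 1 \<inter> {x. x \<bullet> ?k \<ge> s}"
    using s exhaust_2[of i] by (auto simp: mem ip ax)
  also have "cbox (s *\<^sub>R ?k) (1 + s *\<^sub>R ?k) \<inter> {x. x \<bullet> ?k \<ge> 1} = cbox (0 + ?k) (c + ?k)"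
    using s exhaust_2[of i] by (auto simp: mem ip ax c_def)
  also have "integral (cbox (0 + ?k) (c + ?k)) f = integral (cbox 0 c) (f \<circ> (+) ?k)"
    by (rule integral_shift_cbox_plus[symmetric])
  also have "f \<circ> (+) ?k = f"
    using f(1) lattice2_axis[of i] by (auto simp: fun_eq_iff periodic_def add.commute[of ?k])
  also have "cbox 0 c = cbox 0 1 \<inter> {x. x \<bullet> ?k \<le> s}"
    using s exhaust_2[of i] by (auto simp: mem ip c_def)
  also have "integral (cbox 0 1 \<inter> {x. x \<bullet> ?k \<ge> s}) f + integral (cbox 0 1 \<inter> {x. x \<bullet> ?k \<le> s}) f = integral (cbox 0 1) f"
    using integral_split[OF int kB, of 0 1 s] by simp
  finally show ?thesis .
qed

lemma periodic_translate: "periodic f \<Longrightarrow> periodic (\<lambda>x. f (x + a))"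
  unfolding periodic_def by (metis add.assoc add.commute)

lemma integral_periodic_translate:
  fixes f :: "real^2 \<Rightarrow> 'b::banach"
  assumes f: "periodic f" "continuous_on UNIV f" and s: "\<bar>s\<bar> \<le> 1"
  shows "integral (cbox 0 1) (\<lambda>x. f (x + s *\<^sub>R axis i 1)) = integral (cbox 0 1) f"
proof (cases "0 \<le> s")
  case True
  then show ?thesis using integral_periodic_translate_nonneg[OF f] s by simp
next
  case False
  have "continuous_on UNIV (\<lambda>x. f (x + s *\<^sub>R axis i 1))"
    by (rule continuous_on_compose2[OF f(2)]) (auto intro: continuous_intros)
  from integral_periodic_translate_nonneg[OF periodic_translate[OF f(1)] this, of "- s" i]
  show ?thesis using False s by (simp add: algebra_simps)
qed

lemma has_derivative_integral_parameter_eq: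
  fixes K :: "'a::euclidean_space \<times> 'b::euclidean_space \<Rightarrow> 'c::banach"
  assumes K: "smooth K" and D: "\<And>s. ((\<lambda>z. K (z, s)) has_derivative D s) (at z)"
  shows "((\<lambda>z. integral (cbox a b) (\<lambda>s. K (z, s))) has_derivative
    (\<lambda>v. integral (cbox a b) (\<lambda>s. D s v))) (at z)"
proof -
  have "frechet_derivative K (at (z, s)) (v, 0) = D s v" for s v
  proof -
    have "((\<lambda>z. K (z, s)) has_derivative (\<lambda>v. frechet_derivative K (at (z, s)) (v, 0))) (at z)"
      by (rule has_derivative_compose[OF _ smooth_has_derivative[OF K]]) (auto intro!: derivative_eq_intros)
    then show ?thesis using has_derivative_unique[OF D] by metis
  qed
  then show ?thesis
    using has_derivative_integral_parameter[OF smooth_Ck[OF K], of a b z] by simp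
qed

lemma has_derivative_along_line:
  assumes "smooth f"
  shows "((\<lambda>s. f (x + s *\<^sub>R v)) has_derivative (\<lambda>h. h *\<^sub>R frechet_derivative f (at x) v)) (at 0)"
proof -
  have d: "(f has_derivative frechet_derivative f (at (x + 0 *\<^sub>R v))) (at (x + 0 *\<^sub>R v))"
    by (rule smooth_has_derivative[OF assms])
  then interpret bounded_linear "frechet_derivative f (at (x + 0 *\<^sub>R v))"
    by (rule has_derivative_bounded_linear)
  have "((\<lambda>s. x + s *\<^sub>R v) has_derivative (\<lambda>h. h *\<^sub>R v)) (at 0)"
    by (auto intro!: derivative_eq_intros)
  from has_derivative_compose[OF this d] scaleR show ?thesis by simp
qed

text \<open>The integral over a cell is unchanged when a periodic function is translated; the
  integral of the partial derivative is the derivative of this constant.\<close>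

lemma integral_periodic_partial:
  fixes F :: "real^2 \<Rightarrow> real"
  assumes "smooth F" "periodic F"
  shows "integral (cbox 0 1) (\<lambda>x. frechet_derivative F (at x) (axis i 1)) = 0"
proof -
  let ?k = "axis i 1 :: real^2"
  let ?I = "\<lambda>s. integral (cbox 0 1) (\<lambda>x. F (x + s *\<^sub>R ?k))"
  have K: "smooth (\<lambda>z. F (snd z + fst z *\<^sub>R ?k))"
    by (intro smooth_compose[OF assms(1)] smooth_intros)
  have "(?I has_derivative (\<lambda>h. integral (cbox 0 1) (\<lambda>x. h *\<^sub>R frechet_derivative F (at x) ?k))) (at 0)"
    using has_derivative_integral_parameter_eq[OF K, of "\<lambda>x h. h *\<^sub>R frechet_derivative F (at x) ?k" 0 0 1]
      has_derivative_along_line[OF assms(1)] by simp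
  moreover have "(?I has_derivative (\<lambda>h. 0)) (at 0)"
  proof (rule has_derivative_transform_within_open[OF has_derivative_const[of "integral (cbox 0 1) F"]])
    show "open (ball (0::real) 1)" "(0::real) \<in> ball 0 1" by auto
    show "integral (cbox 0 1) F = ?I s" if "s \<in> ball 0 1" for s
      using integral_periodic_translate[OF assms(2) smooth_continuous[OF assms(1)], of s i] that by simp
  qed
  ultimately have "(\<lambda>h. integral (cbox 0 1) (\<lambda>x. h *\<^sub>R frechet_derivative F (at x) ?k)) = (\<lambda>h. 0)"
    by (rule has_derivative_unique)
  from fun_cong[OF this, of 1] show ?thesis by simp
qed

lemma frechet_derivative_mult_real:
  fixes f u :: "'a::euclidean_space \<Rightarrow> real"
  assumes "smooth f" "smooth u"
  shows "frechet_derivative (\<lambda>x. f x * u x) (at x) v =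
    f x * frechet_derivative u (at x) v + frechet_derivative f (at x) v * u x"
  by (rule fun_cong[OF frechet_derivative_at[symmetric],
      OF has_derivative_mult[OF smooth_has_derivative[OF assms(1)] smooth_has_derivative[OF assms(2)]]])

lemma integral_by_parts_periodic:
  fixes f u :: "real^2 \<Rightarrow> real"
  assumes "smooth f" "smooth u" "periodic f" "periodic u"
  shows "integral (cbox 0 1) (\<lambda>x. frechet_derivative f (at x) (axis i 1) * u x) =
    - integral (cbox 0 1) (\<lambda>x. f x * frechet_derivative u (at x) (axis i 1))"
proof -
  let ?D = "\<lambda>f x. frechet_derivative f (at x) (axis i 1 :: real^2) :: real"
  have c: "continuous_on S f" "continuous_on S u" "continuous_on S (?D f)" "continuous_on S (?D u)" for S
    using assms by (auto intro: continuous_on_subset smooth_continuous smooth_frechet_continuous)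
  have "0 = integral (cbox 0 1) (?D (\<lambda>x. f x * u x))"
    using assms by (intro integral_periodic_partial[symmetric] smooth_mult) (auto simp: periodic_def)
  also have "\<dots> = integral (cbox 0 1) (\<lambda>x. f x * ?D u x + ?D f x * u x)"
    by (simp add: frechet_derivative_mult_real assms)
  also have "\<dots> = integral (cbox 0 1) (\<lambda>x. f x * ?D u x) + integral (cbox 0 1) (\<lambda>x. ?D f x * u x)"
    by (intro Henstock_Kurzweil_Integration.integral_add integrable_continuous continuous_intros c)
  finally show ?thesis by simp
qed

text \<open>Differentiating a shifted integral avoids the symmetry of second derivatives.\<close>

lemma integral_partial_partial:
  fixes f u :: "real^2 \<Rightarrow> real"
  assumes f: "smooth f" "periodic f" and u: "smooth u" "periodic u"
  shows "integral (cbox 0 1) (\<lambda>x. frechet_derivative f (at x) (axis j 1) * frechet_derivative u (at x) (axis i 1)) =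
    integral (cbox 0 1) (\<lambda>x. frechet_derivative f (at x) (axis i 1) * frechet_derivative u (at x) (axis j 1))"
proof -
  let ?D = "\<lambda>i f x. frechet_derivative f (at x) (axis i 1 :: real^2) :: real"
  let ?k = "axis i 1 :: real^2"
  let ?J = "\<lambda>s. integral (cbox 0 1) (\<lambda>x. ?D j f x * u (x + s *\<^sub>R ?k))"
  let ?L = "\<lambda>s. integral (cbox 0 1) (\<lambda>x. f (x - s *\<^sub>R ?k) * ?D j u x)"
  have sD: "smooth (?D j f)" "smooth (?D j u)" by (intro smooth_frechet f u)+
  have sh: "smooth (\<lambda>x. u (x + a))" "smooth (\<lambda>x. f (x - a))" for a
    by (intro smooth_compose[OF u(1)] smooth_compose[OF f(1)] smooth_intros)+
  have "smooth (\<lambda>z. ?D j f (snd z) * u (snd z + fst z *\<^sub>R ?k))"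
    by (intro smooth_mult smooth_compose[OF sD(1)] smooth_compose[OF u(1)] smooth_intros)
  from has_derivative_integral_parameter_eq[OF this, of "\<lambda>x h. ?D j f x * (h *\<^sub>R ?D i u x)" 0 0 1]
  have J: "(?J has_derivative (\<lambda>h. integral (cbox 0 1) (\<lambda>x. ?D j f x * (h *\<^sub>R ?D i u x)))) (at 0)"
    using has_derivative_along_line[OF u(1), of _ ?k] by (simp add: has_derivative_mult_right)
  have "smooth (\<lambda>z. f (snd z - fst z *\<^sub>R ?k) * ?D j u (snd z))"
    by (intro smooth_mult smooth_compose[OF sD(2)] smooth_compose[OF f(1)] smooth_intros)
  note L0 = has_derivative_integral_parameter_eq[OF this, of "\<lambda>x h. (h *\<^sub>R ?D i f x) * - ?D j u x" 0 0 1]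
  have "((\<lambda>s. f (x - s *\<^sub>R ?k) * ?D j u x) has_derivative (\<lambda>h. (h *\<^sub>R ?D i f x) * - ?D j u x)) (at 0)" for x
  proof -
    have "((\<lambda>s. f (x + s *\<^sub>R - ?k)) has_derivative (\<lambda>h. h *\<^sub>R frechet_derivative f (at x) (- ?k))) (at 0)"
      by (rule has_derivative_along_line[OF f(1)])
    moreover have "frechet_derivative f (at x) (- ?k) = - ?D i f x"
      by (rule linear_neg[OF has_derivative_linear[OF smooth_has_derivative[OF f(1)]]])
    ultimately have "((\<lambda>s. f (x - s *\<^sub>R ?k)) has_derivative (\<lambda>h. - (h *\<^sub>R ?D i f x))) (at 0)" by simp
    from has_derivative_mult_left[OF this, of "?D j u x"] show ?thesis by simp
  qed
  with L0 have L: "(?L has_derivative (\<lambda>h. integral (cbox 0 1) (\<lambda>x. (h *\<^sub>R ?D i f x) * - ?D j u x))) (at 0)"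
    by simp
  \<comment> \<open>Integration by parts in direction \<open>j\<close>, followed by a translation of
    the variable, moves the derivative from \<open>f\<close> to \<open>u\<close> and the shift from
    \<open>u\<close> to \<open>f\<close>. Differentiating both sides at \<open>s = 0\<close> gives
    the claim.\<close>
  have JL: "?J s = - ?L s" if "\<bar>s\<bar> \<le> 1" for s
  proof -
    have pu: "periodic (\<lambda>x. u (x + s *\<^sub>R ?k))" by (rule periodic_translate[OF u(2)])
    have D: "?D j (\<lambda>x. u (x + a)) x = ?D j u (x + a)" for x a
      using smooth_has_derivative[OF u(1), of "x + a"] unfolding has_derivative_translate
      by (metis frechet_derivative_at)
    have "?J s = - integral (cbox 0 1) (\<lambda>x. f x * ?D j u (x + s *\<^sub>R ?k))"
      using integral_by_parts_periodic[OF f(1) sh(1) f(2) pu, of j] by (simp add: D)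
    also have "integral (cbox 0 1) (\<lambda>x. f x * ?D j u (x + s *\<^sub>R ?k)) =
        integral (cbox 0 1) (\<lambda>x. (\<lambda>y. f (y - s *\<^sub>R ?k) * ?D j u y) (x + s *\<^sub>R ?k))" by simp
    also have "\<dots> = ?L s"
    proof (rule integral_periodic_translate[OF _ _ that])
      show "periodic (\<lambda>y. f (y - s *\<^sub>R ?k) * ?D j u y)"
        using periodic_translate[OF f(2), of "- (s *\<^sub>R ?k)"] periodic_frechet[OF u(2)] by (simp add: periodic_def)
      show "continuous_on UNIV (\<lambda>y. f (y - s *\<^sub>R ?k) * ?D j u y)"
        by (intro smooth_continuous smooth_mult sh sD)
    qed
    finally show ?thesis .
  qed
  have "(?J has_derivative (\<lambda>h. - integral (cbox 0 1) (\<lambda>x. (h *\<^sub>R ?D i f x) * - ?D j u x))) (at 0)"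
    by (rule has_derivative_transform_within_open[OF has_derivative_minus[OF L], of "ball 0 1"])
      (use JL in auto)
  from fun_cong[OF has_derivative_unique[OF J this], of 1] show ?thesis by simp
qed

section \<open>Ordinary differential equations\<close>

text \<open>The expression is the integral of \<open>f\<close> from 0 to \<open>t\<close> after
  substituting \<open>t * r\<close>. In this form it covers negative \<open>t\<close>, and as a
  parameter integral over a fixed interval it is visibly smooth for smooth \<open>f\<close>.\<close>

lemma has_vector_derivative_primitive:
  fixes f :: "real \<Rightarrow> 'a::euclidean_space"
  assumes f: "continuous_on UNIV f"
  shows "((\<lambda>t. t *\<^sub>R integral {0..1} (\<lambda>r. f (t * r))) has_vector_derivative f t) (at t)"
proof -
  \<comment> \<open>The interval from \<open>-n\<close> to \<open>n\<close> contains 0 and has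
    \<open>t\<close> in its interior, so the derivative of the antiderivative at \<open>t\<close> is
    two-sided.\<close>
  define n where "n = \<bar>t\<bar> + 1"
  obtain A where A: "\<And>x. x \<in> {-n..n} \<Longrightarrow> (A has_vector_derivative f x) (at x within {-n..n})"
    using antiderivative_continuous continuous_on_subset[OF f subset_UNIV] by metis
  have eq: "A s - A 0 = s *\<^sub>R integral {0..1} (\<lambda>r. f (s * r))" if s: "s \<in> {-n<..<n}" for s
  proof -
    have im: "(\<lambda>r. s * r) ` {0..1} \<subseteq> {-n..n}"
    proof clarify
      fix r :: real assume "r \<in> {0..1}"
      then have "\<bar>s * r\<bar> \<le> \<bar>s\<bar> * 1" unfolding abs_mult by (intro mult_left_mono) auto
      then show "s * r \<in> {-n..n}" using s by auto
    qed
    have "((\<lambda>r. s *\<^sub>R f (s * r)) has_integral (A \<circ> (\<lambda>r. s * r)) 1 - (A \<circ> (\<lambda>r. s * r)) 0) {0..1}"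
    proof (rule fundamental_theorem_of_calculus)
      fix r :: real assume r: "r \<in> {0..1}"
      have "((\<lambda>r. s * r) has_vector_derivative s) (at r within {0..1})"
        by (auto intro!: derivative_eq_intros)
      moreover have "(A has_vector_derivative f (s * r)) (at (s * r) within (\<lambda>r. s * r) ` {0..1})"
        by (rule has_vector_derivative_within_subset[OF A im]) (use im r in blast)
      ultimately show "(A \<circ> (\<lambda>r. s * r) has_vector_derivative s *\<^sub>R f (s * r)) (at r within {0..1})"
        by (rule vector_diff_chain_within)
    qed simp
    then have "integral {0..1} (\<lambda>r. s *\<^sub>R f (s * r)) = A s - A 0"
      by (simp add: integral_unique del: integral_cmul)
    then show ?thesis by simp
  qed
  have t: "t \<in> {-n<..<n}" by (auto simp: n_def)
  have "(A has_vector_derivative f t) (at t within {-n..n})"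
    using A t by (simp add: less_imp_le)
  then have "(A has_vector_derivative f t) (at t within {-n<..<n})"
    by (rule has_vector_derivative_within_subset) (rule greaterThanLessThan_subseteq_atLeastAtMost_iff[THEN iffD2], simp)
  then have "(A has_vector_derivative f t) (at t)"
    using at_within_open[OF t] by simp
  then have "((\<lambda>s. A s - A 0) has_vector_derivative f t) (at t)"
    using has_vector_derivative_diff[OF _ has_vector_derivative_const] by fastforce
  then show ?thesis
    by (rule has_vector_derivative_transform_within_open[OF _ open_greaterThanLessThan t]) (rule eq)
qed

text \<open>The Picard operator is a contraction in the norm weighted by \<open>exp (- K \<bar>t\<bar>)\<close>; writing the
  integral from \<open>0\<close> to \<open>t\<close> over \<open>[0,1]\<close> treats both signs of \<open>t\<close> at once.\<close>

lemma ODE_global_solution: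
  fixes F :: "real \<times> 'a::euclidean_space \<Rightarrow> 'a" and z0 :: 'a
  assumes cont: "continuous_on UNIV F"
    and lip: "\<And>t x y. norm (F (t, x) - F (t, y)) \<le> L * norm (x - y)" and "L \<ge> 0"
    and bdd: "\<And>t. norm (F (t, z0)) \<le> M"
  obtains z where "z 0 = z0" "\<And>t. (z has_vector_derivative F (t, z t)) (at t)"
proof -
  \<comment> \<open>The Picard operator will contract by \<open>L / K\<close>; this \<open>K\<close>
    makes the factor at most 1/2 and stays positive for \<open>L = 0\<close>.\<close>
  define K where "K = 2 * L + 1"
  have K: "K > 0" "L / K \<le> 1/2" using \<open>L \<ge> 0\<close> by (auto simp: K_def field_simps)
  have M0: "M \<ge> 0" using bdd[of 0] norm_ge_zero order_trans by blast
  have expint: "((\<lambda>r. \<bar>t\<bar> * exp (K * \<bar>t\<bar> * r)) has_integral (exp (K * \<bar>t\<bar>) - 1) / K) {0..1}" for t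
  proof -
    have "((\<lambda>r. \<bar>t\<bar> * exp (K * \<bar>t\<bar> * r)) has_integral exp (K * \<bar>t\<bar> * 1) / K - exp (K * \<bar>t\<bar> * 0) / K) {0..1}"
      by (rule fundamental_theorem_of_calculus)
        (use K in \<open>auto intro!: derivative_eq_intros simp flip: has_real_derivative_iff_has_vector_derivative\<close>)
    then show ?thesis by (simp add: diff_divide_distrib)
  qed
  \<comment> \<open>Integrating the weight reproduces it up to the factor \<open>1 / K\<close>; this
    gain is the contraction.\<close>
  have est: "norm (t *\<^sub>R integral {0..1} (\<lambda>r. f (t * r))) \<le> B / K * exp (K * \<bar>t\<bar>)"
    if f: "continuous_on UNIV f" and B: "\<And>s. norm (f s) \<le> B * exp (K * \<bar>s\<bar>)" and B0: "B \<ge> 0"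
    for f :: "real \<Rightarrow> 'a" and t B
  proof -
    have "norm (integral {0..1} (\<lambda>r. t *\<^sub>R f (t * r))) \<le> integral {0..1} (\<lambda>r. B * (\<bar>t\<bar> * exp (K * \<bar>t\<bar> * r)))"
    proof (rule integral_norm_bound_integral)
      show "(\<lambda>r. t *\<^sub>R f (t * r)) integrable_on {0..1}"
        by (intro integrable_continuous_real continuous_intros continuous_on_compose2[OF f]) auto
      show "(\<lambda>r. B * (\<bar>t\<bar> * exp (K * \<bar>t\<bar> * r))) integrable_on {0..1}"
        by (intro integrable_continuous_real continuous_intros)
      fix r :: real assume "r \<in> {0..1}"
      then have "norm (f (t * r)) \<le> B * exp (K * \<bar>t\<bar> * r)"
        using B[of "t * r"] by (simp add: abs_mult mult.assoc)
      then show "norm (t *\<^sub>R f (t * r)) \<le> B * (\<bar>t\<bar> * exp (K * \<bar>t\<bar> * r))"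
        using mult_left_mono[of "norm (f (t * r))" "B * exp (K * \<bar>t\<bar> * r)" "\<bar>t\<bar>"]
        by (simp add: mult_ac)
    qed
    also have "\<dots> = B * ((exp (K * \<bar>t\<bar>) - 1) / K)"
      using integral_unique[OF has_integral_mult_right[OF expint]] .
    also have "\<dots> \<le> B / K * exp (K * \<bar>t\<bar>)"
      using B0 K by (simp add: field_simps)
    finally show ?thesis by simp
  qed
  \<comment> \<open>The unknown \<open>u\<close> is the deviation from \<open>z0\<close> divided by
    the weight, so that the sup metric on bounded continuous functions is the weighted norm of the
    deviation.\<close>
  define f where "f u s = F (s, z0 + exp (K * \<bar>s\<bar>) *\<^sub>R apply_bcontfun u s)" for u s
  have fc: "continuous_on UNIV (f u)" for u
    unfolding f_def by (rule continuous_on_compose2[OF cont]) (auto intro!: continuous_intros)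
  have fd: "norm (f u s - f v s) \<le> L * dist u v * exp (K * \<bar>s\<bar>)" for u v s
  proof -
    have "norm (f u s - f v s) \<le> L * norm (exp (K * \<bar>s\<bar>) *\<^sub>R (apply_bcontfun u s - apply_bcontfun v s))"
      unfolding f_def using lip[of s] by (metis add_diff_cancel_left scaleR_right_diff_distrib)
    also have "\<dots> = L * dist (u s) (v s) * exp (K * \<bar>s\<bar>)" by (simp add: dist_norm)
    also have "\<dots> \<le> L * dist u v * exp (K * \<bar>s\<bar>)"
      by (intro mult_right_mono mult_left_mono dist_bounded \<open>L \<ge> 0\<close>) simp
    finally show ?thesis .
  qed
  have fb: "norm (f u s) \<le> (M + L * dist u 0) * exp (K * \<bar>s\<bar>)" for u s
  proof -
    have "norm (f u s) \<le> norm (f 0 s) + norm (f u s - f 0 s)" by norm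
    also have "norm (f 0 s) \<le> M * exp (K * \<bar>s\<bar>)"
      using bdd[of s] mult_left_mono[OF one_le_exp_iff[THEN iffD2, of "K * \<bar>s\<bar>"] M0] K(1) by (simp add: f_def)
    finally show ?thesis using fd[of u s 0] by (simp add: algebra_simps)
  qed
  define G where "G u t = exp (- K * \<bar>t\<bar>) *\<^sub>R (t *\<^sub>R integral {0..1} (\<lambda>r. f u (t * r)))" for u t
  have Gest: "norm (exp (- K * \<bar>t\<bar>) *\<^sub>R x) \<le> C" if "norm x \<le> C * exp (K * \<bar>t\<bar>)" for x :: 'a and t C
    using that by (simp add: exp_minus field_simps)
  have ci: "continuous_on UNIV (\<lambda>t. integral {0..1} (\<lambda>r. f u (t * r)))" for u
  proof -
    have "continuous_on UNIV (\<lambda>x. f u (fst x * snd x))"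
      by (rule continuous_on_compose2[OF fc]) (auto intro!: continuous_intros)
    from continuous_on_integral_parameter[OF this, of 0 1] show ?thesis by simp
  qed
  have Gb: "G u \<in> bcontfun" for u
  proof (rule bcontfun_normI)
    show "continuous_on UNIV (G u)" unfolding G_def by (intro continuous_intros ci)
    show "norm (G u t) \<le> (M + L * dist u 0) / K" for t
      unfolding G_def using M0 \<open>L \<ge> 0\<close> by (intro Gest est fc fb) auto
  qed
  have "\<exists>!u. Bcontfun (G u) = u"
  proof (rule banach_fix_type[of "L / K"], safe)
    show "0 \<le> L / K" "L / K < 1" using K \<open>L \<ge> 0\<close> by auto
    fix u v
    show "dist (Bcontfun (G u)) (Bcontfun (G v)) \<le> L / K * dist u v"
    proof (rule dist_bound)
      fix t
      have int: "(\<lambda>r. f w (t * r)) integrable_on {0..1}" for w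
        by (intro integrable_continuous_real continuous_on_compose2[OF fc]) (auto intro: continuous_intros)
      have "G u t - G v t = exp (- K * \<bar>t\<bar>) *\<^sub>R (t *\<^sub>R integral {0..1} (\<lambda>r. f u (t * r) - f v (t * r)))"
        unfolding G_def by (simp add: int Henstock_Kurzweil_Integration.integral_diff scaleR_right_diff_distrib)
      also have "norm \<dots> \<le> L * dist u v / K"
        using est[of "\<lambda>s. f u s - f v s" "L * dist u v" t] fd fc \<open>L \<ge> 0\<close>
        by (intro Gest) (auto intro!: continuous_intros)
      finally show "dist (Bcontfun (G u) t) (Bcontfun (G v) t) \<le> L / K * dist u v"
        by (simp add: Bcontfun_inverse Gb dist_norm)
    qed
  qed
  then obtain u where "Bcontfun (G u) = u" by blast
  then have u: "apply_bcontfun u = G u" by (metis Bcontfun_inverse Gb)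
  define z where "z t = z0 + t *\<^sub>R integral {0..1} (\<lambda>r. f u (t * r))" for t
  have "z t = z0 + exp (K * \<bar>t\<bar>) *\<^sub>R apply_bcontfun u t" for t
    unfolding z_def u G_def by (simp add: exp_minus)
  then have fz: "f u t = F (t, z t)" for t by (simp add: f_def)
  have "(z has_vector_derivative f u t) (at t)" for t
    unfolding z_def
    using has_vector_derivative_add[OF has_vector_derivative_const has_vector_derivative_primitive[OF fc]] by simp
  then have "(z has_vector_derivative F (t, z t)) (at t)" for t by (simp only: fz)
  moreover have "z 0 = z0" by (simp add: z_def)
  ultimately show thesis by (intro that)
qed

text \<open>The weighted quantity \<open>e\<close> does not increase, because
  \<open>2 * norm w * c \<le> (norm w)\<^sup>2 + c\<^sup>2\<close> absorbs the inhomogeneity.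
  Squaring avoids the point where the norm is not differentiable.\<close>

lemma gronwall_bound:
  fixes w :: "real \<Rightarrow> 'a::euclidean_space"
  assumes w: "\<And>t. (w has_vector_derivative w' t) (at t)"
    and b: "\<And>t. t \<in> {0..1} \<Longrightarrow> norm (w' t) \<le> L * norm (w t) + c"
    and "L \<ge> 0" "c \<ge> 0" and t: "t \<in> {0..1}"
  shows "norm (w t) \<le> exp (L + 1) * (norm (w 0) + c)"
proof -
  define m where "m = 2 * L + 1"
  define e where "e t = exp (- m * t) * (w t \<bullet> w t + c\<^sup>2)" for t
  have m: "m \<ge> 0" using \<open>L \<ge> 0\<close> by (simp add: m_def)
  have "e t \<le> e 0"
  proof (rule DERIV_nonpos_imp_nonincreasing[of 0 t])
    fix s assume s: "0 \<le> s" "s \<le> t"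
    let ?d = "2 * (w s \<bullet> w' s) - m * (w s \<bullet> w s + c\<^sup>2)"
    have "((\<lambda>t. w t \<bullet> w t) has_real_derivative 2 * (w s \<bullet> w' s)) (at s)"
      unfolding has_field_derivative_def
      by (rule has_derivative_eq_rhs[OF has_derivative_inner[OF w[of s, unfolded has_vector_derivative_def]
        w[of s, unfolded has_vector_derivative_def]]]) (simp add: fun_eq_iff inner_commute)
    from DERIV_mult[OF DERIV_fun_exp[OF DERIV_cmult_Id[of "- m"]] DERIV_add[OF this DERIV_const[of "c\<^sup>2"]]]
    have "(e has_real_derivative exp (- m * s) * ?d) (at s)"
      unfolding e_def by (rule DERIV_cong) (simp add: right_diff_distrib mult_ac)
    moreover have "w s \<bullet> w' s \<le> norm (w s) * (L * norm (w s) + c)"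
      using norm_cauchy_schwarz[of "w s" "w' s"] mult_left_mono[OF b[of s] norm_ge_zero[of "w s"]] s t by auto
    then have "2 * (w s \<bullet> w' s) \<le> 2 * L * (norm (w s))\<^sup>2 + 2 * norm (w s) * c"
      by (simp add: power2_eq_square algebra_simps)
    then have "?d \<le> 0"
      using sum_squares_bound[of "norm (w s)" c] mult_nonneg_nonneg[OF \<open>L \<ge> 0\<close> zero_le_power2[of c]]
      by (simp add: algebra_simps dot_square_norm m_def)
    then have "exp (- m * s) * ?d \<le> 0" by (rule mult_nonneg_nonpos[OF exp_ge_zero])
    ultimately show "\<exists>y. (e has_real_derivative y) (at s) \<and> y \<le> 0" by blast
  qed (use t in auto)
  then have "exp (m * t) * (exp (- m * t) * ((norm (w t))\<^sup>2 + c\<^sup>2)) \<le> exp (m * t) * ((norm (w 0))\<^sup>2 + c\<^sup>2)"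
    by (simp add: e_def dot_square_norm)
  moreover have "exp (m * t) * (exp (- m * t) * ((norm (w t))\<^sup>2 + c\<^sup>2)) = (norm (w t))\<^sup>2 + c\<^sup>2"
    by (simp add: exp_minus)
  ultimately have "(norm (w t))\<^sup>2 + c\<^sup>2 \<le> exp (m * t) * ((norm (w 0))\<^sup>2 + c\<^sup>2)"
    by (simp only:)
  also have "\<dots> \<le> exp (2 * (L + 1)) * (norm (w 0) + c)\<^sup>2"
  proof (rule mult_mono)
    show "exp (m * t) \<le> exp (2 * (L + 1))"
      using mult_left_mono[of t 1 m] m t by (simp add: m_def)
    show "(norm (w 0))\<^sup>2 + c\<^sup>2 \<le> (norm (w 0) + c)\<^sup>2"
      using \<open>c \<ge> 0\<close> by (simp add: power2_sum)
  qed auto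
  also have "\<dots> = (exp (L + 1) * (norm (w 0) + c))\<^sup>2"
    by (simp only: power_mult_distrib exp_double)
  finally have "(norm (w t))\<^sup>2 \<le> (exp (L + 1) * (norm (w 0) + c))\<^sup>2"
    using zero_le_power2[of c] by linarith
  then show ?thesis by (rule power2_le_imp_le) (use \<open>c \<ge> 0\<close> in simp)
qed

lemma norm_increment_le:
  fixes f :: "real \<Rightarrow> 'a::real_normed_vector"
  assumes f: "\<And>t. t \<in> {0..1} \<Longrightarrow> (f has_vector_derivative f' t) (at t within {0..1})"
    and B: "\<And>t. t \<in> {0..1} \<Longrightarrow> norm (f' t) \<le> B" and t: "t \<in> {0..1}"
  shows "norm (f t - f 0) \<le> B"
proof -
  have "norm (f t - f 0) \<le> B * norm (t - 0)"
  proof (rule differentiable_bound[of "{0..1}" f "\<lambda>t h. h *\<^sub>R f' t"])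
    show "onorm (\<lambda>h. h *\<^sub>R f' s) \<le> B" if "s \<in> {0..1}" for s
      using B[OF that] order_trans[OF norm_ge_zero B[OF that]]
      by (intro onorm_bound) (auto simp: mult.commute[of B] intro: mult_left_mono)
  qed (use f t in \<open>auto simp: has_vector_derivative_def\<close>)
  moreover have "B \<ge> 0" using B[OF t] norm_ge_zero order_trans by blast
  ultimately show ?thesis using t mult_left_mono[of t 1 B] by auto
qed

section \<open>Geodesics on the torus\<close>

lemma cbox_representative: obtains k where "k \<in> lattice2" "x - k \<in> cbox 0 1"
proof -
  have "(\<chi> i. of_int \<lfloor>x $ i\<rfloor>) \<in> lattice2" by (simp add: lattice2_def)
  moreover have "x - (\<chi> i. of_int \<lfloor>x $ i\<rfloor>) \<in> cbox 0 1"
    by (simp add: mem_box_cart) (metis diff_le_eq le_diff_eq add.commute add_0 less_eq_real_def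
        of_int_floor_le real_of_int_floor_add_one_gt)
  ultimately show thesis using that by blast
qed

text \<open>Positions range over the whole plane, but by periodicity one cell suffices; so
  compactness of the set of second arguments gives a bound on the whole strip.\<close>

lemma strip_bounded:
  fixes h :: "(real^2) \<times> 'a::heine_borel \<Rightarrow> 'b::real_normed_vector"
  assumes h: "continuous_on UNIV h" and per: "\<And>x y k. k \<in> lattice2 \<Longrightarrow> h (x + k, y) = h (x, y)"
    and S: "compact S"
  obtains B where "B > 0" "\<And>x y. y \<in> S \<Longrightarrow> norm (h (x, y)) \<le> B"
proof -
  have "compact (h ` (cbox 0 1 \<times> S))"
    by (intro compact_continuous_image compact_Times compact_cbox S continuous_on_subset[OF h]) auto
  then have "bounded (h ` (cbox 0 1 \<times> S))" by (rule compact_imp_bounded)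
  then obtain B where "B > 0" "\<forall>w\<in>h ` (cbox 0 1 \<times> S). norm w \<le> B" unfolding bounded_pos by blast
  then have B: "B > 0" "\<And>z. z \<in> cbox 0 1 \<times> S \<Longrightarrow> norm (h z) \<le> B" by auto
  show thesis
  proof (rule that[OF B(1)])
    fix x y assume y: "y \<in> S"
    obtain k where k: "k \<in> lattice2" "x - k \<in> cbox 0 1" by (rule cbox_representative)
    then have "norm (h (x - k, y)) \<le> B" using y by (intro B) auto
    then show "norm (h (x, y)) \<le> B" using per[OF k(1), of "x - k" y] by simp
  qed
qed

lemma norm_linear_le_Basis:
  fixes D :: "'a::euclidean_space \<Rightarrow> 'b::real_normed_vector"
  assumes "linear D" "\<And>b. b \<in> Basis \<Longrightarrow> norm (D b) \<le> B"
  shows "norm (D v) \<le> real DIM('a) * B * norm v"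
proof -
  have "norm (D v) = norm (\<Sum>b\<in>Basis. (v \<bullet> b) *\<^sub>R D b)"
    by (subst euclidean_representation[symmetric, of v])
      (simp only: linear_sum[OF assms(1)] linear_cmul[OF assms(1)])
  also have "\<dots> \<le> (\<Sum>b\<in>(Basis::'a set). norm v * B)"
    by (rule sum_norm_le) (use assms(2) Basis_le_norm in \<open>auto intro!: mult_mono\<close>)
  finally show ?thesis by (simp add: mult_ac)
qed

lemma strip_frechet:
  fixes f :: "(real^2) \<times> 'a::euclidean_space \<Rightarrow> 'b::real_normed_vector"
  assumes f: "smooth f" and per: "\<And>x y k. k \<in> lattice2 \<Longrightarrow> f (x + k, y) = f (x, y)" and k: "k \<in> lattice2"
  shows "frechet_derivative f (at (x + k, y)) = frechet_derivative f (at (x, y))"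
proof -
  have "(\<lambda>z. f (z + (k, 0))) = f" using per[OF k] by (auto simp: fun_eq_iff)
  moreover have "((\<lambda>z. f (z + (k, 0))) has_derivative frechet_derivative f (at ((x, y) + (k, 0)))) (at (x, y))"
    using smooth_has_derivative[OF f, of "(x, y) + (k, 0)"] unfolding has_derivative_translate .
  ultimately have "(f has_derivative frechet_derivative f (at (x + k, y))) (at (x, y))" by simp
  from frechet_derivative_at[OF this] show ?thesis .
qed

lemma strip_derivative_bounded:
  fixes f :: "(real^2) \<times> (real^2) \<Rightarrow> real^2"
  assumes f: "smooth f" and per: "\<And>x y k. k \<in> lattice2 \<Longrightarrow> f (x + k, y) = f (x, y)"
  obtains B where "B > 0" "\<And>z v. norm (snd z) \<le> R \<Longrightarrow> norm (frechet_derivative f (at z) v) \<le> B * norm v"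
proof -
  have "\<exists>B>0. \<forall>x y. y \<in> cball 0 R \<longrightarrow> norm (frechet_derivative f (at (x, y)) b) \<le> B" for b
    by (rule strip_bounded[OF smooth_frechet_continuous[OF f], of b "cball 0 R"]) (auto simp: strip_frechet[OF f per])
  then obtain B where B: "\<And>b. B b > 0" "\<And>b x y. y \<in> cball 0 R \<Longrightarrow> norm (frechet_derivative f (at (x, y)) b) \<le> B b"
    by metis
  define C where "C = (\<Sum>b\<in>Basis. B b)"
  have BC: "B b \<le> C" if "b \<in> Basis" for b
    unfolding C_def using that by (intro member_le_sum less_imp_le[OF B(1)]) auto
  have "norm (frechet_derivative f (at z) v) \<le> real DIM((real^2) \<times> (real^2)) * C * norm v" if "norm (snd z) \<le> R" for z v
  proof (rule norm_linear_le_Basis)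
    show "linear (frechet_derivative f (at z))"
      by (rule has_derivative_linear[OF smooth_has_derivative[OF f]])
    show "norm (frechet_derivative f (at z) b) \<le> C" if "b \<in> Basis" for b
      using B(2)[of "snd z" "fst z" b] BC[OF that] \<open>norm (snd z) \<le> R\<close> by simp
  qed
  moreover have "C > 0" unfolding C_def by (rule sum_pos) (auto simp: B(1))
  then have "real DIM((real^2) \<times> (real^2)) * C > 0" by simp
  ultimately show thesis using that by blast
qed

lemma strip_lipschitz:
  fixes f :: "(real^2) \<times> (real^2) \<Rightarrow> real^2"
  assumes f: "smooth f" and per: "\<And>x y k. k \<in> lattice2 \<Longrightarrow> f (x + k, y) = f (x, y)"
  obtains B where "B > 0"
    "\<And>z z'. norm (snd z) \<le> R \<Longrightarrow> norm (snd z') \<le> R \<Longrightarrow> norm (f z - f z') \<le> B * norm (z - z')"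
proof -
  obtain B where B: "B > 0" "\<And>z v. norm (snd z) \<le> R \<Longrightarrow> norm (frechet_derivative f (at z) v) \<le> B * norm v"
    using strip_derivative_bounded[OF assms] by blast
  have "norm (f z - f z') \<le> B * norm (z - z')" if "norm (snd z) \<le> R" "norm (snd z') \<le> R" for z z'
  proof (rule differentiable_bound[of "UNIV \<times> cball 0 R" f "\<lambda>z. frechet_derivative f (at z)"])
    show "convex (UNIV \<times> cball 0 R :: ((real^2) \<times> (real^2)) set)" by (intro convex_Times) auto
    show "(f has_derivative frechet_derivative f (at x)) (at x within UNIV \<times> cball 0 R)" for x
      by (rule has_derivative_at_withinI[OF smooth_has_derivative[OF f]])
    show "onorm (frechet_derivative f (at x)) \<le> B" if "x \<in> UNIV \<times> cball 0 R" for x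
      using that B by (intro onorm_bound) (auto simp: mem_Times_iff)
  qed (use that in \<open>auto simp: mem_Times_iff\<close>)
  then show thesis using that B(1) by blast
qed

text \<open>The derivative is Lipschitz on the strip in every basis direction, hence in every
  direction. On the segment from \<open>z\<close> to \<open>z'\<close> it therefore deviates from
  its value at \<open>z\<close> by a multiple of \<open>norm (z' - z)\<close>, and the mean value
  inequality turns this into a quadratic remainder.\<close>

lemma strip_taylor:
  fixes f :: "(real^2) \<times> (real^2) \<Rightarrow> real^2"
  assumes f: "smooth f" and per: "\<And>x y k. k \<in> lattice2 \<Longrightarrow> f (x + k, y) = f (x, y)"
  obtains C where "C > 0"
    "\<And>z z'. norm (snd z) \<le> R \<Longrightarrow> norm (snd z') \<le> R \<Longrightarrow>
      norm (f z' - f z - frechet_derivative f (at z) (z' - z)) \<le> C * (norm (z' - z))\<^sup>2"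
proof -
  let ?D = "\<lambda>z. frechet_derivative f (at z)"
  have "\<exists>B>0. \<forall>z z'. norm (snd z) \<le> R \<longrightarrow> norm (snd z') \<le> R \<longrightarrow> norm (?D z b - ?D z' b) \<le> B * norm (z - z')" for b
    by (rule strip_lipschitz[OF smooth_frechet[OF f], of b R]) (auto simp: strip_frechet[OF f per])
  then obtain B where "\<forall>b. B b > 0 \<and> (\<forall>z z'. norm (snd z) \<le> R \<longrightarrow> norm (snd z') \<le> R \<longrightarrow>
      norm (?D z b - ?D z' b) \<le> B b * norm (z - z'))"
    using choice[of "\<lambda>b B. B > 0 \<and> (\<forall>z z'. norm (snd z) \<le> R \<longrightarrow> norm (snd z') \<le> R \<longrightarrow>
      norm (?D z b - ?D z' b) \<le> B * norm (z - z'))"] by blast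
  then have B: "\<And>b. B b > 0" "\<And>b z z'. norm (snd z) \<le> R \<Longrightarrow> norm (snd z') \<le> R \<Longrightarrow>
      norm (?D z b - ?D z' b) \<le> B b * norm (z - z')"
    by auto
  define C where "C = (\<Sum>b\<in>Basis. B b)"
  have BC: "B b \<le> C" if "b \<in> Basis" for b
    unfolding C_def using that by (intro member_le_sum less_imp_le[OF B(1)]) auto
  have C0: "C > 0" unfolding C_def by (rule sum_pos) (auto simp: B(1))
  define d where "d = real DIM((real^2) \<times> (real^2))"
  have d0: "d > 0" by (simp add: d_def)
  have D: "norm (?D z v - ?D z' v) \<le> d * (C * norm (z - z')) * norm v"
    if "norm (snd z) \<le> R" "norm (snd z') \<le> R" for z z' v
    unfolding d_def
  proof (rule norm_linear_le_Basis)
    show "linear (\<lambda>v. ?D z v - ?D z' v)"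
      by (intro linear_compose_sub has_derivative_linear[OF smooth_has_derivative[OF f]])
    fix b :: "(real^2) \<times> (real^2)" assume "b \<in> Basis"
    then show "norm (?D z b - ?D z' b) \<le> C * norm (z - z')"
      using B(2)[OF that, of b] mult_right_mono[OF BC norm_ge_zero] order_trans by blast
  qed
  have "norm (f z' - f z - ?D z (z' - z)) \<le> (d * C) * (norm (z' - z))\<^sup>2"
    if z: "norm (snd z) \<le> R" "norm (snd z') \<le> R" for z z'
  proof -
    have seg: "norm (snd w) \<le> R \<and> norm (w - z) \<le> norm (z' - z)" if w: "w \<in> closed_segment z z'" for w
    proof -
      obtain u where u: "0 \<le> u" "u \<le> 1" "w = (1 - u) *\<^sub>R z + u *\<^sub>R z'"
        using w unfolding closed_segment_def by blast
      have "norm (snd w) \<le> (1 - u) * norm (snd z) + u * norm (snd z')"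
        using u norm_triangle_ineq[of "(1 - u) *\<^sub>R snd z" "u *\<^sub>R snd z'"] by simp
      also have "\<dots> \<le> (1 - u) * R + u * R" using u z by (intro add_mono mult_left_mono) auto
      finally have "norm (snd w) \<le> R" by (simp add: algebra_simps)
      moreover have "w - z = u *\<^sub>R (z' - z)" by (simp add: u algebra_simps)
      then have "norm (w - z) \<le> norm (z' - z)" using u by (simp add: mult_left_le_one_le)
      ultimately show ?thesis by simp
    qed
    have "norm (f z' - f z - ?D z (z' - z)) \<le> norm (z' - z) * (d * C * norm (z' - z))"
    proof (rule differentiable_bound_linearization[of z z' "closed_segment z z'" f ?D z])
      show "z + t *\<^sub>R (z' - z) \<in> closed_segment z z'" if "t \<in> {0..1}" for t
        using that by (auto simp: closed_segment_def algebra_simps intro!: exI[of _ t])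
      show "(f has_derivative ?D w) (at w within closed_segment z z')" for w
        by (rule has_derivative_at_withinI[OF smooth_has_derivative[OF f]])
      fix w assume w: "w \<in> closed_segment z z'"
      show "onorm (?D w - ?D z) \<le> d * C * norm (z' - z)"
        unfolding fun_diff_def
      proof (rule onorm_bound)
        show "norm (?D w v - ?D z v) \<le> d * C * norm (z' - z) * norm v" for v
        proof -
          have "norm (?D w v - ?D z v) \<le> d * (C * norm (w - z)) * norm v"
            using D seg[OF w] z by blast
          also have "\<dots> \<le> d * (C * norm (z' - z)) * norm v"
            using seg[OF w] d0 C0 by (intro mult_right_mono mult_left_mono) auto
          finally show ?thesis by (simp add: mult_ac)
        qed
      qed (use d0 C0 in auto)
    qed auto
    then show ?thesis by (simp add: power2_eq_square mult_ac)
  qed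
  moreover have "d * C > 0" using d0 C0 by simp
  ultimately show thesis using that by blast
qed

lemma linear_real2: "linear D \<Longrightarrow> D v = v $ 1 *\<^sub>R D (axis 1 1) + v $ 2 *\<^sub>R D (axis 2 1)"
  for D :: "real^2 \<Rightarrow> 'b::real_vector"
proof -
  assume D: "linear D"
  have "v $ 1 *\<^sub>R axis 1 1 + v $ 2 *\<^sub>R axis 2 1 = v"
    by (simp add: vec_eq_iff forall_2 axis_def)
  then have "D v = D (v $ 1 *\<^sub>R axis 1 1 + v $ 2 *\<^sub>R axis 2 1)" by (rule arg_cong[symmetric])
  also have "\<dots> = v $ 1 *\<^sub>R D (axis 1 1) + v $ 2 *\<^sub>R D (axis 2 1)"
    by (subst linear_add[OF D]) (simp only: linear_cmul[OF D])
  finally show ?thesis .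
qed

lemma axis_nth2: "(axis i 1 :: real^2) $ j = (if j = i then 1 else 0)"
  by (simp add: axis_def)

text \<open>Cramer's rule. The explicit entries make it visible that the inverse metric depends
  smoothly on the point.\<close>

lemma matrix_inv_2:
  fixes A :: "real^2^2"
  assumes A: "A ** matrix_inv A = mat 1" and d: "det A \<noteq> 0"
  shows "matrix_inv A $ 1 $ 1 = A $ 2 $ 2 * inverse (det A)" "matrix_inv A $ 1 $ 2 = - A $ 1 $ 2 * inverse (det A)"
    "matrix_inv A $ 2 $ 1 = - A $ 2 $ 1 * inverse (det A)" "matrix_inv A $ 2 $ 2 = A $ 1 $ 1 * inverse (det A)"
proof -
  let ?B = "matrix_inv A"
  have eq: "A $ i $ 1 * ?B $ 1 $ j + A $ i $ 2 * ?B $ 2 $ j = (if i = j then 1 else 0)" for i j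
  proof -
    have "(A ** ?B) $ i $ j = (mat 1 :: real^2^2) $ i $ j" by (simp only: A)
    then show ?thesis by (simp add: matrix_matrix_mult_def mat_def sum_2)
  qed
  have cramer: "det A * ?B $ 1 $ j = A $ 2 $ 2 * (A $ 1 $ 1 * ?B $ 1 $ j + A $ 1 $ 2 * ?B $ 2 $ j)
      - A $ 1 $ 2 * (A $ 2 $ 1 * ?B $ 1 $ j + A $ 2 $ 2 * ?B $ 2 $ j)"
    "det A * ?B $ 2 $ j = A $ 1 $ 1 * (A $ 2 $ 1 * ?B $ 1 $ j + A $ 2 $ 2 * ?B $ 2 $ j)
      - A $ 2 $ 1 * (A $ 1 $ 1 * ?B $ 1 $ j + A $ 1 $ 2 * ?B $ 2 $ j)" for j
    by (simp_all add: det_2 algebra_simps)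
  have "det A * ?B $ 1 $ 1 = A $ 2 $ 2" "det A * ?B $ 1 $ 2 = - A $ 1 $ 2"
    "det A * ?B $ 2 $ 1 = - A $ 2 $ 1" "det A * ?B $ 2 $ 2 = A $ 1 $ 1"
    unfolding cramer eq by simp_all
  then show "matrix_inv A $ 1 $ 1 = A $ 2 $ 2 * inverse (det A)" "matrix_inv A $ 1 $ 2 = - A $ 1 $ 2 * inverse (det A)"
    "matrix_inv A $ 2 $ 1 = - A $ 2 $ 1 * inverse (det A)" "matrix_inv A $ 2 $ 2 = A $ 1 $ 1 * inverse (det A)"
    using d by (simp_all add: field_simps)
qed

section \<open>The metric tensor, its inverse and the geodesic equation\<close>

locale riemannian_torus =
  fixes g :: metric_tensor
  assumes riemannian: "riemannian_metric g"
begin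

lemma smooth_metric: "smooth (\<lambda>x. g (proj x))"
  using riemannian by (simp add: riemannian_metric_def smooth_torus_def)

lemma smooth_entry: "smooth (\<lambda>x. g (proj x) $ i $ j)"
  by (rule smooth_vec_nth[OF smooth_vec_nth[OF smooth_metric]])

lemma continuous_metric: "continuous_on UNIV g"
  unfolding continuous_on_torus_iff by (rule smooth_continuous[OF smooth_metric])

lemma metric_sym: "g p $ i $ j = g p $ j $ i"
proof -
  have "transpose (g p) = g p" using riemannian unfolding riemannian_metric_def by blast
  then have "transpose (g p) $ j $ i = g p $ j $ i" by (rule arg_cong)
  then show ?thesis by (simp only: transpose_def vec_lambda_beta)
qed

lemma metric_pos: "v \<noteq> 0 \<Longrightarrow> v \<bullet> (g p *v v) > 0"
  using riemannian by (simp add: riemannian_metric_def)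

lemma quadratic_form: "v \<bullet> (A *v v) = A $ 1 $ 1 * v $ 1 * v $ 1 + A $ 1 $ 2 * v $ 1 * v $ 2
    + A $ 2 $ 1 * v $ 2 * v $ 1 + A $ 2 $ 2 * v $ 2 * v $ 2" for A :: "real^2^2"
  by (simp add: inner_vec_def matrix_vector_mult_def sum_2 algebra_simps)

lemma metric_inverse: "g p ** matrix_inv (g p) = mat 1"
proof -
  have "\<forall>x. g p *v x = 0 \<longrightarrow> x = 0" using metric_pos by (metis inner_zero_right less_irrefl)
  then have "invertible (g p)"
    unfolding invertible_left_inverse matrix_left_invertible_ker .
  then obtain B where "g p ** B = mat 1 \<and> B ** g p = mat 1" unfolding invertible_def by blast
  then show ?thesis unfolding matrix_inv_def by (rule someI2) simp
qed

lemma det_metric_pos: "det (g p) > 0"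
proof -
  have a: "g p $ 1 $ 1 > 0"
    using metric_pos[of "axis 1 1" p] by (simp add: quadratic_form axis_nth2)
  \<comment> \<open>On this vector the quadratic form takes the value
    \<open>g p $ 1 $ 1 * det (g p)\<close>.\<close>
  let ?v = "(\<chi> i. if i = 1 then - g p $ 1 $ 2 else g p $ 1 $ 1) :: real^2"
  have "?v \<noteq> 0"
  proof
    assume "?v = 0"
    then have "?v $ 2 = 0" by (simp only: zero_index)
    with a show False by simp
  qed
  from metric_pos[OF this, of p] have "g p $ 1 $ 1 * det (g p) > 0"
    by (simp add: quadratic_form det_2 metric_sym[of p 2 1] algebra_simps)
  then show ?thesis using a by (simp add: zero_less_mult_iff)
qed

lemma smooth_det: "smooth (\<lambda>x. det (g (proj x)))"
  unfolding det_2 by (intro smooth_diff smooth_mult smooth_entry)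

lemma smooth_inverse_entry: "smooth (\<lambda>x. matrix_inv (g (proj x)) $ i $ j)"
proof -
  have "det (g p) \<noteq> 0" for p using det_metric_pos[of p] by simp
  moreover from this have "smooth (\<lambda>x. inverse (det (g (proj x))))" by (intro smooth_inverse smooth_det)
  ultimately show ?thesis
    using exhaust_2[of i] exhaust_2[of j]
    by (auto simp: matrix_inv_2[OF metric_inverse] intro!: smooth_mult smooth_minus smooth_entry)
qed

lemma smooth_christoffel: "smooth (\<lambda>x. christoffel g (proj x) k i j)"
proof -
  have d: "smooth (\<lambda>x. partial m (\<lambda>q. g q $ a $ b) (proj x))" for m a b
    unfolding partial_proj by (rule smooth_frechet[OF smooth_entry])
  show ?thesis
    unfolding christoffel_def
    by (intro smooth_mult[OF smooth_const] smooth_sum smooth_mult[OF smooth_inverse_entry] smooth_diff smooth_add d)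
qed

definition spray :: "(real^2) \<times> (real^2) \<Rightarrow> real^2" where
  "spray z = (\<chi> k. - (\<Sum>i\<in>UNIV. \<Sum>j\<in>UNIV. christoffel g (proj (fst z)) k i j * snd z $ i * snd z $ j))"

text \<open>Carrying the velocity along turns the geodesic equation into a first-order system with
  right-hand side \<open>(y, spray (x, y))\<close>, to which the results on differential equations
  apply.\<close>

definition geo :: "(real \<Rightarrow> real^2) \<Rightarrow> (real \<Rightarrow> real^2) \<Rightarrow> bool" where
  "geo \<gamma> y \<longleftrightarrow> (\<forall>t. (\<gamma> has_vector_derivative y t) (at t) \<and> (y has_vector_derivative spray (\<gamma> t, y t)) (at t))"

lemma geodesic_iff: "geodesic g \<gamma> \<longleftrightarrow> (\<exists>y. geo \<gamma> y)"
  unfolding geodesic_def geo_def spray_def by (simp only: fst_conv snd_conv)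

lemma smooth_spray: "smooth spray"
proof -
  have c: "smooth (\<lambda>z::(real^2) \<times> (real^2). christoffel g (proj (fst z)) k i j)" for k i j
    by (rule smooth_compose[OF smooth_christoffel smooth_fst[OF smooth_ident]])
  show ?thesis
    unfolding spray_def[abs_def]
    by (rule smooth_vec_lambda smooth_minus smooth_sum smooth_mult c smooth_vec_nth[OF smooth_snd[OF smooth_ident]])+
qed

lemma spray_periodic: "k \<in> lattice2 \<Longrightarrow> spray (x + k, y) = spray (x, y)"
  by (simp add: spray_def)

text \<open>Quadratic homogeneity in the velocity is what makes the Lipschitz constant of the spray
  small at low speed.\<close>

lemma spray_scale: "spray (x, r *\<^sub>R y) = r\<^sup>2 *\<^sub>R spray (x, y)"
  by (simp add: spray_def vec_eq_iff sum_2 power2_eq_square algebra_simps)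

lemma geo_translate: "geo \<gamma> y \<Longrightarrow> k \<in> lattice2 \<Longrightarrow> geo (\<lambda>t. \<gamma> t + k) y"
  by (simp add: geo_def spray_periodic has_vector_derivative_add_const)

text \<open>Lowering the upper index cancels the inverse metric and leaves the Christoffel symbols
  of the first kind, so that energy conservation becomes an identity between partial derivatives of
  the metric.\<close>

lemma metric_christoffel:
  "g p $ m $ 1 * christoffel g p 1 a b + g p $ m $ 2 * christoffel g p 2 a b =
    (partial a (\<lambda>q. g q $ b $ m) p + partial b (\<lambda>q. g q $ a $ m) p - partial m (\<lambda>q. g q $ a $ b) p) / 2"
proof -
  have eq: "g p $ m $ 1 * matrix_inv (g p) $ 1 $ j + g p $ m $ 2 * matrix_inv (g p) $ 2 $ j = (if m = j then 1 else 0)" for j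
  proof -
    have "(g p ** matrix_inv (g p)) $ m $ j = (mat 1 :: real^2^2) $ m $ j" by (simp only: metric_inverse)
    then show ?thesis by (simp add: matrix_matrix_mult_def mat_def sum_2)
  qed
  define T where "T l = partial a (\<lambda>q. g q $ b $ l) p + partial b (\<lambda>q. g q $ a $ l) p - partial l (\<lambda>q. g q $ a $ b) p" for l
  have "g p $ m $ 1 * christoffel g p 1 a b + g p $ m $ 2 * christoffel g p 2 a b =
     ((g p $ m $ 1 * matrix_inv (g p) $ 1 $ 1 + g p $ m $ 2 * matrix_inv (g p) $ 2 $ 1) * T 1
      + (g p $ m $ 1 * matrix_inv (g p) $ 1 $ 2 + g p $ m $ 2 * matrix_inv (g p) $ 2 $ 2) * T 2) / 2"
    by (simp add: christoffel_def T_def[symmetric] sum_2 algebra_simps add_divide_distrib)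
  also have "\<dots> = T m / 2"
    unfolding eq using exhaust_2[of m] by auto
  finally show ?thesis unfolding T_def .
qed

text \<open>With the index lowered, the acceleration terms are derivatives of the metric, which by
  symmetry cancel those from differentiating the metric along the curve. A single time is considered
  because the existence proof knows the geodesic equation only where the truncation is
  inactive.\<close>

lemma energy_derivative:
  assumes \<gamma>: "(\<gamma> has_vector_derivative y t) (at t)"
    and y: "(y has_vector_derivative spray (\<gamma> t, y t)) (at t)"
  shows "((\<lambda>t. y t \<bullet> (g (proj (\<gamma> t)) *v y t)) has_real_derivative 0) (at t)"
proof -
  define P where "P k i j = partial k (\<lambda>q. g q $ i $ j) (proj (\<gamma> t))" for k i j
  define a where "a i j = g (proj (\<gamma> t)) $ i $ j" for i j
  define c where "c k i j = christoffel g (proj (\<gamma> t)) k i j" for k i j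
  define u where "u i = y t $ i" for i
  define N where "N k = spray (\<gamma> t, y t) $ k" for k
  have N: "N k = - (c k 1 1 * u 1 * u 1 + c k 1 2 * u 1 * u 2 + c k 2 1 * u 2 * u 1 + c k 2 2 * u 2 * u 2)" for k
    by (simp add: N_def spray_def sum_2 c_def u_def)
  have da: "((\<lambda>t. g (proj (\<gamma> t)) $ i $ j) has_real_derivative P 1 i j * u 1 + P 2 i j * u 2) (at t)" for i j
  proof -
    let ?D = "frechet_derivative (\<lambda>x. g (proj x) $ i $ j) (at (\<gamma> t))"
    have D: "((\<lambda>x. g (proj x) $ i $ j) has_derivative ?D) (at (\<gamma> t))"
      by (rule smooth_has_derivative[OF smooth_entry])
    have "((\<lambda>t. g (proj (\<gamma> t)) $ i $ j) has_derivative (\<lambda>h. ?D (h *\<^sub>R y t))) (at t)"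
      by (rule has_derivative_compose[OF \<gamma>[unfolded has_vector_derivative_def] D])
    moreover have "?D (h *\<^sub>R y t) = (P 1 i j * u 1 + P 2 i j * u 2) * h" for h
      using linear_real2[OF has_derivative_linear[OF D], of "h *\<^sub>R y t"]
      by (simp add: P_def u_def partial_proj algebra_simps)
    ultimately show ?thesis by (simp add: has_field_derivative_def)
  qed
  have dy: "((\<lambda>t. y t $ i) has_real_derivative N i) (at t)" for i
    using bounded_linear.has_vector_derivative[OF bounded_linear_vec_nth y, of i]
    by (simp add: has_real_derivative_iff_has_vector_derivative N_def)
  have Psym: "P k i j = P k j i" and asym: "a i j = a j i" for k i j
    unfolding P_def a_def by (simp_all add: metric_sym[of _ i j])
  have ch: "a m 1 * c 1 i j + a m 2 * c 2 i j = (P i j m + P j i m - P m i j) / 2" for m i j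
    unfolding a_def c_def P_def by (rule metric_christoffel)
  have low: "a m 1 * N 1 + a m 2 * N 2 = - ((P 1 1 m + P 1 1 m - P m 1 1) / 2 * u 1 * u 1 + (P 1 2 m + P 2 1 m - P m 1 2) / 2 * u 1 * u 2
     + (P 2 1 m + P 1 2 m - P m 2 1) / 2 * u 2 * u 1 + (P 2 2 m + P 2 2 m - P m 2 2) / 2 * u 2 * u 2)" for m
    unfolding N ch[symmetric] by (simp add: algebra_simps)
  let ?d = "((P 1 1 1 * u 1 + P 2 1 1 * u 2) * u 1 * u 1 + (P 1 1 2 * u 1 + P 2 1 2 * u 2) * u 1 * u 2
     + (P 1 2 1 * u 1 + P 2 2 1 * u 2) * u 2 * u 1 + (P 1 2 2 * u 1 + P 2 2 2 * u 2) * u 2 * u 2)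
     + 2 * (u 1 * (a 1 1 * N 1 + a 1 2 * N 2) + u 2 * (a 2 1 * N 1 + a 2 2 * N 2))"
  have "((\<lambda>t. y t \<bullet> (g (proj (\<gamma> t)) *v y t)) has_real_derivative ?d) (at t)"
    unfolding quadratic_form
    by (rule derivative_eq_intros da dy refl)+
      (simp add: u_def[symmetric] a_def[symmetric] asym[of 2 1] algebra_simps)
  moreover have "?d = 0"
    unfolding low Psym[of _ 2 1] by (simp add: field_simps)
  ultimately show ?thesis by simp
qed

text \<open>By homogeneity it suffices to compare the norms on the unit circle bundle, which is
  compact.\<close>

lemma gnorm_bounds:
  obtains c C where "c > 0" "C > 0" "\<And>p v. c * norm v \<le> gnorm g p v" "\<And>p v. gnorm g p v \<le> C * norm v"
proof -
  let ?q = "\<lambda>z. snd z \<bullet> (g (fst z) *v snd z)"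
  let ?K = "(UNIV :: torus set) \<times> sphere (0 :: real^2) 1"
  have "continuous_on ?K ?q"
    unfolding quadratic_form
    by (intro continuous_intros continuous_on_compose2[OF continuous_metric]) auto
  moreover have "compact ?K" by (intro compact_Times compact_UNIV_torus compact_sphere)
  moreover have "(undefined, axis 1 1) \<in> ?K" by (simp add: norm_axis_1)
  then have "?K \<noteq> {}" by blast
  ultimately obtain a b where a: "a \<in> ?K" "\<And>z. z \<in> ?K \<Longrightarrow> ?q a \<le> ?q z"
    and b: "b \<in> ?K" "\<And>z. z \<in> ?K \<Longrightarrow> ?q z \<le> ?q b"
    using continuous_attains_inf[of ?K ?q] continuous_attains_sup[of ?K ?q] by blast
  have "snd a \<noteq> 0" using a(1) by (auto simp: mem_Times_iff)
  then have a0: "?q a > 0" by (rule metric_pos)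
  then have b0: "?q b > 0" using b(2)[OF a(1)] by linarith
  have bounds: "sqrt (?q a) * norm v \<le> gnorm g p v \<and> gnorm g p v \<le> sqrt (?q b) * norm v" for p v
  proof (cases "v = 0")
    case False
    let ?u = "v /\<^sub>R norm v"
    have u: "(p, ?u) \<in> ?K" using False by simp
    have v: "v = norm v *\<^sub>R ?u" using False by simp
    have "v \<bullet> (g p *v v) = (norm v)\<^sup>2 * (?u \<bullet> (g p *v ?u))"
      by (subst (1 2) v) (simp add: quadratic_form power2_eq_square algebra_simps)
    then have "gnorm g p v = norm v * sqrt (?u \<bullet> (g p *v ?u))"
      unfolding gnorm_def by (simp add: real_sqrt_mult)
    moreover have "sqrt (?q a) \<le> sqrt (?u \<bullet> (g p *v ?u))" "sqrt (?u \<bullet> (g p *v ?u)) \<le> sqrt (?q b)"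
      using a(2)[OF u] b(2)[OF u] by simp_all
    ultimately show ?thesis by (simp add: mult.commute mult_left_mono)
  qed (simp add: gnorm_def)
  show thesis by (rule that[of "sqrt (?q a)" "sqrt (?q b)"]) (use a0 b0 bounds in auto)
qed

lemma continuous_gnorm: "continuous_on UNIV (\<lambda>z. gnorm g (fst z) (snd z))"
  unfolding gnorm_def quadratic_form
  by (intro continuous_intros continuous_on_compose2[OF continuous_metric]) auto

section \<open>Existence of geodesics and dependence on initial data\<close>

lemma geoD:
  assumes "geo \<gamma> y"
  shows "(\<gamma> has_vector_derivative y t) (at t)" "(y has_vector_derivative spray (\<gamma> t, y t)) (at t)"
  using assms unfolding geo_def by blast+

lemma geo_speed: "geo \<gamma> y \<Longrightarrow> gnorm g (proj (\<gamma> t)) (y t) = gnorm g (proj (\<gamma> s)) (y s)"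
proof -
  assume "geo \<gamma> y"
  then have "((\<lambda>t. y t \<bullet> (g (proj (\<gamma> t)) *v y t)) has_real_derivative 0) (at t)" for t
    unfolding geo_def by (blast intro: energy_derivative)
  then have "y t \<bullet> (g (proj (\<gamma> t)) *v y t) = y s \<bullet> (g (proj (\<gamma> s)) *v y s)"
    by (intro DERIV_isconst_all allI)
  then show ?thesis by (simp only: gnorm_def)
qed

text \<open>The metric speed is conserved, and it is comparable to the Euclidean norm uniformly in
  the point; so the velocity never leaves a ball fixed by its initial size.\<close>

lemma geo_norm_bound:
  obtains \<kappa> where "\<kappa> \<ge> 1" "\<And>\<gamma> y t. geo \<gamma> y \<Longrightarrow> norm (y t) \<le> \<kappa> * norm (y 0)"
proof -
  obtain c C where c: "c > 0" "C > 0" and lo: "\<And>p v. c * norm v \<le> gnorm g p v"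
    and hi: "\<And>p v. gnorm g p v \<le> C * norm v" by (rule gnorm_bounds) blast
  have *: "norm (y t) \<le> C / c * norm (y 0)" if "geo \<gamma> y" for \<gamma> y t
  proof -
    have "c * norm (y t) \<le> C * norm (y 0)"
      using lo[of "y t" "proj (\<gamma> t)"] hi[of "proj (\<gamma> 0)" "y 0"] geo_speed[OF that, of t 0] by linarith
    then show ?thesis using c by (simp add: field_simps)
  qed
  show thesis
  proof (rule that[of "max 1 (C / c)"])
    fix \<gamma> y t assume "geo \<gamma> y"
    from *[OF this, of t] show "norm (y t) \<le> max 1 (C / c) * norm (y 0)"
      using mult_right_mono[of "C / c" "max 1 (C / c)" "norm (y 0)"] by simp
  qed simp
qed

text \<open>Projecting the velocity to a ball makes the geodesic field globally Lipschitz.\<close>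

lemma truncated_field:
  assumes "R > 0"
  obtains F L where "L > 0" "\<And>z. norm (snd z) \<le> R \<Longrightarrow> F z = (snd z, spray z)"
    "\<And>z z'. norm (F z - F z') \<le> L * norm (z - z')"
proof -
  obtain B where B: "B > 0" "\<And>z z'. norm (snd z) \<le> R \<Longrightarrow> norm (snd z') \<le> R \<Longrightarrow>
      norm (spray z - spray z') \<le> B * norm (z - z')"
    using strip_lipschitz[OF smooth_spray, of R] spray_periodic by blast
  let ?p = "closest_point (cball (0 :: real^2) R)"
  let ?F = "\<lambda>z. (snd z, spray (fst z, ?p (snd z)))"
  have p: "norm (?p y) \<le> R" for y
    using closest_point_in_set[of "cball (0 :: real^2) R" y] \<open>R > 0\<close> by auto
  have "norm (?F z - ?F z') \<le> (1 + B) * norm (z - z')" for z z'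
  proof -
    have "norm (?p (snd z) - ?p (snd z')) \<le> norm (snd z - snd z')"
      using closest_point_lipschitz[of "cball (0 :: real^2) R"] \<open>R > 0\<close> by (auto simp: dist_norm)
    then have "norm ((fst z, ?p (snd z)) - (fst z', ?p (snd z'))) \<le> norm (z - z')"
      by (simp add: norm_Pair norm_prod_def power_mono)
    then have "norm (spray (fst z, ?p (snd z)) - spray (fst z', ?p (snd z'))) \<le> B * norm (z - z')"
      using B(2)[of "(fst z, ?p (snd z))" "(fst z', ?p (snd z'))"] p mult_left_mono[OF _ less_imp_le[OF B(1)]] by fastforce
    moreover have "norm (snd z - snd z') \<le> norm (z - z')"
      unfolding norm_prod_def[of "z - z'"] using real_sqrt_sum_squares_ge2[of "norm (snd (z - z'))"] by simp
    moreover have "norm (?F z - ?F z') \<le> norm (snd z - snd z') + norm (spray (fst z, ?p (snd z)) - spray (fst z', ?p (snd z')))"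
      by (simp add: norm_Pair_le)
    ultimately show ?thesis by (simp add: algebra_simps)
  qed
  moreover have "?F z = (snd z, spray z)" if "norm (snd z) \<le> R" for z
    using that closest_point_self[of "snd z" "cball 0 R"] by simp
  ultimately show thesis using that[of "1 + B" ?F] B(1) by simp
qed

lemma geo_pair_derivative:
  "geo \<gamma> y \<longleftrightarrow> (\<forall>t. ((\<lambda>t. (\<gamma> t, y t)) has_vector_derivative (y t, spray (\<gamma> t, y t))) (at t))"
proof
  show "geo \<gamma> y \<Longrightarrow> \<forall>t. ((\<lambda>t. (\<gamma> t, y t)) has_vector_derivative (y t, spray (\<gamma> t, y t))) (at t)"
    unfolding geo_def by (blast intro: has_vector_derivative_Pair)
  assume *: "\<forall>t. ((\<lambda>t. (\<gamma> t, y t)) has_vector_derivative (y t, spray (\<gamma> t, y t))) (at t)"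
  show "geo \<gamma> y"
    unfolding geo_def
    using bounded_linear.has_vector_derivative[OF bounded_linear_fst *[rule_format]]
      bounded_linear.has_vector_derivative[OF bounded_linear_snd *[rule_format]] by simp
qed

text \<open>Both velocities stay in a ball on which the truncated field agrees with the geodesic
  field, so Gronwall's inequality for a globally Lipschitz field applies.\<close>

lemma geo_dependence:
  obtains E where "E > 0" "\<And>\<gamma> y \<gamma>' y' t. geo \<gamma> y \<Longrightarrow> geo \<gamma>' y' \<Longrightarrow> norm (y 0) \<le> R \<Longrightarrow> norm (y' 0) \<le> R \<Longrightarrow> t \<in> {0..1} \<Longrightarrow>
    norm ((\<gamma> t, y t) - (\<gamma>' t, y' t)) \<le> E * norm ((\<gamma> 0, y 0) - (\<gamma>' 0, y' 0))"
proof -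
  obtain \<kappa> where \<kappa>: "\<kappa> \<ge> 1" and b: "\<And>\<gamma> y t. geo \<gamma> y \<Longrightarrow> norm (y t) \<le> \<kappa> * norm (y 0)"
    by (rule geo_norm_bound) blast
  have "\<kappa> * \<bar>R\<bar> + 1 > 0" using \<kappa> by (simp add: add_nonneg_pos)
  then obtain F L where L: "L > 0" and F: "\<And>z. norm (snd z) \<le> \<kappa> * \<bar>R\<bar> + 1 \<Longrightarrow> F z = (snd z, spray z)"
    and lip: "\<And>z z'. norm (F z - F z') \<le> L * norm (z - z')"
    by (rule truncated_field) blast
  have d: "((\<lambda>t. (\<gamma> t, y t)) has_vector_derivative F (\<gamma> t, y t)) (at t)"
    if "geo \<gamma> y" "norm (y 0) \<le> R" for \<gamma> y t
  proof -
    have "norm (y t) \<le> \<kappa> * \<bar>R\<bar>"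
      using b[OF that(1), of t] mult_left_mono[of "norm (y 0)" "\<bar>R\<bar>" \<kappa>] that(2) \<kappa> by linarith
    then show ?thesis using that(1) F[of "(\<gamma> t, y t)"] by (simp add: geo_pair_derivative)
  qed
  have "norm ((\<gamma> t, y t) - (\<gamma>' t, y' t)) \<le> exp (L + 1) * norm ((\<gamma> 0, y 0) - (\<gamma>' 0, y' 0))"
    if "geo \<gamma> y" "geo \<gamma>' y'" "norm (y 0) \<le> R" "norm (y' 0) \<le> R" "t \<in> {0..1}" for \<gamma> y \<gamma>' y' t
  proof -
    have lip': "norm (F a - F b) \<le> L * norm (a - b) + 0" for a b using lip[of a b] by simp
    have "norm ((\<gamma> t, y t) - (\<gamma>' t, y' t)) \<le> exp (L + 1) * (norm ((\<gamma> 0, y 0) - (\<gamma>' 0, y' 0)) + 0)"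
      by (rule gronwall_bound[OF has_vector_derivative_diff[OF d[OF that(1,3)] d[OF that(2,4)]] lip'])
        (use L that(5) in auto)
    then show ?thesis by simp
  qed
  then show thesis using that[of "exp (L + 1)"] by simp
qed

text \<open>The truncated system has a global solution, and the truncation never acts on it: the
  times at which the energy has its initial value form a closed set, which is also open because at
  such times the velocity lies strictly inside the ball, where energy is locally conserved.\<close>

lemma geo_exists:
  obtains \<gamma> y where "geo \<gamma> y" "\<gamma> 0 = x" "y 0 = v"
proof -
  obtain c C where c: "c > 0" "C > 0" and lo: "\<And>p v. c * norm v \<le> gnorm g p v"
    and hi: "\<And>p v. gnorm g p v \<le> C * norm v" by (rule gnorm_bounds) blast
  \<comment> \<open>The initial energy confines the velocity to norm at most
    \<open>C / c * norm v\<close>; the summand 1 leaves room, so that nearby times still see the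
    untruncated field.\<close>
  define R where "R = C / c * norm v + 1"
  have "R > 0" unfolding R_def using c by (simp add: add_nonneg_pos)
  then obtain F L where L: "L > 0" and F: "\<And>z. norm (snd z) \<le> R \<Longrightarrow> F z = (snd z, spray z)"
    and lip: "\<And>z z'. norm (F z - F z') \<le> L * norm (z - z')"
    by (rule truncated_field) blast
  have cF: "continuous_on UNIV F"
    by (rule lipschitz_on_continuous_on[of L]) (use lip L in \<open>auto simp: lipschitz_on_def dist_norm\<close>)
  obtain z where z0: "z 0 = (x, v)" and z: "\<And>t. (z has_vector_derivative F (z t)) (at t)"
    using ODE_global_solution[of "\<lambda>p. F (snd p)" L "(x, v)" "norm (F (x, v))"] lip L
      continuous_on_compose2[OF cF continuous_on_snd[OF continuous_on_id], of UNIV] by auto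
  define \<gamma> where "\<gamma> t = fst (z t)" for t
  define y where "y t = snd (z t)" for t
  have zt: "z t = (\<gamma> t, y t)" for t by (simp add: \<gamma>_def y_def)
  have d: "(\<gamma> has_vector_derivative y t) (at t)" "(y has_vector_derivative spray (\<gamma> t, y t)) (at t)"
    if "norm (y t) \<le> R" for t
    using bounded_linear.has_vector_derivative[OF bounded_linear_fst z[of t]]
      bounded_linear.has_vector_derivative[OF bounded_linear_snd z[of t]] F[of "z t"] that
    by (simp_all add: zt \<gamma>_def[symmetric] y_def[symmetric])
  have cz: "continuous_on UNIV z"
    using z has_vector_derivative_continuous continuous_at_imp_continuous_on by blast
  have c\<gamma>: "continuous_on UNIV \<gamma>" and cy: "continuous_on UNIV y"
    unfolding \<gamma>_def y_def by (intro continuous_intros cz)+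
  define e where "e t = y t \<bullet> (g (proj (\<gamma> t)) *v y t)" for t
  have ce: "continuous_on UNIV e"
    unfolding e_def quadratic_form
    by (intro continuous_intros cy continuous_on_compose2[OF smooth_continuous[OF smooth_metric] c\<gamma>]) auto
  have bound: "norm (y t) < R" if "e t = e 0" for t
  proof -
    have "gnorm g (proj (\<gamma> t)) (y t) = gnorm g (proj (\<gamma> 0)) (y 0)"
      using that by (simp add: gnorm_def e_def)
    then have "c * norm (y t) \<le> C * norm v"
      using lo[of "y t" "proj (\<gamma> t)"] hi[of "proj (\<gamma> 0)" "y 0"] z0 zt[of 0] by simp
    then have "norm (y t) \<le> C / c * norm v" using c by (simp add: field_simps)
    then show ?thesis by (simp add: R_def)
  qed
  let ?B = "{t. e t = e 0}"
  have "closed ?B" using continuous_closed_preimage_constant[OF ce, of "e 0"] by simp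
  moreover have "open ?B"
    unfolding open_contains_ball
  proof
    fix t assume t: "t \<in> ?B"
    have "open {s. norm (y s) < R}" by (intro open_Collect_less continuous_intros cy)
    then obtain r where r: "r > 0" "ball t r \<subseteq> {s. norm (y s) < R}"
      using t bound unfolding open_contains_ball by blast
    have "\<exists>k. \<forall>s\<in>ball t r. e s = k"
    proof (rule has_field_derivative_zero_constant[OF convex_ball])
      fix s assume "s \<in> ball t r"
      then have "norm (y s) \<le> R" using r(2) by auto
      from energy_derivative[OF d[OF this]] have "(e has_real_derivative 0) (at s)" by (simp only: e_def[abs_def])
      then show "(e has_real_derivative 0) (at s within ball t r)" by (rule has_field_derivative_at_within)
    qed
    then obtain k where "\<forall>s\<in>ball t r. e s = k" by blast
    moreover have "t \<in> ball t r" using r(1) by simp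
    ultimately have "ball t r \<subseteq> ?B" using t by auto
    then show "\<exists>r>0. ball t r \<subseteq> ?B" using r(1) by blast
  qed
  moreover have "0 \<in> ?B" by simp
  ultimately have "?B = UNIV" using clopen[of ?B] by blast
  then have "e t = e 0" for t by blast
  from bound[OF this] have "norm (y t) \<le> R" for t by (rule less_imp_le)
  then have "geo \<gamma> y" unfolding geo_def using d by blast
  then show thesis using that z0 zt[of 0] by simp
qed

section \<open>The exponential map near zero\<close>

lemma riem_exp_eq:
  assumes "geo \<gamma> y" shows "riem_exp g (\<gamma> 0) (y 0) = \<gamma> 1"
  unfolding riem_exp_def
proof (rule the_equality)
  show "\<exists>\<sigma>. geodesic g \<sigma> \<and> \<sigma> 0 = \<gamma> 0 \<and> (\<sigma> has_vector_derivative y 0) (at 0) \<and> \<sigma> 1 = \<gamma> 1"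
    using assms by (intro exI[of _ \<gamma>]) (auto simp: geodesic_iff geo_def)
next
  fix p assume "\<exists>\<sigma>. geodesic g \<sigma> \<and> \<sigma> 0 = \<gamma> 0 \<and> (\<sigma> has_vector_derivative y 0) (at 0) \<and> \<sigma> 1 = p"
  then obtain \<sigma> z where \<sigma>: "geo \<sigma> z" "\<sigma> 0 = \<gamma> 0" "(\<sigma> has_vector_derivative y 0) (at 0)" "\<sigma> 1 = p"
    by (auto simp: geodesic_iff)
  have "(\<sigma> has_vector_derivative z 0) (at 0)" using \<sigma>(1) by (simp add: geo_def)
  then have z: "z 0 = y 0" using \<sigma>(3) by (rule vector_derivative_unique_at)
  \<comment> \<open>This is uniqueness: with equal initial data the right-hand side is 0.\<close>
  obtain E where "norm ((\<sigma> 1, z 1) - (\<gamma> 1, y 1)) \<le> E * norm ((\<sigma> 0, z 0) - (\<gamma> 0, y 0))"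
    using geo_dependence[of "norm (y 0)"] \<sigma>(1) assms z by (metis atLeastAtMost_iff order_refl zero_le_one)
  then show "p = \<gamma> 1" using \<sigma> z by (simp add: zero_prod_def)
qed

text \<open>Dividing velocities by \<open>\<rho>\<close> reduces to the unit ball. Homogeneity
  contributes \<open>\<rho>\<^sup>2\<close>, and the rescaling stretches differences by at most
  \<open>1 / \<rho>\<close>.\<close>

lemma spray_lipschitz_small:
  obtains B where "B > 0" "\<And>\<rho> z z'. 0 < \<rho> \<Longrightarrow> \<rho> \<le> 1 \<Longrightarrow> norm (snd z) \<le> \<rho> \<Longrightarrow> norm (snd z') \<le> \<rho> \<Longrightarrow>
    norm (spray z - spray z') \<le> \<rho> * B * norm (z - z')"
proof -
  obtain B where B: "B > 0" "\<And>z z'. norm (snd z) \<le> 1 \<Longrightarrow> norm (snd z') \<le> 1 \<Longrightarrow>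
      norm (spray z - spray z') \<le> B * norm (z - z')"
    using strip_lipschitz[OF smooth_spray, of 1] spray_periodic by blast
  have "norm (spray z - spray z') \<le> \<rho> * B * norm (z - z')"
    if \<rho>: "0 < \<rho>" "\<rho> \<le> 1" and z: "norm (snd z) \<le> \<rho>" "norm (snd z') \<le> \<rho>" for \<rho> z z'
  proof -
    let ?s = "\<lambda>z. (fst z, snd z /\<^sub>R \<rho>)"
    have s: "spray z = \<rho>\<^sup>2 *\<^sub>R spray (?s z)" for z
      using spray_scale[of "fst z" \<rho> "snd z /\<^sub>R \<rho>"] \<rho> by simp
    have "norm (?s z - ?s z') \<le> norm (z - z') / \<rho>"
    proof -
      have "norm (?s z - ?s z') = sqrt ((norm (fst z - fst z'))\<^sup>2 + (norm (snd z - snd z') / \<rho>)\<^sup>2)"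
        using \<rho> by (simp add: norm_Pair divide_inverse mult.commute flip: scaleR_diff_right)
      also have "\<dots> \<le> sqrt ((norm (fst z - fst z') / \<rho>)\<^sup>2 + (norm (snd z - snd z') / \<rho>)\<^sup>2)"
        using \<rho> mult_left_mono[of \<rho> 1 "norm (fst z - fst z')"]
        by (intro real_sqrt_le_mono add_right_mono power_mono) (auto simp: field_simps)
      also have "\<dots> = norm (z - z') / \<rho>"
        using \<rho> by (simp add: norm_prod_def power_divide real_sqrt_divide flip: add_divide_distrib)
      finally show ?thesis .
    qed
    then have le: "B * norm (?s z - ?s z') \<le> B * (norm (z - z') / \<rho>)"
      by (rule mult_left_mono) (use B(1) in simp)
    have "norm (spray z - spray z') = \<rho>\<^sup>2 * norm (spray (?s z) - spray (?s z'))"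
      unfolding s[of z] s[of z'] by (simp flip: scaleR_diff_right)
    also have "\<dots> \<le> \<rho>\<^sup>2 * (B * (norm (z - z') / \<rho>))"
      by (intro mult_left_mono order_trans[OF B(2) le]) (use z \<rho> in \<open>simp_all add: field_simps\<close>)
    also have "\<dots> = \<rho> * B * norm (z - z')" using \<rho> by (simp add: power2_eq_square)
    finally show ?thesis .
  qed
  then show thesis using that B(1) by blast
qed

text \<open>For slow geodesics the difference of accelerations is small against the difference of
  initial velocities. Integrating twice over unit time bounds the deviation of the exponential map
  from a translation by half that difference, uniformly in \<open>x\<close>.\<close>

lemma exp_near_identity:
  obtains r where "r > 0" "r \<le> 1/4"
    "\<And>x v w. norm v < r \<Longrightarrow> norm w < r \<Longrightarrow> norm (riem_exp g x v - riem_exp g x w - (v - w)) \<le> norm (v - w) / 2"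
proof -
  obtain \<kappa> where \<kappa>: "\<kappa> \<ge> 1" and b: "\<And>\<gamma> y t. geo \<gamma> y \<Longrightarrow> norm (y t) \<le> \<kappa> * norm (y 0)"
    by (rule geo_norm_bound) blast
  obtain B where B: "B > 0" and lip: "\<And>\<rho> z z'. 0 < \<rho> \<Longrightarrow> \<rho> \<le> 1 \<Longrightarrow> norm (snd z) \<le> \<rho> \<Longrightarrow> norm (snd z') \<le> \<rho> \<Longrightarrow>
    norm (spray z - spray z') \<le> \<rho> * B * norm (z - z')" by (rule spray_lipschitz_small) blast
  obtain E where E: "E > 0" and dep: "\<And>\<gamma> y \<gamma>' y' t. geo \<gamma> y \<Longrightarrow> geo \<gamma>' y' \<Longrightarrow> norm (y 0) \<le> 1 \<Longrightarrow> norm (y' 0) \<le> 1 \<Longrightarrow> t \<in> {0..1} \<Longrightarrow>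
    norm ((\<gamma> t, y t) - (\<gamma>' t, y' t)) \<le> E * norm ((\<gamma> 0, y 0) - (\<gamma>' 0, y' 0))" by (rule geo_dependence) blast
  \<comment> \<open>The second entry makes \<open>\<rho> * B * E \<le> 1/2\<close>, which bounds the
    difference of accelerations; 1/4 serves the comparison with lattice vectors in the proof of
    injectivity.\<close>
  define \<rho> where "\<rho> = min (1/4) (1 / (2 * B * E))"
  have \<rho>: "\<rho> > 0" "\<rho> \<le> 1/4" using B E by (auto simp: \<rho>_def)
  have "\<rho> \<le> 1 / (2 * B * E)" by (simp add: \<rho>_def)
  then have \<rho>E: "\<rho> * B * E \<le> 1/2" using B E by (simp add: field_simps)
  \<comment> \<open>Dividing by \<open>\<kappa>\<close> keeps velocities below \<rho> at all times
    and not only initially.\<close>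
  have r: "\<rho> / \<kappa> > 0" "\<rho> / \<kappa> \<le> 1/4" using \<rho> \<kappa> frac_le[of \<rho> \<rho> 1 \<kappa>] by auto
  show thesis
  proof (rule that[OF r])
    fix x v w :: "real^2" assume v: "norm v < \<rho> / \<kappa>" and w: "norm w < \<rho> / \<kappa>"
    obtain \<gamma> y where 1: "geo \<gamma> y" "\<gamma> 0 = x" "y 0 = v" by (rule geo_exists)
    obtain \<sigma> z where 2: "geo \<sigma> z" "\<sigma> 0 = x" "z 0 = w" by (rule geo_exists)
    have small: "norm (y t) \<le> \<rho>" "norm (z t) \<le> \<rho>" for t
      using b[OF 1(1), of t] b[OF 2(1), of t] v w \<kappa> 1(3) 2(3) by (auto simp: field_simps)
    have "norm (y 0) \<le> 1" "norm (z 0) \<le> 1" using small[of 0] \<rho> by linarith+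
    then have zz: "norm ((\<gamma> t, y t) - (\<sigma> t, z t)) \<le> E * norm (v - w)" if "t \<in> {0..1}" for t
      using dep[OF 1(1) 2(1) _ _ that] 1 2 by (simp add: norm_Pair)
    have s: "norm (spray (\<gamma> t, y t) - spray (\<sigma> t, z t)) \<le> norm (v - w) / 2" if "t \<in> {0..1}" for t
    proof -
      have "norm (spray (\<gamma> t, y t) - spray (\<sigma> t, z t)) \<le> \<rho> * B * norm ((\<gamma> t, y t) - (\<sigma> t, z t))"
        using \<rho> small by (intro lip) auto
      also have "\<dots> \<le> \<rho> * B * (E * norm (v - w))"
        using zz[OF that] \<rho> B by (intro mult_left_mono) auto
      also have "\<dots> \<le> 1/2 * norm (v - w)"
        using mult_right_mono[OF \<rho>E norm_ge_zero[of "v - w"]] by (simp add: mult.assoc)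
      finally show ?thesis by simp
    qed
    have dy: "((\<lambda>t. y t - z t) has_vector_derivative spray (\<gamma> t, y t) - spray (\<sigma> t, z t)) (at t within {0..1})" for t
      by (rule has_vector_derivative_at_within[OF has_vector_derivative_diff[OF geoD(2)[OF 1(1)] geoD(2)[OF 2(1)]]])
    have yz: "norm (y t - z t - (v - w)) \<le> norm (v - w) / 2" if "t \<in> {0..1}" for t
      using norm_increment_le[OF dy s that] 1 2 by simp
    have dg: "((\<lambda>t. \<gamma> t - \<sigma> t - t *\<^sub>R (v - w)) has_vector_derivative y t - z t - (v - w)) (at t within {0..1})" for t
    proof -
      have "((\<lambda>t. t *\<^sub>R (v - w)) has_vector_derivative v - w) (at t)"
        using has_vector_derivative_scaleR[OF DERIV_ident has_vector_derivative_const[of "v - w"]] by simp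
      from has_vector_derivative_diff[OF has_vector_derivative_diff[OF geoD(1)[OF 1(1)] geoD(1)[OF 2(1)]] this]
      show ?thesis by (rule has_vector_derivative_at_within)
    qed
    from norm_increment_le[OF dg yz, of 1] show "norm (riem_exp g x v - riem_exp g x w - (v - w)) \<le> norm (v - w) / 2"
      using riem_exp_eq[OF 1(1)] riem_exp_eq[OF 2(1)] 1 2 by simp
  qed
qed

end

lemma LIMSEQ_subseqI:
  fixes X :: "nat \<Rightarrow> 'a::metric_space"
  assumes sub: "\<And>r :: nat \<Rightarrow> nat. strict_mono r \<Longrightarrow> \<exists>s :: nat \<Rightarrow> nat. strict_mono s \<and> (\<lambda>n. X (r (s n))) \<longlonglongrightarrow> l"
  shows "X \<longlonglongrightarrow> l"
proof (rule tendstoI)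
  fix e :: real assume "e > 0"
  show "\<forall>\<^sub>F n in sequentially. dist (X n) l < e"
  proof (rule ccontr)
    assume "\<not> (\<forall>\<^sub>F n in sequentially. dist (X n) l < e)"
    from not_eventually_sequentiallyD[OF this] obtain r :: "nat \<Rightarrow> nat"
      where r: "strict_mono r" "\<And>n. \<not> dist (X (r n)) l < e"
      by blast
    obtain s :: "nat \<Rightarrow> nat" where "(\<lambda>n. X (r (s n))) \<longlonglongrightarrow> l" using sub[OF r(1)] by blast
    then have "\<forall>\<^sub>F n in sequentially. dist (X (r (s n))) l < e" using \<open>e > 0\<close> by (rule tendstoD)
    then show False using r(2) by simp
  qed
qed

context riemannian_torus begin

text \<open>The derivative is the time-one value of the solution of the linearised geodesic equation.\<close>

lemma exp_differentiable: "\<exists>D. (riem_exp g x has_derivative D) (at v)"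
proof -
  obtain \<gamma> y where geo: "geo \<gamma> y" "\<gamma> 0 = x" "y 0 = v" by (rule geo_exists)
  obtain \<kappa> where \<kappa>: "\<kappa> \<ge> 1" and nb: "\<And>\<gamma> y t. geo \<gamma> y \<Longrightarrow> norm (y t) \<le> \<kappa> * norm (y 0)"
    by (rule geo_norm_bound) blast
  define R where "R = norm v + 1"
  obtain E where E: "E > 0" and dep: "\<And>\<gamma> y \<gamma>' y' t. geo \<gamma> y \<Longrightarrow> geo \<gamma>' y' \<Longrightarrow> norm (y 0) \<le> R \<Longrightarrow> norm (y' 0) \<le> R \<Longrightarrow> t \<in> {0..1} \<Longrightarrow>
    norm ((\<gamma> t, y t) - (\<gamma>' t, y' t)) \<le> E * norm ((\<gamma> 0, y 0) - (\<gamma>' 0, y' 0))" by (rule geo_dependence) blast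
  obtain B where B: "B > 0" and DB: "\<And>z w. norm (snd z) \<le> \<kappa> * R \<Longrightarrow> norm (frechet_derivative spray (at z) w) \<le> B * norm w"
    using strip_derivative_bounded[OF smooth_spray, of "\<kappa> * R"] spray_periodic by blast
  obtain C where C: "C > 0" and taylor: "\<And>z z'. norm (snd z) \<le> \<kappa> * R \<Longrightarrow> norm (snd z') \<le> \<kappa> * R \<Longrightarrow>
      norm (spray z' - spray z - frechet_derivative spray (at z) (z' - z)) \<le> C * (norm (z' - z))\<^sup>2"
    using strip_taylor[OF smooth_spray, of "\<kappa> * R"] spray_periodic by blast
  have speed: "norm (\<eta> t) \<le> \<kappa> * R" if "geo \<sigma> \<eta>" "norm (\<eta> 0) \<le> R" for \<sigma> \<eta> t
    using nb[OF that(1), of t] mult_left_mono[OF that(2), of \<kappa>] \<kappa> by linarith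
  define A where "A t = frechet_derivative spray (at (\<gamma> t, y t))" for t
  have lin: "linear (A t)" for t
    unfolding A_def by (rule has_derivative_linear[OF smooth_has_derivative[OF smooth_spray]])
  have AB: "norm (A t w) \<le> B * norm w" for t w
    unfolding A_def using speed[OF geo(1)] geo(3) by (intro DB) (auto simp: R_def)
  define L where "L = 1 + B"
  have L0: "L \<ge> 0" using B by (simp add: L_def)
  define F where "F p = (snd (snd p), A (fst p) (snd p))" for p :: "real \<times> (real^2) \<times> (real^2)"
  have Fdiff: "F (t, w) - F (t, w') = F (t, w - w')" for t w w'
    by (simp add: F_def linear_diff[OF lin])
  have FL: "norm (F (t, w)) \<le> L * norm w" for t w
  proof -
    have "norm (F (t, w)) \<le> norm (snd w) + norm (A t w)" by (simp add: F_def norm_Pair_le)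
    moreover have "norm (snd w) \<le> norm w"
      unfolding norm_prod_def[of w] using real_sqrt_sum_squares_ge2[of "norm (snd w)"] by simp
    ultimately show ?thesis using AB[of t w] by (simp add: L_def algebra_simps)
  qed
  have cont: "continuous_on UNIV F"
  proof -
    have cp: "continuous_on UNIV (\<lambda>t. (\<gamma> t, y t))"
      using has_vector_derivative_continuous[OF has_vector_derivative_Pair[OF geoD[OF geo(1)]]]
      by (intro continuous_at_imp_continuous_on ballI)
    have "A t w = (\<Sum>b\<in>Basis. (w \<bullet> b) *\<^sub>R A t b)" for t w
      by (subst euclidean_representation[symmetric, of w]) (simp only: linear_sum[OF lin] linear_cmul[OF lin])
    then have "(\<lambda>p. A (fst p) (snd p)) = (\<lambda>p. \<Sum>b\<in>Basis. (snd p \<bullet> b) *\<^sub>R A (fst p) b)" by (intro ext)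
    moreover have "continuous_on UNIV (\<lambda>p::real \<times> (real^2) \<times> (real^2). A (fst p) b)" for b
      unfolding A_def
      by (rule continuous_on_compose2[OF smooth_frechet_continuous[OF smooth_spray]
            continuous_on_compose2[OF cp continuous_on_fst[OF continuous_on_id]]]) auto
    ultimately have "continuous_on UNIV (\<lambda>p::real \<times> (real^2) \<times> (real^2). A (fst p) (snd p))"
      by (simp only:) (intro continuous_intros)
    then show ?thesis unfolding F_def[abs_def] by (intro continuous_intros)
  qed
  have "\<exists>W. W 0 = (0, h) \<and> (\<forall>t. (W has_vector_derivative F (t, W t)) (at t))" for h
  proof -
    have "norm (F (t, w) - F (t, w')) \<le> L * norm (w - w')" for t w w' unfolding Fdiff by (rule FL)
    from ODE_global_solution[OF cont this L0 FL, of "(0, h)"] show ?thesis by blast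
  qed
  then have "\<forall>h. \<exists>W. W 0 = (0, h) \<and> (\<forall>t. (W has_vector_derivative F (t, W t)) (at t))" by blast
  from choice[OF this] obtain W where "\<forall>h. W h 0 = (0, h) \<and> (\<forall>t. (W h has_vector_derivative F (t, W h t)) (at t))" ..
  then have W0: "W h 0 = (0, h)" and dW: "(W h has_vector_derivative F (t, W h t)) (at t)" for h t by auto
  \<comment> \<open>Uniqueness for the linearised equation. Applied to combinations of its solutions
    it yields linearity of the time-one map \<open>D\<close>.\<close>
  have zero: "w 1 = 0" if "w 0 = 0" and w: "\<And>t. (w has_vector_derivative F (t, w t)) (at t)" for w
  proof -
    have "norm (w 1) \<le> exp (L + 1) * (norm (w 0) + 0)"
      by (rule gronwall_bound[OF w]) (use FL L0 in auto)
    then show ?thesis using that(1) by simp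
  qed
  have F_add: "F (t, w) + F (t, w') = F (t, w + w')" and F_scale: "r *\<^sub>R F (t, w) = F (t, r *\<^sub>R w)" for t w w' r
    by (simp_all add: F_def linear_add[OF lin] linear_cmul[OF lin])
  define D where "D h = fst (W h 1)" for h
  have "linear D"
  proof (rule linearI)
    fix h k
    have "(\<lambda>t. W (h + k) t - (W h t + W k t)) 1 = 0"
    proof (rule zero)
      show "((\<lambda>t. W (h + k) t - (W h t + W k t)) has_vector_derivative F (t, W (h + k) t - (W h t + W k t))) (at t)" for t
        using has_vector_derivative_diff[OF dW[of "h + k" t] has_vector_derivative_add[OF dW[of h t] dW[of k t]]]
        by (simp only: F_add Fdiff)
    qed (simp add: W0 zero_prod_def)
    then show "D (h + k) = D h + D k" by (simp add: D_def)
  next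
    fix r h
    have "(\<lambda>t. W (r *\<^sub>R h) t - r *\<^sub>R W h t) 1 = 0"
    proof (rule zero)
      show "((\<lambda>t. W (r *\<^sub>R h) t - r *\<^sub>R W h t) has_vector_derivative F (t, W (r *\<^sub>R h) t - r *\<^sub>R W h t)) (at t)" for t
        using has_vector_derivative_diff[OF dW[of "r *\<^sub>R h" t]
            bounded_linear.has_vector_derivative[OF bounded_linear_scaleR_right[of r] dW[of h t]]]
        by (simp only: F_scale Fdiff)
    qed (simp add: W0 zero_prod_def)
    then show "D (r *\<^sub>R h) = r *\<^sub>R D h" by (simp add: D_def)
  qed
  then have D: "bounded_linear D" by (simp add: linear_conv_bounded_linear)
  define K where "K = exp (L + 1) * (C * E\<^sup>2)"
  have K: "K > 0" using C E by (simp add: K_def)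
  \<comment> \<open>The difference \<open>\<Delta>\<close> of two geodesics solves the linearised
    equation up to the Taylor remainder of the spray, which is quadratic in \<open>h\<close> by the
    dependence estimate. Gronwall passes this on to \<open>\<Delta> - W h\<close>.\<close>
  have quad: "norm (riem_exp g x (v + h) - riem_exp g x v - D h) \<le> K * (norm h)\<^sup>2" if h: "norm h < 1" for h
  proof -
    obtain \<sigma> \<eta> where gh: "geo \<sigma> \<eta>" "\<sigma> 0 = x" "\<eta> 0 = v + h" by (rule geo_exists)
    have R: "norm (y 0) \<le> R" "norm (\<eta> 0) \<le> R"
      using geo(3) gh(3) h norm_triangle_ineq[of v h] by (auto simp: R_def)
    define \<Delta> where "\<Delta> t = (\<sigma> t, \<eta> t) - (\<gamma> t, y t)" for t
    have \<Delta>: "norm (\<Delta> t) \<le> E * norm h" if "t \<in> {0..1}" for t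
      using dep[OF gh(1) geo(1) R(2,1) that] geo gh by (simp add: \<Delta>_def norm_Pair)
    let ?w' = "\<lambda>t. ((\<eta> t, spray (\<sigma> t, \<eta> t)) - (y t, spray (\<gamma> t, y t))) - F (t, W h t)"
    have "norm ((\<lambda>t. \<Delta> t - W h t) 1) \<le> exp (L + 1) * (norm ((\<lambda>t. \<Delta> t - W h t) 0) + C * (E * norm h)\<^sup>2)"
    proof (rule gronwall_bound)
      show "((\<lambda>t. \<Delta> t - W h t) has_vector_derivative ?w' t) (at t)" for t
        unfolding \<Delta>_def
        by (rule has_vector_derivative_diff[OF has_vector_derivative_diff[OF
              has_vector_derivative_Pair[OF geoD[OF gh(1)]] has_vector_derivative_Pair[OF geoD[OF geo(1)]]] dW])
    next
      fix t :: real assume t: "t \<in> {0..1}"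
      let ?e = "spray (\<sigma> t, \<eta> t) - spray (\<gamma> t, y t) - A t (\<Delta> t)"
      have "?w' t = (0, ?e) + (F (t, \<Delta> t) - F (t, W h t))"
        by (simp add: F_def \<Delta>_def)
      then have "norm (?w' t) \<le> norm (0 :: real^2, ?e) + norm (F (t, \<Delta> t - W h t))"
        unfolding Fdiff using norm_triangle_ineq by metis
      moreover have "norm ?e \<le> C * (norm (\<Delta> t))\<^sup>2"
        unfolding A_def \<Delta>_def using speed[OF geo(1) R(1)] speed[OF gh(1) R(2)] by (intro taylor) auto
      moreover have "C * (norm (\<Delta> t))\<^sup>2 \<le> C * (E * norm h)\<^sup>2"
        using \<Delta>[OF t] C by (intro mult_left_mono power_mono) auto
      ultimately show "norm (?w' t) \<le> L * norm (\<Delta> t - W h t) + C * (E * norm h)\<^sup>2"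
        using FL[of t "\<Delta> t - W h t"] by (simp add: norm_Pair)
    qed (use L0 C in auto)
    moreover have "\<Delta> 0 - W h 0 = 0" using geo gh by (simp add: \<Delta>_def W0 zero_prod_def)
    ultimately have "norm (\<Delta> 1 - W h 1) \<le> exp (L + 1) * (C * (E * norm h)\<^sup>2)" by simp
    also have "\<dots> = K * (norm h)\<^sup>2" by (simp add: K_def power_mult_distrib)
    finally have "norm (\<Delta> 1 - W h 1) \<le> K * (norm h)\<^sup>2" .
    moreover have "norm (fst (\<Delta> 1 - W h 1)) \<le> norm (\<Delta> 1 - W h 1)"
      unfolding norm_prod_def[of "\<Delta> 1 - W h 1"] using real_sqrt_sum_squares_ge1 by blast
    moreover have "fst (\<Delta> 1 - W h 1) = riem_exp g x (v + h) - riem_exp g x v - D h"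
      using riem_exp_eq[OF gh(1)] riem_exp_eq[OF geo(1)] geo gh by (simp add: \<Delta>_def D_def)
    ultimately show ?thesis by simp
  qed
  have "(riem_exp g x has_derivative D) (at v)"
    unfolding has_derivative_at_alt
  proof (intro conjI allI impI D)
    fix e :: real assume e: "e > 0"
    show "\<exists>d>0. \<forall>w. norm (w - v) < d \<longrightarrow> norm (riem_exp g x w - riem_exp g x v - D (w - v)) \<le> e * norm (w - v)"
    proof (intro exI[of _ "min 1 (e / K)"] conjI allI impI)
      show "0 < min 1 (e / K)" using e K by simp
      fix w assume w: "norm (w - v) < min 1 (e / K)"
      then have "K * norm (w - v) \<le> e" using K by (simp add: field_simps)
      then have "K * norm (w - v) * norm (w - v) \<le> e * norm (w - v)" by (rule mult_right_mono) simp
      then show "norm (riem_exp g x w - riem_exp g x v - D (w - v)) \<le> e * norm (w - v)"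
        using quad[of "w - v"] w by (simp add: power2_eq_square mult.assoc)
    qed
  qed
  then show ?thesis by blast
qed

section \<open>The injectivity radius and the continuity of minimizing geodesics\<close>

lemma injectivity_radius_witness:
  "\<exists>\<rho>>0. \<forall>x. inj_on (\<lambda>v. proj (riem_exp g x v)) {v. gnorm g (proj x) v < \<rho>} \<and>
     (\<forall>v. gnorm g (proj x) v < \<rho> \<longrightarrow> (\<exists>D. (riem_exp g x has_derivative D) (at v) \<and> bij D))"
proof -
  obtain r where r: "r > 0" "r \<le> 1/4" and near: "\<And>x v w. norm v < r \<Longrightarrow> norm w < r \<Longrightarrow>
      norm (riem_exp g x v - riem_exp g x w - (v - w)) \<le> norm (v - w) / 2"
    by (rule exp_near_identity) blast
  obtain c C where c: "c > 0" and lo: "\<And>p v. c * norm v \<le> gnorm g p v"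
    by (rule gnorm_bounds) blast
  have small: "norm v < r" if "gnorm g p v < c * r" for p v
    using that lo[of v p] c by (smt (verit) mult_less_cancel_left_pos)
  have inj: "inj_on (\<lambda>v. proj (riem_exp g x v)) {v. gnorm g (proj x) v < c * r}" for x
  proof (rule inj_onI)
    fix v w assume "v \<in> {v. gnorm g (proj x) v < c * r}" "w \<in> {v. gnorm g (proj x) v < c * r}"
    then have v: "norm v < r" "norm w < r" using small by auto
    let ?d = "riem_exp g x v - riem_exp g x w"
    assume "proj (riem_exp g x v) = proj (riem_exp g x w)"
    then have d: "?d \<in> lattice2" by (simp add: proj_eq_lattice)
    \<comment> \<open>The lifted images then differ by less than 3/4, whereas a nonzero lattice
      vector has norm at least 1; this is where \<open>r \<le> 1/4\<close> enters.\<close>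
    have "norm (v - w) < 1/2" using v r(2) norm_triangle_ineq4[of v w] by linarith
    then have "norm ?d < 1"
      using near[OF v, of x] norm_triangle_ineq2[of ?d "v - w"] by linarith
    then have "?d = 0" using norm_lattice2_ge_1[OF d] by force
    then have "norm (v - w) \<le> norm (v - w) / 2" using near[OF v, of x] by (simp add: norm_minus_commute)
    then show "v = w" by simp
  qed
  have bij: "\<exists>D. (riem_exp g x has_derivative D) (at v) \<and> bij D" if v: "norm v < r" for x v
  proof -
    obtain D where D: "(riem_exp g x has_derivative D) (at v)" using exp_differentiable by blast
    have "k = 0" if k: "D k = 0" for k
    proof (rule ccontr)
      assume "k \<noteq> 0"
      \<comment> \<open>Along a small multiple of a kernel vector the image moves by at most 1/4 of
        its length, but \<open>near\<close> forces it to move by at least 1/2.\<close>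
      obtain d where d: "d > 0" and dd: "\<And>w. norm (w - v) < d \<Longrightarrow>
          norm (riem_exp g x w - riem_exp g x v - D (w - v)) \<le> 1/4 * norm (w - v)"
        using D unfolding has_derivative_at_alt by (metis zero_less_divide_1_iff zero_less_numeral)
      define s where "s = min d (r - norm v) / 2 / norm k"
      have s: "s > 0" using d v \<open>k \<noteq> 0\<close> by (simp add: s_def)
      have ns: "norm (s *\<^sub>R k) = min d (r - norm v) / 2" using \<open>k \<noteq> 0\<close> d v by (simp add: s_def)
      have "norm (s *\<^sub>R k) \<le> d / 2" "norm (s *\<^sub>R k) \<le> (r - norm v) / 2"
        unfolding ns by (intro divide_right_mono; simp)+
      then have sk: "norm (s *\<^sub>R k) < d" "norm (v + s *\<^sub>R k) < r"
        using d v norm_triangle_ineq[of v "s *\<^sub>R k"] by argo+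
      have "D (s *\<^sub>R k) = 0" using k linear_cmul[OF has_derivative_linear[OF D]] by simp
      then have "norm (riem_exp g x (v + s *\<^sub>R k) - riem_exp g x v) \<le> 1/4 * norm (s *\<^sub>R k)"
        using dd[of "v + s *\<^sub>R k"] sk(1) by simp
      moreover have "norm (riem_exp g x (v + s *\<^sub>R k) - riem_exp g x v - s *\<^sub>R k) \<le> norm (s *\<^sub>R k) / 2"
        using near[OF sk(2) v, of x] by simp
      moreover have "norm (s *\<^sub>R k) > 0" using s \<open>k \<noteq> 0\<close> by simp
      ultimately show False
        using norm_triangle_ineq2[of "s *\<^sub>R k" "riem_exp g x (v + s *\<^sub>R k) - riem_exp g x v"]
          norm_minus_commute[of "s *\<^sub>R k" "riem_exp g x (v + s *\<^sub>R k) - riem_exp g x v"] by argo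
    qed
    then have "inj D" using linear_injective_0[OF has_derivative_linear[OF D]] by blast
    then have "bij D"
      using linear_injective_imp_surjective[OF has_derivative_linear[OF D]] by (simp add: bij_def)
    then show ?thesis using D by blast
  qed
  have "c * r > 0" using c r by simp
  then show ?thesis using inj bij small by blast
qed

text \<open>If the set of admissible radii were unbounded, \<open>Sup\<close> would carry no
  information, but then some radius exceeds \<delta> anyway.\<close>

lemma injectivity_radius_gt:
  assumes "\<delta> < injectivity_radius g"
  obtains \<rho> where "\<rho> > \<delta>" "\<And>x. inj_on (\<lambda>v. proj (riem_exp g x v)) {v. gnorm g (proj x) v < \<rho>}"
proof -
  let ?S = "{\<rho>. \<rho> > 0 \<and> (\<forall>x. inj_on (\<lambda>v. proj (riem_exp g x v)) {v. gnorm g (proj x) v < \<rho>} \<and>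
     (\<forall>v. gnorm g (proj x) v < \<rho> \<longrightarrow> (\<exists>D. (riem_exp g x has_derivative D) (at v) \<and> bij D)))}"
  have ne: "?S \<noteq> {}" using injectivity_radius_witness by blast
  have "\<exists>\<rho>\<in>?S. \<delta> < \<rho>"
  proof (cases "bdd_above ?S")
    case True
    then show ?thesis using assms less_cSup_iff[OF ne True] unfolding injectivity_radius_def by blast
  next
    case False
    then show ?thesis unfolding bdd_above_def using not_le by blast
  qed
  then show thesis using that by blast
qed

lemma curve_length_geo:
  assumes "geo \<gamma> y" shows "curve_length g \<gamma> = gnorm g (proj (\<gamma> 0)) (y 0)"
proof -
  have "gnorm g (proj (\<gamma> t)) (vector_derivative \<gamma> (at t)) = gnorm g (proj (\<gamma> 0)) (y 0)" for t
    using vector_derivative_at[OF geoD(1)[OF assms]] geo_speed[OF assms, of t 0] by simp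
  then show ?thesis unfolding curve_length_def by simp
qed

text \<open>By compactness the initial velocities of the chosen minimizing geodesics vary continuously:
  any limit velocity yields the same endpoint, and the exponential map is injective below \<open>\<rho>\<close>.\<close>

lemma continuous_geodesic_displacement:
  fixes a b :: "torus \<Rightarrow> torus" and \<sigma> :: "torus \<Rightarrow> real \<Rightarrow> real^2"
  assumes \<delta>: "\<delta> < injectivity_radius g" and a: "continuous_on UNIV a" and b: "continuous_on UNIV b"
    and \<sigma>: "\<And>p. minimizing_geodesic g (\<sigma> p) (a p) (b p)" and len: "\<And>p. riem_dist g (a p) (b p) \<le> \<delta>"
  shows "continuous_on UNIV (\<lambda>p. \<sigma> p 1 - \<sigma> p 0)"
proof -
  obtain \<rho> where \<rho>: "\<rho> > \<delta>" and inj: "\<And>x. inj_on (\<lambda>v. proj (riem_exp g x v)) {v. gnorm g (proj x) v < \<rho>}"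
    using injectivity_radius_gt[OF \<delta>] by blast
  obtain c C where c: "c > 0" and lo: "\<And>p v. c * norm v \<le> gnorm g p v"
    by (rule gnorm_bounds) blast
  have "\<forall>p. \<exists>y. geo (\<sigma> p) y"
    using \<sigma> by (simp add: minimizing_geodesic_def geodesic_iff)
  from choice[OF this] obtain y where geo: "\<And>p. geo (\<sigma> p) (y p)" by blast
  have ends: "proj (\<sigma> p 0) = a p" "proj (\<sigma> p 1) = b p" for p
    using \<sigma>[of p] by (auto simp: minimizing_geodesic_def)
  have speed: "gnorm g (a p) (y p 0) \<le> \<delta>" for p
    using curve_length_geo[OF geo, of p] \<sigma>[of p] len[of p] ends(1)[of p] by (simp add: minimizing_geodesic_def)
  have yb: "norm (y p 0) \<le> \<delta> / c" for p
    using lo[of "y p 0" "a p"] speed[of p] c by (simp add: field_simps)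
  obtain E where dep: "\<And>\<gamma> y \<gamma>' y' t. geo \<gamma> y \<Longrightarrow> geo \<gamma>' y' \<Longrightarrow> norm (y 0) \<le> \<delta> / c \<Longrightarrow> norm (y' 0) \<le> \<delta> / c \<Longrightarrow> t \<in> {0..1} \<Longrightarrow>
    norm ((\<gamma> t, y t) - (\<gamma>' t, y' t)) \<le> E * norm ((\<gamma> 0, y 0) - (\<gamma>' 0, y' 0))" by (rule geo_dependence) blast
  have key: "\<exists>s :: nat \<Rightarrow> nat. strict_mono s \<and> (\<lambda>n. \<sigma> (P (s n)) 1 - \<sigma> (P (s n)) 0) \<longlonglongrightarrow> \<sigma> p 1 - \<sigma> p 0"
    if P: "P \<longlonglongrightarrow> p" for P :: "nat \<Rightarrow> torus" and p
  proof -
    have aP: "(\<lambda>n. a (P n)) \<longlonglongrightarrow> a p" and bP: "(\<lambda>n. b (P n)) \<longlonglongrightarrow> b p"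
      using a b P by (auto intro: continuous_on_tendsto_compose)
    let ?x = "\<sigma> p 0"
    \<comment> \<open>Starting points are compared in the plane through representatives near
      \<open>?x\<close>; the summand \<open>inverse (real (Suc n))\<close> supplies the strict
      inequality required by \<open>dist_proj_ltE\<close>.\<close>
    have "\<exists>z. proj z = a (P n) \<and> dist ?x z < dist (a p) (a (P n)) + inverse (real (Suc n))" for n
    proof -
      have "dist (proj ?x) (a (P n)) < dist (a p) (a (P n)) + inverse (real (Suc n))" by (simp add: ends)
      then show ?thesis using dist_proj_ltE by metis
    qed
    then obtain z where z: "\<And>n. proj (z n) = a (P n)"
      and zd: "\<And>n. dist ?x (z n) < dist (a p) (a (P n)) + inverse (real (Suc n))" by metis
    have "(\<lambda>n. dist (a p) (a (P n)) + inverse (real (Suc n))) \<longlonglongrightarrow> dist (a p) (a p) + 0"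
      by (intro tendsto_intros aP LIMSEQ_inverse_real_of_nat)
    then have "(\<lambda>n. dist (a p) (a (P n)) + inverse (real (Suc n))) \<longlonglongrightarrow> 0" by simp
    moreover have "\<forall>n. norm (dist (z n) ?x) \<le> dist (a p) (a (P n)) + inverse (real (Suc n))"
      using less_imp_le[OF zd] by (simp add: dist_commute)
    ultimately have "(\<lambda>n. dist (z n) ?x) \<longlonglongrightarrow> 0"
      by (rule Lim_null_comparison[OF always_eventually, rotated])
    then have zlim: "z \<longlonglongrightarrow> ?x" by (rule tendsto_dist_iff[THEN iffD2])
    have "bounded (range (\<lambda>n. y (P n) 0))" using yb by (intro boundedI) auto
    then obtain u and s :: "nat \<Rightarrow> nat" where s: "strict_mono s" and u: "((\<lambda>n. y (P n) 0) \<circ> s) \<longlonglongrightarrow> u"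
      using bounded_imp_convergent_subsequence by blast
    \<comment> \<open>Adding \<open>k n\<close> makes the lift \<open>\<sigma> (P (s n))\<close>
      start at \<open>z (s n)\<close>; a lattice translate of a geodesic is again a geodesic, with
      the same displacement.\<close>
    define k where "k n = z (s n) - \<sigma> (P (s n)) 0" for n
    have k: "k n \<in> lattice2" for n
      unfolding k_def using z ends(1) by (simp flip: proj_eq_lattice)
    obtain \<gamma> w where \<gamma>: "geo \<gamma> w" "\<gamma> 0 = ?x" "w 0 = u" by (rule geo_exists)
    have zs: "(\<lambda>n. z (s n)) \<longlonglongrightarrow> ?x" using LIMSEQ_subseq_LIMSEQ[OF zlim s] by (simp add: o_def)
    have us: "(\<lambda>n. y (P (s n)) 0) \<longlonglongrightarrow> u" using u by (simp add: o_def)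
    have as: "(\<lambda>n. a (P (s n))) \<longlonglongrightarrow> a p" using LIMSEQ_subseq_LIMSEQ[OF aP s] by (simp add: o_def)
    have "(\<lambda>n. gnorm g (a (P (s n))) (y (P (s n)) 0)) \<longlonglongrightarrow> gnorm g (a p) u"
      using continuous_on_tendsto_compose[OF continuous_gnorm tendsto_Pair[OF as us]] by simp
    then have gu: "gnorm g (a p) u \<le> \<delta>"
      by (rule LIMSEQ_le_const2) (simp add: speed)
    have ub: "norm u \<le> \<delta> / c" using lo[of u "a p"] gu c by (simp add: field_simps)
    have close: "norm (\<sigma> (P (s n)) 1 + k n - \<gamma> 1) \<le> \<bar>E\<bar> * norm ((z (s n), y (P (s n)) 0) - (?x, u))" for n
    proof -
      let ?d = "(\<sigma> (P (s n)) 1 + k n, y (P (s n)) 1) - (\<gamma> 1, w 1)"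
      have "norm ?d \<le> E * norm ((z (s n), y (P (s n)) 0) - (?x, u))"
        using dep[OF geo_translate[OF geo[of "P (s n)"] k[of n]] \<gamma>(1), of 1] yb ub \<gamma> by (simp add: k_def)
      moreover have "norm (fst ?d) \<le> norm ?d"
        unfolding norm_prod_def[of ?d] using real_sqrt_sum_squares_ge1 by blast
      moreover have "E * norm ((z (s n), y (P (s n)) 0) - (?x, u)) \<le> \<bar>E\<bar> * norm ((z (s n), y (P (s n)) 0) - (?x, u))"
        by (intro mult_right_mono) auto
      ultimately show ?thesis by simp
    qed
    have "(\<lambda>n. \<bar>E\<bar> * norm ((z (s n), y (P (s n)) 0) - (?x, u))) \<longlonglongrightarrow> \<bar>E\<bar> * norm ((?x, u) - (?x, u))"
      by (intro tendsto_intros zs us)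
    then have "(\<lambda>n. \<bar>E\<bar> * norm ((z (s n), y (P (s n)) 0) - (?x, u))) \<longlonglongrightarrow> 0" by simp
    then have "(\<lambda>n. \<sigma> (P (s n)) 1 + k n - \<gamma> 1) \<longlonglongrightarrow> 0"
      by (rule Lim_null_comparison[OF always_eventually, rotated]) (simp only: close simp_thms)
    then have lim: "(\<lambda>n. \<sigma> (P (s n)) 1 + k n) \<longlonglongrightarrow> \<gamma> 1" by (simp add: LIM_zero_iff)
    have "(\<lambda>n. proj (\<sigma> (P (s n)) 1 + k n)) \<longlonglongrightarrow> proj (\<gamma> 1)"
      by (rule continuous_on_tendsto_compose[OF continuous_on_proj[of UNIV] lim]) auto
    moreover have "proj (\<sigma> (P (s n)) 1 + k n) = b (P (s n))" for n using k ends(2) by simp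
    ultimately have "(\<lambda>n. b (P (s n))) \<longlonglongrightarrow> proj (\<gamma> 1)" by simp
    then have pg: "proj (\<gamma> 1) = b p"
      using LIMSEQ_subseq_LIMSEQ[OF bP s] LIMSEQ_unique by (fastforce simp: o_def)
    have e1: "riem_exp g ?x u = \<gamma> 1" and e2: "riem_exp g ?x (y p 0) = \<sigma> p 1"
      using riem_exp_eq[OF \<gamma>(1)] riem_exp_eq[OF geo[of p]] \<gamma> by simp_all
    have "u = y p 0"
      by (rule inj_onD[OF inj[of ?x]]) (use pg e1 e2 ends gu speed[of p] \<rho> in auto)
    then have "\<gamma> 1 = \<sigma> p 1" using e1 e2 by simp
    then have "(\<lambda>n. (\<sigma> (P (s n)) 1 + k n) - z (s n)) \<longlonglongrightarrow> \<sigma> p 1 - ?x"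
      using tendsto_diff[OF lim zs] by simp
    then show ?thesis using s by (intro exI[of _ s]) (simp add: k_def)
  qed
  show ?thesis
  proof (rule continuous_on_sequentiallyI)
    fix P :: "nat \<Rightarrow> torus" and p assume P: "P \<longlonglongrightarrow> p"
    show "(\<lambda>n. \<sigma> (P n) 1 - \<sigma> (P n) 0) \<longlonglongrightarrow> \<sigma> p 1 - \<sigma> p 0"
    proof (rule LIMSEQ_subseqI)
      show "\<exists>s :: nat \<Rightarrow> nat. strict_mono s \<and> (\<lambda>n. \<sigma> (P (r (s n))) 1 - \<sigma> (P (r (s n))) 0) \<longlonglongrightarrow> \<sigma> p 1 - \<sigma> p 0"
        if "strict_mono r" for r :: "nat \<Rightarrow> nat"
        using key[OF LIMSEQ_subseq_LIMSEQ[OF P that]] by (simp add: o_def)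
    qed
  qed
qed

end

section \<open>The flux of constant forms\<close>

lemma smooth_map_continuous: "smooth_map f \<Longrightarrow> continuous_on UNIV f"
proof -
  assume "smooth_map f"
  then obtain F where F: "smooth F" "is_lift F f" by (auto simp: smooth_map_def)
  then have "(\<lambda>x. f (proj x)) = (\<lambda>x. proj (F x))" by (simp add: is_lift_def)
  moreover have "continuous_on UNIV (\<lambda>x. proj (F x))"
    by (rule continuous_on_compose2[OF continuous_on_proj[of UNIV] smooth_continuous[OF F(1)]]) simp
  ultimately show ?thesis unfolding continuous_on_torus_iff by (simp only:)
qed

lemma continuous_torus_bcontfun:
  fixes f :: "torus \<Rightarrow> 'a::metric_space"
  assumes "continuous_on UNIV f" shows "f \<in> bcontfun"
  unfolding bcontfun_def
  using assms compact_imp_bounded[OF compact_continuous_image[OF assms compact_UNIV_torus]] by simp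

lemma smooth_slice:
  fixes G :: "real \<times> (real^2) \<Rightarrow> 'b::real_normed_vector"
  assumes "smooth G"
  shows "smooth (\<lambda>x. G (t, x))" "smooth (\<lambda>s. G (s, x))"
  by (rule smooth_compose[OF assms smooth_Pair[OF smooth_const smooth_ident]])
    (rule smooth_compose[OF assms smooth_Pair[OF smooth_ident smooth_const]])

lemma has_vector_derivative_slice:
  fixes G :: "real \<times> (real^2) \<Rightarrow> 'b::real_normed_vector"
  assumes "smooth G"
  shows "((\<lambda>s. G (s, x)) has_vector_derivative frechet_derivative G (at (t, x)) (1, 0)) (at t)"
proof -
  have D: "(G has_derivative frechet_derivative G (at (t, x))) (at (t, x))"
    by (rule smooth_has_derivative[OF assms])
  have "((\<lambda>s. (s, x)) has_derivative (\<lambda>h. (h, 0))) (at t)" by (auto intro!: derivative_eq_intros)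
  from has_derivative_compose[OF this D]
  have "((\<lambda>s. G (s, x)) has_derivative (\<lambda>h. frechet_derivative G (at (t, x)) (h, 0))) (at t)" .
  moreover have "frechet_derivative G (at (t, x)) (h, 0) = h *\<^sub>R frechet_derivative G (at (t, x)) (1, 0)" for h
    using linear_cmul[OF has_derivative_linear[OF D], of h "(1, 0)"] by simp
  ultimately show ?thesis
    unfolding has_vector_derivative_def by (rule has_derivative_eq_rhs[OF _ ext])
qed

text \<open>A lift of the isotopy starts at a lift of the identity, that is, at a translation by a
  lattice vector, which can be subtracted. Equivariance holds at time 0 and persists because its
  defect is lattice valued and continuous in time.\<close>

lemma smooth_isotopy_lift:
  assumes "smooth_isotopy \<Phi>"
  obtains G :: "real \<times> (real^2) \<Rightarrow> real^2" where "smooth G" "\<And>x. G (0, x) = x"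
    "\<And>t x. t \<in> {0..1} \<Longrightarrow> proj (G (t, x)) = \<Phi> t (proj x)"
    "\<And>t x k. t \<in> {0..1} \<Longrightarrow> k \<in> lattice2 \<Longrightarrow> G (t, x + k) = G (t, x) + k"
proof -
  obtain G0 :: "real \<times> (real^2) \<Rightarrow> real^2" where G0: "smooth G0" "\<And>t x. t \<in> {0..1} \<Longrightarrow> proj (G0 (t, x)) = \<Phi> t (proj x)"
    using assms by (auto simp: smooth_isotopy_def is_lift_def)
  have id: "\<Phi> 0 = id" using assms by (simp add: smooth_isotopy_def)
  have "G0 (0, x) - x = G0 (0, 0) - 0" for x
  proof (rule lattice2_valued_constant[of UNIV "\<lambda>x. G0 (0, x) - x"])
    show "continuous_on UNIV (\<lambda>x. G0 (0, x) - x)"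
      by (intro continuous_intros smooth_continuous smooth_slice G0)
    show "G0 (0, x) - x \<in> lattice2" for x using G0(2)[of 0 x] id by (simp flip: proj_eq_lattice)
  qed auto
  then have c: "G0 (0, x) = x + G0 (0, 0)" for x by (metis add.commute diff_add_cancel diff_zero)
  have cl: "G0 (0, 0) \<in> lattice2" using G0(2)[of 0 0] id proj_eq_lattice[of "G0 (0, 0)" 0] by simp
  define G where "G z = G0 z - G0 (0, 0)" for z
  have sG: "smooth G" unfolding G_def by (intro smooth_diff G0 smooth_const)
  have G0x: "G (0, x) = x" for x by (simp add: G_def c[of x])
  have lift: "proj (G (t, x)) = \<Phi> t (proj x)" if "t \<in> {0..1}" for t x
    using G0(2)[OF that, of x] proj_add_lattice[OF lattice2_minus[OF cl], of "G0 (t, x)"] by (simp add: G_def)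
  have "G (t, x + k) = G (t, x) + k" if "t \<in> {0..1}" "k \<in> lattice2" for t x k
  proof -
    have "G (t, x + k) - G (t, x) = G (0, x + k) - G (0, x)"
    proof (rule lattice2_valued_constant[of "{0..1}" "\<lambda>t. G (t, x + k) - G (t, x)"])
      show "continuous_on {0..1} (\<lambda>t. G (t, x + k) - G (t, x))"
        by (intro continuous_intros continuous_on_subset[OF smooth_continuous[OF smooth_slice(2)[OF sG]]]) auto
      show "G (s, x + k) - G (s, x) \<in> lattice2" if "s \<in> {0..1}" for s
        using lift[OF that, of "x + k"] lift[OF that, of x] \<open>k \<in> lattice2\<close> by (simp flip: proj_eq_lattice)
    qed (use that in auto)
    then show ?thesis by (simp add: G0x algebra_simps)
  qed
  then show thesis using that sG lift G0x by blast
qed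

lemma integral_velocity:
  assumes \<gamma>: "\<And>t. (\<gamma> has_vector_derivative \<gamma>' t) (at t)" and lift: "\<And>t. t \<in> {0..1} \<Longrightarrow> proj (\<gamma> t) = c t"
  shows "integral {0..1} (\<lambda>t. a \<bullet> velocity c t) = a \<bullet> (\<gamma> 1 - \<gamma> 0)"
proof -
  have cont: "continuous_on {0..1} \<gamma>"
    using \<gamma> by (meson continuous_at_imp_continuous_on has_vector_derivative_continuous)
  have "velocity c t = \<gamma>' t" if "t \<in> {0..1}" for t
    by (rule velocity_lift[OF cont lift that has_vector_derivative_at_within[OF \<gamma>]])
  then have "integral {0..1} (\<lambda>t. a \<bullet> velocity c t) = integral {0..1} (\<lambda>t. a \<bullet> \<gamma>' t)"
    by (intro Henstock_Kurzweil_Integration.integral_cong) simp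
  also have "((\<lambda>t. a \<bullet> \<gamma>' t) has_integral a \<bullet> \<gamma> 1 - a \<bullet> \<gamma> 0) {0..1}"
    by (rule fundamental_theorem_of_calculus)
      (auto intro!: has_vector_derivative_at_within bounded_linear.has_vector_derivative[OF bounded_linear_inner_right \<gamma>])
  then have "integral {0..1} (\<lambda>t. a \<bullet> \<gamma>' t) = a \<bullet> \<gamma> 1 - a \<bullet> \<gamma> 0" by (rule integral_unique)
  finally show ?thesis by (simp add: inner_diff_right)
qed

section \<open>Displacements of the endpoint of a path\<close>

context riemannian_torus begin

lemma gnorm_nonneg: "gnorm g p v \<ge> 0"
  unfolding gnorm_def using metric_pos[of v p] by (cases "v = 0") auto

text \<open>Makes the supremum in \<open>AHom\<close> usable: a supremum bounds the single distances
  only if they are bounded above. Segments between representatives in the unit square have uniformly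
  bounded length.\<close>

lemma riem_dist_bounded: obtains B where "\<And>p q. riem_dist g p q \<le> B"
proof -
  obtain c C where C: "C > 0" "\<And>p v. gnorm g p v \<le> C * norm v" by (rule gnorm_bounds) blast
  obtain M where M: "\<And>x. x \<in> cbox (0 :: real^2) 1 \<Longrightarrow> norm x \<le> M"
    using bounded_cbox[of "0 :: real^2" 1] unfolding bounded_iff by blast
  have "riem_dist g p q \<le> C * (2 * M)" for p q
  proof -
    have rep: "\<exists>x\<in>cbox 0 1. proj x = p" for p
    proof -
      obtain k where k: "k \<in> lattice2" "rep_torus p - k \<in> cbox 0 1" by (rule cbox_representative)
      then show ?thesis using proj_add_lattice[OF lattice2_minus[OF k(1)], of "rep_torus p"] by force
    qed
    obtain a b where a: "a \<in> cbox 0 1" "proj a = p" and b: "b \<in> cbox 0 1" "proj b = q" using rep by metis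
    define \<gamma> where "\<gamma> t = a + t *\<^sub>R (b - a)" for t :: real
    have d: "(\<gamma> has_vector_derivative b - a) (at t)" for t
      using has_vector_derivative_add[OF has_vector_derivative_const[of a]
          has_vector_derivative_scaleR[OF DERIV_ident has_vector_derivative_const[of "b - a"]], of t]
      unfolding \<gamma>_def by simp
    have "norm (b - a) \<le> 2 * M" using M[OF a(1)] M[OF b(1)] norm_triangle_ineq4[of b a] by linarith
    then have le: "C * norm (b - a) \<le> C * (2 * M)" using C(1) by simp
    have cont: "continuous_on {0..1} (\<lambda>t. gnorm g (proj (\<gamma> t)) (b - a))"
      using continuous_on_compose2[OF continuous_gnorm, of "{0..1}" "\<lambda>t. (proj (\<gamma> t), b - a)"]
        continuous_on_compose2[OF continuous_on_proj[of UNIV], of "{0..1}" \<gamma>]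
      unfolding \<gamma>_def by (simp add: continuous_intros)
    have "norm (integral {0..1} (\<lambda>t. gnorm g (proj (\<gamma> t)) (b - a))) \<le> C * (2 * M) * (1 - 0)"
    proof (rule integral_bound[OF _ cont])
      show "norm (gnorm g (proj (\<gamma> t)) (b - a)) \<le> C * (2 * M)" for t
        using C(2)[of "proj (\<gamma> t)" "b - a"] le gnorm_nonneg[of "proj (\<gamma> t)" "b - a"] by simp
    qed simp
    then have len: "curve_length g \<gamma> \<le> C * (2 * M)"
      unfolding curve_length_def vector_derivative_at[OF d] by simp
    \<comment> \<open>A speed that is not integrable has integral 0, so the inequality holds for
      every \<open>\<eta>\<close> and the set in \<open>riem_dist\<close> is bounded below.\<close>
    have nonneg: "curve_length g \<eta> \<ge> 0" for \<eta>
      unfolding curve_length_def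
      by (cases "(\<lambda>t. gnorm g (proj (\<eta> t)) (vector_derivative \<eta> (at t))) integrable_on {0..1}")
        (auto intro: integral_nonneg gnorm_nonneg simp: not_integrable_integral)
    have "riem_dist g p q \<le> curve_length g \<gamma>"
      unfolding riem_dist_def
    proof (rule cInf_lower)
      have "\<gamma> C1_differentiable_on {0..1}"
        unfolding C1_differentiable_on_def using d by (intro exI[of _ "\<lambda>_. b - a"]) auto
      moreover have "proj (\<gamma> 0) = p" "proj (\<gamma> 1) = q" using a b by (auto simp: \<gamma>_def)
      ultimately show "curve_length g \<gamma> \<in> {curve_length g \<gamma> |\<gamma>. \<gamma> C1_differentiable_on {0..1} \<and> proj (\<gamma> 0) = p \<and> proj (\<gamma> 1) = q}"
        by blast
      show "bdd_below {curve_length g \<gamma> |\<gamma>. \<gamma> C1_differentiable_on {0..1} \<and> proj (\<gamma> 0) = p \<and> proj (\<gamma> 1) = q}"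
        by (rule bdd_belowI[of _ 0]) (use nonneg in auto)
    qed
    then show ?thesis using len by linarith
  qed
  then show thesis using that by blast
qed

text \<open>On constant forms both cases of \<open>flux_density\<close> measure a displacement of
  \<open>H 1\<close>; in the second it is the displacement of \<Phi> plus that of the geodesics.
  Continuity in the point is the substance: otherwise displacements might jump by lattice vectors
  and their mean would have no meaning.\<close>

lemma flux_density_const:
  assumes \<delta>: "\<delta> < injectivity_radius g" and R: "flux_density g \<delta> H R" and H: "continuous_on UNIV (H 1)"
  obtains w :: "torus \<Rightarrow> real^2" where "continuous_on UNIV w" "\<And>x. proj (x + w (proj x)) = H 1 (proj x)"
    "\<And>a p. R (\<lambda>_. a) p = a \<bullet> w p"
proof -
  have isotopy: "\<exists>w. continuous_on UNIV w \<and> (\<forall>x. proj (x + w (proj x)) = \<Phi> 1 (proj x)) \<and>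
      (\<forall>a p. flux_function (\<lambda>_. a) \<Phi> 1 p = a \<bullet> w p)" if \<Phi>: "smooth_isotopy \<Phi>" for \<Phi>
  proof -
    obtain G :: "real \<times> (real^2) \<Rightarrow> real^2" where G: "smooth G" "\<And>x. G (0, x) = x"
      "\<And>t x. t \<in> {0..1} \<Longrightarrow> proj (G (t, x)) = \<Phi> t (proj x)"
      "\<And>t x k. t \<in> {0..1} \<Longrightarrow> k \<in> lattice2 \<Longrightarrow> G (t, x + k) = G (t, x) + k"
      using smooth_isotopy_lift[OF \<Phi>] by blast
    define w where "w p = G (1, rep_torus p) - rep_torus p" for p
    have "periodic (\<lambda>x. G (1, x) - x)" using G(4) by (simp add: periodic_def)
    from periodic_rep_torus[OF this] have w: "w (proj x) = G (1, x) - x" for x by (simp add: w_def)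
    have "continuous_on UNIV w"
      unfolding continuous_on_torus_iff w
      by (intro continuous_intros smooth_continuous smooth_slice G)
    moreover have "proj (x + w (proj x)) = \<Phi> 1 (proj x)" for x using G(3)[of 1 x] by (simp add: w)
    moreover have "flux_function (\<lambda>_. a) \<Phi> 1 p = a \<bullet> w p" for a p
    proof -
      have "integral {0..1} (\<lambda>t. a \<bullet> velocity (\<lambda>s. \<Phi> s p) t) = a \<bullet> (G (1, rep_torus p) - G (0, rep_torus p))"
        by (rule integral_velocity[OF has_vector_derivative_slice[OF G(1)]]) (use G(3) in simp)
      then show ?thesis by (simp add: flux_function_def w_def G(2))
    qed
    ultimately show ?thesis by blast
  qed
  show thesis
  proof (cases "smooth_isotopy H")
    case True
    then show thesis using R isotopy[OF True] that by (auto simp: flux_density_def)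
  next
    case False
    then obtain \<Phi> \<sigma> where \<Phi>: "\<Phi> \<in> AHom g \<delta> H" and \<sigma>: "\<And>p. minimizing_geodesic g (\<sigma> p) (\<Phi> 1 p) (H 1 p)"
      and R': "R = (\<lambda>\<alpha> p. flux_function \<alpha> \<Phi> 1 p + line_integral \<alpha> (\<lambda>t. proj (\<sigma> p t)))"
      using R by (auto simp: flux_density_def)
    have si: "smooth_isotopy \<Phi>" using \<Phi> by (simp add: AHom_def)
    obtain \<Theta> where \<Theta>: "\<forall>t\<in>{0..1}. diffeo (\<Theta> t)"
      and hom: "homotopic_paths (Bcontfun ` Collect diffeo) (\<lambda>t. Bcontfun (\<Phi> t)) (\<lambda>t. Bcontfun (\<Theta> t))"
      and sup: "(SUP (t, x)\<in>{0..1} \<times> UNIV. riem_dist g (\<Theta> t x) (H t x)) < \<delta>"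
      using \<Phi> by (auto simp: AHom_def)
    have cont: "continuous_on UNIV f" if "diffeo f" for f
      using that smooth_map_continuous by (simp add: diffeo_def)
    have d\<Phi>: "diffeo (\<Phi> 1)" using si by (simp add: smooth_isotopy_def)
    \<comment> \<open>The homotopy fixes endpoints, so the bound \<delta>, which is imposed on
      \<Theta>, holds for \<Phi> at time one.\<close>
    have "Bcontfun (\<Phi> 1) = Bcontfun (\<Theta> 1)"
      using homotopic_paths_imp_pathfinish[OF hom] by (simp add: pathfinish_def)
    then have eq: "\<Phi> 1 = \<Theta> 1"
      using Bcontfun_inject[THEN iffD1, OF continuous_torus_bcontfun[OF cont[OF d\<Phi>]]
          continuous_torus_bcontfun[OF cont], of "\<Theta> 1"] \<Theta> by simp
    obtain B where B: "\<And>p q. riem_dist g p q \<le> B" by (rule riem_dist_bounded) blast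
    have "riem_dist g (\<Phi> 1 p) (H 1 p) \<le> \<delta>" for p
    proof -
      have "(\<lambda>(t, x). riem_dist g (\<Theta> t x) (H t x)) (1, p) \<le> (SUP (t, x)\<in>{0..1} \<times> UNIV. riem_dist g (\<Theta> t x) (H t x))"
        by (rule cSUP_upper) (use B in \<open>auto intro!: bdd_aboveI\<close>)
      then show ?thesis using sup eq by simp
    qed
    then have cd: "continuous_on UNIV (\<lambda>p. \<sigma> p 1 - \<sigma> p 0)"
      by (intro continuous_geodesic_displacement[OF \<delta> cont[OF d\<Phi>] H \<sigma>])
    obtain w where w: "continuous_on UNIV w" "\<And>x. proj (x + w (proj x)) = \<Phi> 1 (proj x)"
      "\<And>a p. flux_function (\<lambda>_. a) \<Phi> 1 p = a \<bullet> w p" using isotopy[OF si] by blast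
    show thesis
    proof (rule that[of "\<lambda>p. w p + (\<sigma> p 1 - \<sigma> p 0)"])
      show "continuous_on UNIV (\<lambda>p. w p + (\<sigma> p 1 - \<sigma> p 0))" by (intro continuous_intros w cd)
      fix x :: "real^2"
      have "proj (\<sigma> (proj x) 0) = proj (x + w (proj x))" and e: "proj (\<sigma> (proj x) 1) = H 1 (proj x)"
        using \<sigma>[of "proj x"] w(2) by (auto simp: minimizing_geodesic_def)
      then have "x + w (proj x) - \<sigma> (proj x) 0 \<in> lattice2" by (simp flip: proj_eq_lattice)
      then show "proj (x + (w (proj x) + (\<sigma> (proj x) 1 - \<sigma> (proj x) 0))) = H 1 (proj x)"
        using proj_add_lattice[of "x + w (proj x) - \<sigma> (proj x) 0" "\<sigma> (proj x) 1"] e by (simp add: algebra_simps)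
    next
      fix a p
      obtain y where "geo (\<sigma> p) y" using \<sigma>[of p] by (auto simp: minimizing_geodesic_def geodesic_iff)
      then have "line_integral (\<lambda>_. a) (\<lambda>t. proj (\<sigma> p t)) = a \<bullet> (\<sigma> p 1 - \<sigma> p 0)"
        unfolding line_integral_def by (intro integral_velocity[OF geoD(1)]) auto
      then show "R (\<lambda>_. a) p = a \<bullet> (w p + (\<sigma> p 1 - \<sigma> p 0))"
        by (simp add: R' w(3) inner_add_right)
    qed
  qed
qed

end

section \<open>Cohomology classes and vanishing flux\<close>

lemma closed_form_const: "closed_form (\<lambda>_. a)"
  by (simp add: closed_form_def smooth_torus_def smooth_const partial_def frechet_derivative_const)

lemma continuous_partial: "smooth_torus f \<Longrightarrow> continuous_on UNIV (partial i f)"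
  unfolding continuous_on_torus_iff partial_proj smooth_torus_def by (rule smooth_frechet_continuous)

lemma smooth_torus_continuous: "smooth_torus f \<Longrightarrow> continuous_on UNIV f"
  unfolding continuous_on_torus_iff smooth_torus_def by (rule smooth_continuous)

text \<open>Stokes' theorem by integration by parts: both derivatives move onto \<alpha>, where they
  cancel by closedness.\<close>

lemma wedge_integral_closed_exact:
  assumes \<alpha>: "closed_form \<alpha>" and f: "smooth_torus f"
  shows "wedge_integral \<alpha> (differential f) = 0"
proof -
  let ?f = "\<lambda>x. f (proj x)" and ?a = "\<lambda>i x. \<alpha> (proj x) $ i"
  let ?D = "\<lambda>i f x. frechet_derivative f (at x) (axis i 1 :: real^2) :: real"
  have s\<alpha>: "smooth (\<lambda>x. \<alpha> (proj x))" using \<alpha> by (simp add: closed_form_def smooth_torus_def)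
  have sf: "smooth ?f" and sa: "smooth (?a i)" for i
    using f smooth_vec_nth[OF s\<alpha>] by (simp_all add: smooth_torus_def)
  have closed: "?D 1 (?a 2) x = ?D 2 (?a 1) x" for x
  proof -
    have "partial 1 (\<lambda>q. \<alpha> q $ 2) (proj x) = partial 2 (\<lambda>q. \<alpha> q $ 1) (proj x)"
      using \<alpha> by (simp add: closed_form_def)
    then show ?thesis by (simp only: partial_proj)
  qed
  have c\<alpha>: "continuous_on UNIV \<alpha>" using \<alpha> by (simp add: closed_form_def smooth_torus_continuous)
  have c: "continuous_on S ?f" "continuous_on S (?a i)" "continuous_on S (?D i ?f)" "continuous_on S (?D j (?a i))" for S i j
    by (rule continuous_on_subset[OF _ subset_UNIV], rule smooth_continuous smooth_frechet_continuous, rule sf sa)+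
  have "wedge_integral \<alpha> (differential f) = integral (cbox 0 1) (\<lambda>x. ?a 1 x * ?D 2 ?f x - ?a 2 x * ?D 1 ?f x)"
    unfolding wedge_integral_def differential_def
    by (subst integral_torus_measure)
      (auto simp: partial_proj intro!: continuous_intros c\<alpha> continuous_partial f)
  also have "\<dots> = integral (cbox 0 1) (\<lambda>x. ?D 2 ?f x * ?a 1 x) - integral (cbox 0 1) (\<lambda>x. ?D 1 ?f x * ?a 2 x)"
    by (subst Henstock_Kurzweil_Integration.integral_diff[symmetric])
      (auto intro!: integrable_continuous continuous_intros c simp: mult.commute)
  also have "\<dots> = integral (cbox 0 1) (\<lambda>x. ?f x * ?D 1 (?a 2) x) - integral (cbox 0 1) (\<lambda>x. ?f x * ?D 2 (?a 1) x)"
    using integral_by_parts_periodic[OF sf sa[of 1] periodic_proj[of f] periodic_proj[of "\<lambda>p. \<alpha> p $ 1"], of 2]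
      integral_by_parts_periodic[OF sf sa[of 2] periodic_proj[of f] periodic_proj[of "\<lambda>p. \<alpha> p $ 2"], of 1]
    by linarith
  also have "\<dots> = 0" by (simp add: closed)
  finally show ?thesis .
qed

lemma exact_form_zero: "exact_form (\<lambda>_. 0)"
  unfolding exact_form_def
  by (intro exI[of _ "\<lambda>_. 0"])
    (simp add: smooth_torus_def smooth_const differential_def partial_def frechet_derivative_const vec_eq_iff fun_eq_iff)

text \<open>The flux group is not empty; otherwise a vanishing flux would be an equation of empty sets.\<close>

lemma exact_class_in_flux_group: "Collect exact_form \<in> flux_group g \<delta>"
proof -
  let ?H = "\<lambda>_::real. id :: torus \<Rightarrow> torus"
  have dif: "diffeo id"
    unfolding diffeo_def smooth_map_def is_lift_def
    by (intro conjI exI[of _ id] exI[of _ "\<lambda>x. x"]) (auto simp: smooth_ident)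
  have si: "smooth_isotopy ?H"
    unfolding smooth_isotopy_def is_lift_def
    by (intro conjI ballI exI[of _ snd]) (auto simp: dif intro: smooth_bounded_linear bounded_linear_snd)
  have hid: "id \<in> homeo_Omega"
  proof -
    have "torus_homeo id" unfolding torus_homeo_def by (rule exI[of _ id]) (simp add: homeomorphism_def)
    moreover have "distr torus_measure borel id = torus_measure"
      using distr_id2[of borel torus_measure] by (simp add: torus_measure_def id_def)
    ultimately show ?thesis by (simp add: homeo_Omega_def)
  qed
  then have "id \<in> homeo0"
    unfolding homeo0_def using connected_component_refl_eq[of "Bcontfun ` homeo_Omega" "Bcontfun id"] by blast
  then have path: "?H \<in> path_homeo0"
    by (simp add: path_homeo0_def path_def)
  have v: "flux_function \<alpha> ?H 1 p = 0" for \<alpha> p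
  proof -
    have "velocity (\<lambda>s. id p) s = 0" if "s \<in> {0..1}" for s
      by (rule velocity_lift[of "\<lambda>_. rep_torus p"]) (use that in auto)
    then have "integral {0..1} (\<lambda>s. \<alpha> (?H s p) \<bullet> velocity (\<lambda>s. ?H s p) s) = integral {0..1} (\<lambda>s::real. 0)"
      by (intro Henstock_Kurzweil_Integration.integral_cong) simp
    then show ?thesis by (simp add: flux_function_def)
  qed
  have "Collect exact_form = Collect exact_form #>\<^bsub>closed_forms\<^esub> (\<lambda>_. 0)"
    by (auto simp: r_coset_def closed_forms_def)
  then have "Collect exact_form \<in> carrier H1"
    using closed_form_const[of 0] by (auto simp: H1_def FactGroup_def RCOSETS_def closed_forms_def)
  moreover have "wedge_integral \<alpha> \<beta> = (LINT p|torus_measure. flux_function \<alpha> ?H 1 p)"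
    if "closed_form \<alpha>" "\<beta> \<in> Collect exact_form" for \<alpha> \<beta>
    using that wedge_integral_closed_exact by (auto simp: exact_form_def v)
  ultimately have "has_path_flux g \<delta> ?H (Collect exact_form)"
    unfolding has_path_flux_def flux_density_def using si by auto
  then show ?thesis using path by (auto simp: flux_group_def)
qed

lemma content_unit_cell: "Henstock_Kurzweil_Integration.content (cbox 0 (1 :: real^2)) = 1"
proof -
  have "(0 :: real^2) \<in> cbox 0 1" by (simp add: mem_box_cart)
  then have "cbox 0 (1 :: real^2) \<noteq> {}" by blast
  then show ?thesis by (simp add: content_cbox_cart)
qed

text \<open>Since the flux group is nonempty, vanishing flux yields a path to \<open>h\<close> and a
  loop whose classes have a common representative. Their displacements then have the same mean, and
  that of the loop is a lattice vector.\<close>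

lemma trivial_flux_mean_displacement:
  assumes g: "riemannian_metric g" and \<delta>: "\<delta> < injectivity_radius g"
    and flux: "flux g \<delta> h = \<one>\<^bsub>H1 Mod flux_group g \<delta>\<^esub>"
  obtains w :: "torus \<Rightarrow> real^2" where "continuous_on UNIV w" "\<And>x. proj (x + w (proj x)) = h (proj x)"
    "integral (cbox 0 1) (\<lambda>x. w (proj x)) = 0"
proof -
  interpret riemannian_torus g by unfold_locales (rule g)
  let ?E = "Collect exact_form"
  have fl: "\<Union> {flux_group g \<delta> #>\<^bsub>H1\<^esub> c |H c. H \<in> path_homeo0 \<and> H 1 = h \<and> has_path_flux g \<delta> H c} = flux_group g \<delta>"
    using flux by (simp add: flux_def FactGroup_def)
  then obtain H c where H: "H \<in> path_homeo0" "H 1 = h" "has_path_flux g \<delta> H c"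
    using exact_class_in_flux_group[of g \<delta>] by blast
  have "c \<in> carrier H1" using H(3) by (simp add: has_path_flux_def)
  then obtain \<beta> where "c = ?E #>\<^bsub>closed_forms\<^esub> \<beta>"
    by (auto simp: H1_def FactGroup_def RCOSETS_def)
  then have \<beta>: "\<beta> \<in> c"
    using exact_form_zero by (force simp: r_coset_def closed_forms_def)
  \<comment> \<open>The coset of \<open>c\<close> contains the product of the exact class with
    \<open>c\<close>, and \<beta> lies in this product as well as in \<open>c\<close>; so one form
    serves both the path and the loop.\<close>
  have "?E \<otimes>\<^bsub>H1\<^esub> c \<in> flux_group g \<delta> #>\<^bsub>H1\<^esub> c"
    using exact_class_in_flux_group[of g \<delta>] by (auto simp: r_coset_def)
  then have "?E \<otimes>\<^bsub>H1\<^esub> c \<in> flux_group g \<delta>" using fl H by blast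
  then obtain K where K: "K \<in> path_homeo0" "K 1 = id" "has_path_flux g \<delta> K (?E \<otimes>\<^bsub>H1\<^esub> c)"
    by (auto simp: flux_group_def)
  have \<beta>': "\<beta> \<in> ?E \<otimes>\<^bsub>H1\<^esub> c"
    using \<beta> exact_form_zero by (force simp: H1_def FactGroup_def set_mult_def closed_forms_def)
  have disp: "\<exists>w. continuous_on UNIV w \<and> (\<forall>x. proj (x + w (proj x)) = P 1 (proj x)) \<and>
      (\<forall>a. wedge_integral (\<lambda>_. a) \<beta> = a \<bullet> integral (cbox 0 1) (\<lambda>x. w (proj x)))"
    if P: "P \<in> path_homeo0" "has_path_flux g \<delta> P d" "\<beta> \<in> d" for P d
  proof -
    obtain R where R: "flux_density g \<delta> P R" "\<And>\<alpha>. closed_form \<alpha> \<Longrightarrow> wedge_integral \<alpha> \<beta> = (LINT p|torus_measure. R \<alpha> p)"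
      using P by (auto simp: has_path_flux_def)
    have "torus_homeo (P 1)" using P(1) by (simp add: path_homeo0_def homeo0_def homeo_Omega_def)
    then have "continuous_on UNIV (P 1)" by (auto simp: torus_homeo_def homeomorphism_def)
    from flux_density_const[OF \<delta> R(1) this] obtain w :: "torus \<Rightarrow> real^2"
      where w: "continuous_on UNIV w" "\<And>x. proj (x + w (proj x)) = P 1 (proj x)" "\<And>a p. R (\<lambda>_. a) p = a \<bullet> w p" by blast
    have int: "(\<lambda>x. w (proj x)) integrable_on cbox 0 1"
      using w(1) unfolding continuous_on_torus_iff by (intro integrable_continuous) (rule continuous_on_subset, auto)
    have "wedge_integral (\<lambda>_. a) \<beta> = a \<bullet> integral (cbox 0 1) (\<lambda>x. w (proj x))" for a
    proof -
      have "wedge_integral (\<lambda>_. a) \<beta> = (LINT p|torus_measure. a \<bullet> w p)"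
        by (simp add: R(2)[OF closed_form_const] w(3))
      also have "\<dots> = integral (cbox 0 1) (\<lambda>x. a \<bullet> w (proj x))"
        by (rule integral_torus_measure) (intro continuous_intros w)
      also have "\<dots> = a \<bullet> integral (cbox 0 1) (\<lambda>x. w (proj x))"
        using integral_linear[OF int bounded_linear_inner_right[of a]] by (simp add: o_def)
      finally show ?thesis .
    qed
    then show ?thesis using w by blast
  qed
  obtain w where w: "continuous_on UNIV w" "\<And>x. proj (x + w (proj x)) = h (proj x)"
    "\<And>a. wedge_integral (\<lambda>_. a) \<beta> = a \<bullet> integral (cbox 0 1) (\<lambda>x. w (proj x))"
    using disp[OF H(1,3) \<beta>] H(2) by auto
  obtain u where u: "continuous_on UNIV u" "\<And>x. proj (x + u (proj x)) = proj x"
    "\<And>a. wedge_integral (\<lambda>_. a) \<beta> = a \<bullet> integral (cbox 0 1) (\<lambda>x. u (proj x))"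
    using disp[OF K(1,3) \<beta>'] K(2) by auto
  \<comment> \<open>A displacement of the identity is lattice valued, hence constant by continuity.
    Subtracting it from \<open>w\<close> gives another displacement of \<open>h\<close>, with mean
    0.\<close>
  have ul: "u (proj x) \<in> lattice2" for x using u(2)[of x] by (simp add: proj_eq_lattice)
  have uc: "u (proj x) = u (proj 0)" for x
    by (rule lattice2_valued_constant[of UNIV "\<lambda>x. u (proj x)"])
      (use ul u(1) continuous_on_torus_iff in auto)
  have "integral (cbox 0 1) (\<lambda>x. w (proj x)) = integral (cbox 0 1) (\<lambda>x. u (proj x))"
    using w(3) u(3) by (intro vector_eq_ldot[THEN iffD1]) simp
  also have "\<dots> = integral (cbox 0 (1 :: real^2)) (\<lambda>x. u (proj 0))" by (intro Henstock_Kurzweil_Integration.integral_cong uc)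
  also have "\<dots> = u (proj 0)" by (simp add: content_unit_cell)
  finally have iw: "integral (cbox 0 1) (\<lambda>x. w (proj x)) = u (proj 0)" .
  have int: "(\<lambda>x. w (proj x)) integrable_on cbox 0 1"
    using w(1) unfolding continuous_on_torus_iff by (intro integrable_continuous) (rule continuous_on_subset, auto)
  show thesis
  proof (rule that[of "\<lambda>p. w p - u (proj 0)"])
    show "continuous_on UNIV (\<lambda>p. w p - u (proj 0))" by (intro continuous_intros w)
    show "proj (x + (w (proj x) - u (proj 0))) = h (proj x)" for x
      using w(2)[of x] proj_add_lattice[OF lattice2_minus[OF ul[of 0]], of "x + w (proj x)"] by (simp add: algebra_simps)
    show "integral (cbox 0 1) (\<lambda>x. w (proj x) - u (proj 0)) = 0"
      using iw int by (simp add: Henstock_Kurzweil_Integration.integral_diff integrable_const content_unit_cell)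
  qed
qed

section \<open>Potentials of closed forms\<close>

lemma smooth_radial:
  fixes a :: "real^2 \<Rightarrow> real^2"
  assumes "smooth a"
  shows "smooth (\<lambda>z::(real^2) \<times> real. a (snd z *\<^sub>R fst z) \<bullet> fst z)"
  by (intro smooth_inner smooth_compose[OF assms] smooth_scaleR smooth_snd smooth_fst smooth_ident)

text \<open>The Poincare lemma: after differentiation under the integral, symmetry of the derivative
  of \<open>a\<close> turns the integrand into the derivative in \<open>s\<close> of
  \<open>s * (a (s *\<^sub>R x) \<bullet> v)\<close>.\<close>

lemma has_derivative_radial_potential:
  fixes a :: "real^2 \<Rightarrow> real^2"
  assumes a: "smooth a"
    and sym: "\<And>x v w. frechet_derivative a (at x) v \<bullet> w = frechet_derivative a (at x) w \<bullet> v"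
  shows "((\<lambda>x. integral {0..1} (\<lambda>s. a (s *\<^sub>R x) \<bullet> x)) has_derivative (\<lambda>v. a x \<bullet> v)) (at x)"
proof -
  let ?D = "\<lambda>s v. a (s *\<^sub>R x) \<bullet> v + frechet_derivative a (at (s *\<^sub>R x)) (s *\<^sub>R v) \<bullet> x"
  have Da: "(a has_derivative frechet_derivative a (at y)) (at y)" for y by (rule smooth_has_derivative[OF a])
  have sc: "((\<lambda>x::real^2. s *\<^sub>R x) has_derivative (\<lambda>v. s *\<^sub>R v)) (at x)" for s
    by (rule bounded_linear_imp_has_derivative[OF bounded_linear_scaleR_right])
  have "((\<lambda>x. a (s *\<^sub>R x) \<bullet> x) has_derivative ?D s) (at x)" for s
    by (rule has_derivative_inner[OF has_derivative_compose[OF sc Da] has_derivative_ident])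
  then have "((\<lambda>x. integral (cbox 0 1) (\<lambda>s. a (s *\<^sub>R x) \<bullet> x)) has_derivative
      (\<lambda>v. integral (cbox 0 1) (\<lambda>s. ?D s v))) (at x)"
    using has_derivative_integral_parameter_eq[OF smooth_radial[OF a], of ?D x 0 1] by simp
  moreover have "integral (cbox 0 1) (\<lambda>s. ?D s v) = a x \<bullet> v" for v
  proof -
    have "((\<lambda>s. ?D s v) has_integral 1 * (a (1 *\<^sub>R x) \<bullet> v) - 0 * (a (0 *\<^sub>R x) \<bullet> v)) {0..1}"
    proof (rule fundamental_theorem_of_calculus)
      fix s :: real
      have "((\<lambda>s. s *\<^sub>R x) has_derivative (\<lambda>h. h *\<^sub>R x)) (at s)" by (auto intro!: derivative_eq_intros)
      from has_derivative_compose[OF this Da]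
      have "((\<lambda>s. a (s *\<^sub>R x)) has_derivative (\<lambda>h. frechet_derivative a (at (s *\<^sub>R x)) (h *\<^sub>R x))) (at s)" .
      from has_derivative_mult[OF has_derivative_ident has_derivative_inner_left[OF this, of v]]
      have "((\<lambda>s. s * (a (s *\<^sub>R x) \<bullet> v)) has_derivative
          (\<lambda>h. s * (frechet_derivative a (at (s *\<^sub>R x)) (h *\<^sub>R x) \<bullet> v) + h * (a (s *\<^sub>R x) \<bullet> v))) (at s)" .
      moreover have "s * (frechet_derivative a (at (s *\<^sub>R x)) (h *\<^sub>R x) \<bullet> v) + h * (a (s *\<^sub>R x) \<bullet> v) = h *\<^sub>R ?D s v" for h
        using sym[of "s *\<^sub>R x" x v] linear_cmul[OF has_derivative_linear[OF Da[of "s *\<^sub>R x"]]]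
        by (simp add: algebra_simps)
      ultimately have "((\<lambda>s. s * (a (s *\<^sub>R x) \<bullet> v)) has_vector_derivative ?D s v) (at s)"
        unfolding has_vector_derivative_def by (rule has_derivative_eq_rhs[OF _ ext])
      then show "((\<lambda>s. s * (a (s *\<^sub>R x) \<bullet> v)) has_vector_derivative ?D s v) (at s within {0..1})"
        by (rule has_vector_derivative_at_within)
    qed simp
    then show ?thesis by (simp add: integral_unique)
  qed
  ultimately show ?thesis by simp
qed

lemma periodic_axisI:
  assumes "\<And>i x. f (x + axis i 1) = f x" shows "periodic f"
proof -
  have nat: "f (x + real n *\<^sub>R axis i 1) = f x" for n i x
  proof (induction n)
    case (Suc n)
    have "f (x + real (Suc n) *\<^sub>R axis i 1) = f ((x + real n *\<^sub>R axis i 1) + axis i 1)"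
      by (simp add: algebra_simps)
    then show ?case using assms Suc by simp
  qed simp
  have int: "f (x + of_int m *\<^sub>R axis i 1) = f x" for m i x
  proof (cases "m \<ge> 0")
    case True
    then show ?thesis using nat[of x "nat m" i] by simp
  next
    case False
    then show ?thesis using nat[of "x + of_int m *\<^sub>R axis i 1" "nat (- m)" i] by (simp add: algebra_simps)
  qed
  show ?thesis unfolding periodic_def
  proof (intro allI ballI)
    fix x k :: "real^2" assume "k \<in> lattice2"
    then have "k $ 1 \<in> \<int>" "k $ 2 \<in> \<int>" by (auto simp: lattice2_def)
    then obtain m n where mn: "k $ 1 = of_int m" "k $ 2 = of_int n" by (auto elim!: Ints_cases)
    have "k = of_int m *\<^sub>R axis 1 1 + of_int n *\<^sub>R axis 2 1"
      by (simp add: vec_eq_iff forall_2 axis_nth2 flip: mn)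
    then have "f (x + k) = f ((x + of_int m *\<^sub>R axis 1 1) + of_int n *\<^sub>R axis 2 1)" by (simp add: add.assoc)
    then show "f (x + k) = f x" by (simp add: int)
  qed
qed

definition period :: "form \<Rightarrow> real^2" where
  "period \<alpha> = (\<chi> i. integral {0..1} (\<lambda>s. \<alpha> (proj (s *\<^sub>R axis i 1)) $ i))"

text \<open>The radial primitive of \<alpha> minus the constant form with the same periods. Removing
  the periods is what lets the primitive descend to the torus.\<close>

definition potential :: "form \<Rightarrow> real^2 \<Rightarrow> real" where
  "potential \<alpha> x = integral {0..1} (\<lambda>s. (\<alpha> (proj (s *\<^sub>R x)) - period \<alpha>) \<bullet> x)"

lemma closed_form_smooth: "closed_form \<alpha> \<Longrightarrow> smooth (\<lambda>x. \<alpha> (proj x))"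
  by (simp add: closed_form_def smooth_torus_def)

lemma frechet_vec_nth:
  fixes f :: "'a::euclidean_space \<Rightarrow> real^2"
  assumes "smooth f"
  shows "frechet_derivative (\<lambda>x. f x $ i) (at x) v = frechet_derivative f (at x) v $ i"
proof -
  have "((\<lambda>x. f x $ i) has_derivative (\<lambda>v. frechet_derivative f (at x) v $ i)) (at x)"
    by (rule bounded_linear.has_derivative[OF bounded_linear_vec_nth smooth_has_derivative[OF assms]])
  from fun_cong[OF frechet_derivative_at[OF this], of v] show ?thesis by simp
qed

lemma closed_form_symmetric:
  assumes "closed_form \<alpha>"
  shows "frechet_derivative (\<lambda>x. \<alpha> (proj x)) (at x) v \<bullet> w = frechet_derivative (\<lambda>x. \<alpha> (proj x)) (at x) w \<bullet> v"
proof -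
  let ?D = "frechet_derivative (\<lambda>x. \<alpha> (proj x)) (at x)"
  note s = closed_form_smooth[OF assms]
  have "partial 1 (\<lambda>q. \<alpha> q $ 2) (proj x) = partial 2 (\<lambda>q. \<alpha> q $ 1) (proj x)"
    using assms by (simp add: closed_form_def)
  then have c: "?D (axis 1 1) $ 2 = ?D (axis 2 1) $ 1" by (simp only: partial_proj frechet_vec_nth[OF s])
  have D: "?D v = v $ 1 *\<^sub>R ?D (axis 1 1) + v $ 2 *\<^sub>R ?D (axis 2 1)" for v
    by (rule linear_real2[OF has_derivative_linear[OF smooth_has_derivative[OF s]]])
  show ?thesis unfolding D[of v] D[of w] by (simp add: inner_vec_def sum_2 c algebra_simps)
qed

lemma has_derivative_potential:
  assumes "closed_form \<alpha>"
  shows "(potential \<alpha> has_derivative (\<lambda>v. (\<alpha> (proj x) - period \<alpha>) \<bullet> v)) (at x)"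
proof -
  let ?a = "\<lambda>x. \<alpha> (proj x) - period \<alpha>"
  have s: "smooth ?a" by (intro smooth_diff closed_form_smooth[OF assms] smooth_const)
  have D: "frechet_derivative ?a (at x) = frechet_derivative (\<lambda>x. \<alpha> (proj x)) (at x)" for x
  proof -
    have "(?a has_derivative (\<lambda>v. frechet_derivative (\<lambda>x. \<alpha> (proj x)) (at x) v - 0)) (at x)"
      by (rule has_derivative_diff[OF smooth_has_derivative[OF closed_form_smooth[OF assms]] has_derivative_const])
    from frechet_derivative_at[OF this] show ?thesis by simp
  qed
  show ?thesis
    unfolding potential_def[abs_def]
    by (rule has_derivative_radial_potential[OF s]) (simp only: D closed_form_symmetric[OF assms])
qed

text \<open>The increment over a lattice step has derivative zero, and at the origin it is a period
  of the form from which the periods have been removed.\<close>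

lemma periodic_potential:
  assumes "closed_form \<alpha>" shows "periodic (potential \<alpha>)"
proof (rule periodic_axisI)
  fix i x
  let ?d = "\<lambda>x. potential \<alpha> (x + axis i 1) - potential \<alpha> x"
  have "((\<lambda>x. potential \<alpha> (x + axis i 1)) has_derivative (\<lambda>v. (\<alpha> (proj (x + axis i 1)) - period \<alpha>) \<bullet> v)) (at x)" for x
    using has_derivative_potential[OF assms, of "x + axis i 1"] unfolding has_derivative_translate .
  then have "((\<lambda>x. potential \<alpha> (x + axis i 1)) has_derivative (\<lambda>v. (\<alpha> (proj x) - period \<alpha>) \<bullet> v)) (at x)" for x
    by (simp add: lattice2_axis)
  from has_derivative_diff[OF this has_derivative_potential[OF assms]]
  have "(?d has_derivative (\<lambda>v. 0)) (at x)" for x by simp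
  then have "\<exists>c. \<forall>x\<in>UNIV. ?d x = c" by (intro has_derivative_zero_constant) auto
  then obtain c where "\<And>x. ?d x = c" by blast
  then have "?d x = ?d 0" by (simp only:)
  also have "?d 0 = 0"
  proof -
    have c: "continuous_on {0..1} (\<lambda>s. \<alpha> (proj (s *\<^sub>R axis i 1)) $ i)"
      by (intro continuous_intros continuous_on_compose2[OF smooth_continuous[OF closed_form_smooth[OF assms]]]) auto
    have "potential \<alpha> (axis i 1) = integral {0..1} (\<lambda>s. \<alpha> (proj (s *\<^sub>R axis i 1)) $ i - period \<alpha> $ i)"
      by (simp add: potential_def inner_axis)
    also have "\<dots> = 0"
      using integrable_continuous_real[OF c]
      by (simp add: Henstock_Kurzweil_Integration.integral_diff integrable_const_ivl period_def)
    finally show ?thesis by (simp add: potential_def)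
  qed
  finally show "potential \<alpha> (x + axis i 1) = potential \<alpha> x" by simp
qed

lemma smooth_potential:
  assumes "closed_form \<alpha>" shows "smooth (potential \<alpha>)"
proof -
  have "smooth (\<lambda>x. \<alpha> (proj x) - period \<alpha>)" by (intro smooth_diff closed_form_smooth[OF assms] smooth_const)
  from smooth_integral[OF smooth_radial[OF this], of 0 1] show ?thesis
    unfolding potential_def[abs_def] by simp
qed

lemma frechet_potential:
  "closed_form \<alpha> \<Longrightarrow> frechet_derivative (potential \<alpha>) (at x) v = (\<alpha> (proj x) - period \<alpha>) \<bullet> v"
  by (rule fun_cong[OF frechet_derivative_at[OF has_derivative_potential], symmetric])

text \<open>The partial derivatives of the potential are the components of \<alpha> minus the
  periods, and by periodicity they have mean zero.\<close>

lemma integral_closed_form: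
  assumes "closed_form \<alpha>"
  shows "integral (cbox 0 1) (\<lambda>x. \<alpha> (proj x) $ i) = period \<alpha> $ i"
proof -
  have c: "continuous_on (cbox 0 1) (\<lambda>x. \<alpha> (proj x) $ i)"
    by (intro continuous_on_subset[OF smooth_continuous[OF smooth_vec_nth[OF closed_form_smooth[OF assms]]]]) auto
  have "0 = integral (cbox 0 1) (\<lambda>x. \<alpha> (proj x) $ i - period \<alpha> $ i)"
    using integral_periodic_partial[OF smooth_potential[OF assms] periodic_potential[OF assms], of i]
    by (simp add: frechet_potential[OF assms] inner_axis)
  also have "\<dots> = integral (cbox 0 1) (\<lambda>x. \<alpha> (proj x) $ i) - period \<alpha> $ i"
    using integrable_continuous[OF c]
    by (simp add: Henstock_Kurzweil_Integration.integral_diff integrable_const content_unit_cell)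
  finally show ?thesis by simp
qed

lemma integral_add_cmult:
  fixes f h :: "'a::euclidean_space \<Rightarrow> real"
  assumes "f integrable_on S" "h integrable_on S"
  shows "integral S (\<lambda>s. f s + r * h s) = integral S f + r * integral S h"
  by (rule integral_unique[OF has_integral_add[OF integrable_integral[OF assms(1)]
      has_integral_mult_right[OF integrable_integral[OF assms(2)]]]])

lemma period_linear:
  assumes "closed_form \<alpha>" "closed_form \<beta>"
  shows "period (\<lambda>p. \<alpha> p + r *\<^sub>R \<beta> p) = period \<alpha> + r *\<^sub>R period \<beta>"
proof -
  have c: "(\<lambda>s. \<alpha> (proj (s *\<^sub>R axis i 1)) $ i) integrable_on {0..1}" if "closed_form \<alpha>" for \<alpha> i
    by (intro integrable_continuous_real continuous_intros
        continuous_on_compose2[OF smooth_continuous[OF closed_form_smooth[OF that]]]) auto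
  show ?thesis
    using integral_add_cmult[OF c[OF assms(1)] c[OF assms(2)]] by (simp add: period_def vec_eq_iff)
qed

lemma potential_linear:
  assumes "closed_form \<alpha>" "closed_form \<beta>"
  shows "potential (\<lambda>p. \<alpha> p + r *\<^sub>R \<beta> p) x = potential \<alpha> x + r * potential \<beta> x"
proof -
  have c: "(\<lambda>s. (\<alpha> (proj (s *\<^sub>R x)) - period \<alpha>) \<bullet> x) integrable_on {0..1}" if "closed_form \<alpha>" for \<alpha>
    by (intro integrable_continuous_real continuous_intros
        continuous_on_compose2[OF smooth_continuous[OF closed_form_smooth[OF that]]]) auto
  have "potential (\<lambda>p. \<alpha> p + r *\<^sub>R \<beta> p) x =
      integral {0..1} (\<lambda>s. (\<alpha> (proj (s *\<^sub>R x)) - period \<alpha>) \<bullet> x + r * ((\<beta> (proj (s *\<^sub>R x)) - period \<beta>) \<bullet> x))"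
    unfolding potential_def period_linear[OF assms] by (simp add: algebra_simps inner_simps)
  also have "\<dots> = potential \<alpha> x + r * potential \<beta> x"
    unfolding potential_def by (rule integral_add_cmult[OF c[OF assms(1)] c[OF assms(2)]])
  finally show ?thesis .
qed

section \<open>Harmonic forms\<close>

lemma frechet_linear_combination:
  fixes f h :: "'a::euclidean_space \<Rightarrow> 'b::real_normed_vector"
  assumes "smooth f" "smooth h"
  shows "frechet_derivative (\<lambda>x. f x + r *\<^sub>R h x) (at x) v = frechet_derivative f (at x) v + r *\<^sub>R frechet_derivative h (at x) v"
proof -
  have "((\<lambda>x. f x + r *\<^sub>R h x) has_derivative
      (\<lambda>v. frechet_derivative f (at x) v + r *\<^sub>R frechet_derivative h (at x) v)) (at x)"
    by (rule has_derivative_add[OF smooth_has_derivative[OF assms(1)]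
      has_derivative_scaleR_right[OF smooth_has_derivative[OF assms(2)]]])
  from fun_cong[OF frechet_derivative_at[OF this], of v] show ?thesis by simp
qed

lemma partial_linear_combination:
  assumes "smooth_torus f" "smooth_torus h"
  shows "partial i (\<lambda>p. f p + r *\<^sub>R h p) p = partial i f p + r *\<^sub>R partial i h p"
  using assms unfolding partial_def smooth_torus_def by (rule frechet_linear_combination)

lemma closed_form_linear_combination:
  assumes "closed_form \<alpha>" "closed_form \<beta>" shows "closed_form (\<lambda>p. \<alpha> p + r *\<^sub>R \<beta> p)"
proof -
  have s: "smooth_torus (\<lambda>p. \<gamma> p $ i)" if "closed_form \<gamma>" for \<gamma> i
    unfolding smooth_torus_def by (rule smooth_vec_nth[OF closed_form_smooth[OF that]])
  have "partial j (\<lambda>p. (\<alpha> p + r *\<^sub>R \<beta> p) $ i) p = partial j (\<lambda>p. \<alpha> p $ i) p + r * partial j (\<lambda>p. \<beta> p $ i) p" for i j p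
    using partial_linear_combination[OF s[OF assms(1)] s[OF assms(2)], of j i r i p] by simp
  moreover have "smooth_torus (\<lambda>p. \<alpha> p + r *\<^sub>R \<beta> p)"
    unfolding smooth_torus_def
    by (rule smooth_add[OF closed_form_smooth[OF assms(1)] smooth_scaleR[OF smooth_const closed_form_smooth[OF assms(2)]]])
  ultimately show ?thesis using assms unfolding closed_form_def by simp
qed

lemma coclosed_form_zero: "coclosed_form g (\<lambda>_. 0)"
  by (simp add: coclosed_form_def partial_def frechet_derivative_const)

context riemannian_torus begin

text \<open>The dual vector field times the area density: its Euclidean divergence expresses
  coclosedness, and its inner product with \<alpha> is the integrand of the squared norm in
  \<open>L2_norm_form\<close>.\<close>

definition density_vector :: "form \<Rightarrow> torus \<Rightarrow> real^2" where
  "density_vector \<alpha> p = sqrt (det (g p)) *\<^sub>R (matrix_inv (g p) *v \<alpha> p)"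

lemma coclosed_form_iff:
  "coclosed_form g \<alpha> \<longleftrightarrow> (\<forall>p. (\<Sum>i\<in>UNIV. partial i (\<lambda>q. density_vector \<alpha> q $ i) p) = 0)"
  by (simp add: coclosed_form_def density_vector_def)

lemma density_vector_nth:
  "density_vector \<alpha> p $ i = sqrt (det (g p)) * (matrix_inv (g p) $ i $ 1 * \<alpha> p $ 1 + matrix_inv (g p) $ i $ 2 * \<alpha> p $ 2)"
  by (simp add: density_vector_def matrix_vector_mult_def sum_2)

lemma smooth_density_vector:
  assumes "closed_form \<alpha>" shows "smooth (\<lambda>x. density_vector \<alpha> (proj x) $ i)"
  unfolding density_vector_nth
  by (rule smooth_mult[OF smooth_sqrt[OF det_metric_pos smooth_det]])
    (rule smooth_add smooth_mult smooth_inverse_entry smooth_vec_nth[OF closed_form_smooth[OF assms]])+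

lemma harmonic_linear_combination:
  assumes "harmonic_form g \<alpha>" "harmonic_form g \<beta>" shows "harmonic_form g (\<lambda>p. \<alpha> p + r *\<^sub>R \<beta> p)"
proof -
  have cl: "closed_form \<alpha>" "closed_form \<beta>" using assms by (auto simp: harmonic_form_def)
  have s: "smooth_torus (\<lambda>p. density_vector \<gamma> p $ i)" if "closed_form \<gamma>" for \<gamma> i
    unfolding smooth_torus_def by (rule smooth_density_vector[OF that])
  have "density_vector (\<lambda>p. \<alpha> p + r *\<^sub>R \<beta> p) p $ i = density_vector \<alpha> p $ i + r *\<^sub>R density_vector \<beta> p $ i" for p i
    by (simp add: density_vector_nth algebra_simps)
  then have "partial i (\<lambda>q. density_vector (\<lambda>p. \<alpha> p + r *\<^sub>R \<beta> p) q $ i) p =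
      partial i (\<lambda>q. density_vector \<alpha> q $ i) p + r *\<^sub>R partial i (\<lambda>q. density_vector \<beta> q $ i) p" for i p
    using partial_linear_combination[OF s[OF cl(1)] s[OF cl(2)], of i i r i p] by simp
  then show ?thesis
    using assms closed_form_linear_combination[OF cl]
    by (simp add: harmonic_form_def coclosed_form_iff sum.distrib sum_2 flip: distrib_left)
qed

lemma harmonic_zero: "harmonic_form g (\<lambda>_. 0)"
  by (simp add: harmonic_form_def closed_form_const coclosed_form_zero)

lemma harmonic_sum:
  assumes "finite B" "\<And>b. b \<in> B \<Longrightarrow> harmonic_form g (\<alpha> b)"
  shows "harmonic_form g (\<lambda>p. \<Sum>b\<in>B. r b *\<^sub>R \<alpha> b p) \<and>
    period (\<lambda>p. \<Sum>b\<in>B. r b *\<^sub>R \<alpha> b p) = (\<Sum>b\<in>B. r b *\<^sub>R period (\<alpha> b)) \<and>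
    potential (\<lambda>p. \<Sum>b\<in>B. r b *\<^sub>R \<alpha> b p) x = (\<Sum>b\<in>B. r b * potential (\<alpha> b) x)"
  using assms
proof (induction B rule: finite_induct)
  case empty
  have "period (\<lambda>_. 0) = 0" by (simp add: period_def vec_eq_iff)
  then show ?case using harmonic_zero by (simp add: potential_def)
next
  case (insert b B)
  let ?s = "\<lambda>p. \<Sum>b\<in>B. r b *\<^sub>R \<alpha> b p"
  have IH: "harmonic_form g ?s" "period ?s = (\<Sum>b\<in>B. r b *\<^sub>R period (\<alpha> b))"
    "potential ?s x = (\<Sum>b\<in>B. r b * potential (\<alpha> b) x)" using insert by auto
  have b: "harmonic_form g (\<alpha> b)" using insert by simp
  have cl: "closed_form ?s" "closed_form (\<alpha> b)" using IH(1) b by (auto simp: harmonic_form_def)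
  have eq: "(\<lambda>p. \<Sum>b\<in>insert b B. r b *\<^sub>R \<alpha> b p) = (\<lambda>p. ?s p + r b *\<^sub>R \<alpha> b p)"
    using insert by (simp add: add.commute)
  show ?case
    unfolding eq using harmonic_linear_combination[OF IH(1) b] period_linear[OF cl] potential_linear[OF cl] IH(2,3) insert(1,2)
    by (simp add: add.commute)
qed

lemma energy_density_bound:
  obtains m where "m > 0" "\<And>\<alpha> p. \<alpha> p \<bullet> density_vector \<alpha> p \<ge> m * (norm (\<alpha> p))\<^sup>2"
proof -
  let ?q = "\<lambda>z. snd z \<bullet> (matrix_inv (g (fst z)) *v snd z) * sqrt (det (g (fst z)))"
  let ?K = "(UNIV :: torus set) \<times> sphere (0 :: real^2) 1"
  have ci: "continuous_on UNIV (\<lambda>p. matrix_inv (g p) $ i $ j)" and cd: "continuous_on UNIV (\<lambda>p. det (g p))" for i j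
    unfolding continuous_on_torus_iff by (rule smooth_continuous[OF smooth_inverse_entry] smooth_continuous[OF smooth_det])+
  have "continuous_on ?K ?q"
    unfolding quadratic_form
    by (intro continuous_intros continuous_on_compose2[OF ci] continuous_on_compose2[OF cd]) auto
  moreover have "compact ?K" by (intro compact_Times compact_UNIV_torus compact_sphere)
  moreover have "(undefined, axis 1 1) \<in> ?K" by (simp add: norm_axis_1)
  then have "?K \<noteq> {}" by blast
  ultimately obtain a where a: "a \<in> ?K" "\<And>z. z \<in> ?K \<Longrightarrow> ?q a \<le> ?q z"
    using continuous_attains_inf[of ?K ?q] by blast
  \<comment> \<open>With \<open>?w\<close> the image of \<open>v\<close> under the inverse metric,
    the expression is the metric square of \<open>?w\<close>.\<close>
  have pos: "v \<bullet> (matrix_inv (g p) *v v) > 0" if "v \<noteq> 0" for v p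
  proof -
    let ?w = "matrix_inv (g p) *v v"
    have v: "v = g p *v ?w" by (simp add: matrix_vector_mul_assoc metric_inverse)
    then have "?w \<noteq> 0" using that by auto
    then have "?w \<bullet> (g p *v ?w) > 0" by (rule metric_pos)
    then show ?thesis using v by (simp add: inner_commute)
  qed
  have "snd a \<noteq> 0" using a(1) by (auto simp: mem_Times_iff)
  then have m: "?q a > 0"
    using pos[of "snd a" "fst a"] det_metric_pos[of "fst a"] by simp
  have "\<alpha> p \<bullet> density_vector \<alpha> p \<ge> ?q a * (norm (\<alpha> p))\<^sup>2" for \<alpha> p
  proof (cases "\<alpha> p = 0")
    case False
    let ?u = "\<alpha> p /\<^sub>R norm (\<alpha> p)"
    have u: "(p, ?u) \<in> ?K" using False by simp
    have v: "\<alpha> p = norm (\<alpha> p) *\<^sub>R ?u" using False by simp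
    have "\<alpha> p \<bullet> density_vector \<alpha> p = (norm (\<alpha> p))\<^sup>2 * ?q (p, ?u)"
      unfolding density_vector_def fst_conv snd_conv
      by (subst (1 2) v) (simp add: quadratic_form power2_eq_square algebra_simps)
    then show ?thesis using mult_left_mono[OF a(2)[OF u] zero_le_power2[of "norm (\<alpha> p)"]] by (simp add: mult.commute)
  qed (simp add: density_vector_def)
  then show thesis using m that by blast
qed

lemma continuous_energy_density:
  assumes "closed_form \<alpha>"
  shows "continuous_on UNIV (\<lambda>x. \<alpha> (proj x) \<bullet> density_vector \<alpha> (proj x))"
  unfolding inner_vec_def sum_2 inner_real_def
  by (intro continuous_intros smooth_continuous smooth_density_vector assms smooth_vec_nth closed_form_smooth)

text \<open>Hodge: a harmonic form with vanishing periods is exact, hence orthogonal to itself.\<close>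

lemma harmonic_period_zero:
  assumes h: "harmonic_form g \<alpha>" and p0: "period \<alpha> = 0"
  shows "\<alpha> p = 0"
proof -
  have cl: "closed_form \<alpha>" using h by (simp add: harmonic_form_def)
  let ?f = "potential \<alpha>" and ?V = "\<lambda>i x. density_vector \<alpha> (proj x) $ i"
  let ?D = "\<lambda>i f x. frechet_derivative f (at x) (axis i 1 :: real^2) :: real"
  note sf = smooth_potential[OF cl] and sV = smooth_density_vector[OF cl]
  have Df: "?D i ?f x = \<alpha> (proj x) $ i" for i x by (simp add: frechet_potential[OF cl] p0 inner_axis)
  have div: "?D 1 (?V 1) x + ?D 2 (?V 2) x = 0" for x
  proof -
    have "partial 1 (\<lambda>q. density_vector \<alpha> q $ 1) (proj x) + partial 2 (\<lambda>q. density_vector \<alpha> q $ 2) (proj x) = 0"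
      using h by (simp add: harmonic_form_def coclosed_form_iff sum_2)
    then show ?thesis by (simp only: partial_proj)
  qed
  have c: "continuous_on S ?f" "continuous_on S (?V i)" "continuous_on S (\<lambda>x. \<alpha> (proj x) $ i)" "continuous_on S (?D j (?V i))" for S i j
    by (rule continuous_on_subset[OF _ subset_UNIV], rule smooth_continuous smooth_frechet_continuous,
        rule sf sV smooth_vec_nth[OF closed_form_smooth[OF cl]])+
  have pV: "periodic (?V i)" for i by (rule periodic_proj[of "\<lambda>p. density_vector \<alpha> p $ i"])
  \<comment> \<open>The potential is a primitive of \<alpha> itself, as the periods vanish; summed
    over \<open>i\<close>, the right-hand sides contain the divergence of the density
    vector.\<close>
  have parts: "integral (cbox 0 1) (\<lambda>x. \<alpha> (proj x) $ i * ?V i x) = - integral (cbox 0 1) (\<lambda>x. ?f x * ?D i (?V i) x)" for i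
    using integral_by_parts_periodic[OF sf sV[of i] periodic_potential[OF cl] pV, of i] by (simp add: Df)
  have "integral (cbox 0 1) (\<lambda>x. \<alpha> (proj x) \<bullet> density_vector \<alpha> (proj x)) =
      integral (cbox 0 1) (\<lambda>x. \<alpha> (proj x) $ 1 * ?V 1 x) + integral (cbox 0 1) (\<lambda>x. \<alpha> (proj x) $ 2 * ?V 2 x)"
    unfolding inner_vec_def sum_2 inner_real_def
    by (intro Henstock_Kurzweil_Integration.integral_add integrable_continuous continuous_intros c)
  also have "\<dots> = - (integral (cbox 0 1) (\<lambda>x. ?f x * ?D 1 (?V 1) x) + integral (cbox 0 1) (\<lambda>x. ?f x * ?D 2 (?V 2) x))"
    unfolding parts by simp
  also have "integral (cbox 0 1) (\<lambda>x. ?f x * ?D 1 (?V 1) x) + integral (cbox 0 1) (\<lambda>x. ?f x * ?D 2 (?V 2) x) =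
      integral (cbox 0 1) (\<lambda>x. ?f x * ?D 1 (?V 1) x + ?f x * ?D 2 (?V 2) x)"
    by (intro Henstock_Kurzweil_Integration.integral_add[symmetric] integrable_continuous continuous_intros c)
  also have "\<dots> = 0" using div by (simp flip: distrib_left)
  finally have zero: "integral (cbox 0 1) (\<lambda>x. \<alpha> (proj x) \<bullet> density_vector \<alpha> (proj x)) = 0" by simp
  obtain m where m: "m > 0" and low: "\<And>\<alpha> p. \<alpha> p \<bullet> density_vector \<alpha> p \<ge> m * (norm (\<alpha> p))\<^sup>2"
    by (rule energy_density_bound) blast
  have nn: "\<alpha> p \<bullet> density_vector \<alpha> p \<ge> 0" for p
    using low[of \<alpha> p] mult_nonneg_nonneg[OF less_imp_le[OF m] zero_le_power2[of "norm (\<alpha> p)"]] by linarith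
  have "box 0 (1 :: real^2) \<noteq> {}" by (simp add: interval_ne_empty_cart)
  then have "\<alpha> (proj x) \<bullet> density_vector \<alpha> (proj x) = 0" if "x \<in> cbox 0 1" for x
    using integral_cbox_eq_0_iff[of 0 1 "\<lambda>x. \<alpha> (proj x) \<bullet> density_vector \<alpha> (proj x)"]
      continuous_on_subset[OF continuous_energy_density[OF cl] subset_UNIV] nn zero that by blast
  then have z: "\<alpha> (proj x) = 0" if "x \<in> cbox 0 1" for x
    using low[of \<alpha> "proj x"] that m by (simp add: mult_le_0_iff)
  obtain k where "k \<in> lattice2" "rep_torus p - k \<in> cbox 0 1" by (rule cbox_representative)
  then show ?thesis using z[of "rep_torus p - k"] proj_add_lattice[OF lattice2_minus, of k "rep_torus p"] by simp
qed

lemma L2_norm_form_eq: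
  assumes "continuous_on UNIV \<alpha>"
  shows "L2_norm_form g \<alpha> = sqrt (integral (cbox 0 1) (\<lambda>x. \<alpha> (proj x) \<bullet> density_vector \<alpha> (proj x)))"
proof -
  have ci: "continuous_on UNIV (\<lambda>p. matrix_inv (g p) $ i $ j)" and cd: "continuous_on UNIV (\<lambda>p. det (g p))" for i j
    unfolding continuous_on_torus_iff by (rule smooth_continuous[OF smooth_inverse_entry] smooth_continuous[OF smooth_det])+
  have "continuous_on UNIV (\<lambda>p. \<alpha> p \<bullet> (matrix_inv (g p) *v \<alpha> p) * sqrt (det (g p)))"
    unfolding quadratic_form by (intro continuous_intros ci cd assms)
  from integral_torus_measure[OF this] show ?thesis
    by (simp add: L2_norm_form_def density_vector_def mult.commute)
qed

text \<open>A harmonic form is determined by its periods, so it is a combination of forms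
  \<open>\<beta> b\<close> whose periods form an orthonormal basis of all periods that occur. The
  coefficients are bounded by the norm of the period and hence by the norm of the form; the finitely
  many potentials are bounded by periodicity.\<close>

lemma harmonic_potential_bound:
  obtains K where "K \<ge> 0" "\<And>\<alpha> x. harmonic_form g \<alpha> \<Longrightarrow> \<bar>potential \<alpha> x\<bar> \<le> K * L2_norm_form g \<alpha>"
proof -
  obtain m where m: "m > 0" and low: "\<And>\<alpha> p. \<alpha> p \<bullet> density_vector \<alpha> p \<ge> m * (norm (\<alpha> p))\<^sup>2"
    by (rule energy_density_bound) blast
  have period_L2: "norm (period \<alpha>) \<le> L2_norm_form g \<alpha> / sqrt m" if cl: "closed_form \<alpha>" for \<alpha>
  proof -
    let ?c = "period \<alpha>" and ?a = "\<lambda>x. \<alpha> (proj x)"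
    have ca: "continuous_on S ?a" for S
      by (rule continuous_on_subset[OF smooth_continuous[OF closed_form_smooth[OF cl]] subset_UNIV])
    have "?c = integral (cbox 0 1) ?a"
    proof (rule vec_eq_iff[THEN iffD2], rule allI)
      fix i
      have "integral (cbox 0 1) ((\<lambda>v. v $ i) \<circ> ?a) = integral (cbox 0 1) ?a $ i"
        by (rule integral_linear[OF integrable_continuous[OF ca] bounded_linear_vec_nth])
      then show "?c $ i = integral (cbox 0 1) ?a $ i" by (simp add: o_def integral_closed_form[OF cl])
    qed
    then have ic: "integral (cbox 0 1) (\<lambda>x. ?c \<bullet> ?a x) = ?c \<bullet> ?c"
      using integral_linear[OF integrable_continuous[OF ca] bounded_linear_inner_right[of ?c]] by (simp add: o_def)
    \<comment> \<open>Integrating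
      \<open>2 * (c \<bullet> a) - c \<bullet> c \<le> a \<bullet> a\<close> over the cell, where
      \<open>a\<close> has mean \<open>c\<close>, yields Jensen's inequality for the square.\<close>
    have "2 * (?c \<bullet> ?c) - ?c \<bullet> ?c = integral (cbox 0 1) (\<lambda>x. 2 * (?c \<bullet> ?a x) - ?c \<bullet> ?c)"
      by (subst Henstock_Kurzweil_Integration.integral_diff)
        (auto simp: ic content_unit_cell intro!: integrable_continuous continuous_intros ca)
    also have "\<dots> \<le> integral (cbox 0 1) (\<lambda>x. (?a x \<bullet> density_vector \<alpha> (proj x)) / m)"
    proof (rule integral_le)
      show "(\<lambda>x. 2 * (?c \<bullet> ?a x) - ?c \<bullet> ?c) integrable_on cbox 0 1"
        by (intro integrable_continuous continuous_intros ca)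
      show "(\<lambda>x. (?a x \<bullet> density_vector \<alpha> (proj x)) / m) integrable_on cbox 0 1"
        by (intro integrable_continuous continuous_intros
            continuous_on_subset[OF continuous_energy_density[OF cl] subset_UNIV]) (use m in auto)
      fix x
      have "2 * (?c \<bullet> ?a x) - ?c \<bullet> ?c \<le> ?a x \<bullet> ?a x"
        using inner_ge_zero[of "?a x - ?c"] by (simp add: inner_simps inner_commute)
      also have "\<dots> \<le> (?a x \<bullet> density_vector \<alpha> (proj x)) / m"
        using low[of \<alpha> "proj x"] m by (simp add: field_simps power2_norm_eq_inner)
      finally show "2 * (?c \<bullet> ?a x) - ?c \<bullet> ?c \<le> (?a x \<bullet> density_vector \<alpha> (proj x)) / m" .
    qed
    finally have "(norm ?c)\<^sup>2 \<le> integral (cbox 0 1) (\<lambda>x. ?a x \<bullet> density_vector \<alpha> (proj x)) / m"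
      by (simp add: power2_norm_eq_inner)
    then have "norm ?c \<le> sqrt (integral (cbox 0 1) (\<lambda>x. ?a x \<bullet> density_vector \<alpha> (proj x)) / m)"
      by (rule real_le_rsqrt)
    moreover have "continuous_on UNIV \<alpha>" using cl by (simp add: closed_form_def smooth_torus_continuous)
    ultimately show ?thesis by (simp add: L2_norm_form_eq real_sqrt_divide)
  qed
  let ?C = "period ` Collect (harmonic_form g)"
  have "subspace ?C"
    unfolding subspace_def
  proof (intro conjI ballI allI)
    show "0 \<in> ?C" using harmonic_zero by (intro image_eqI[of _ _ "\<lambda>_. 0"]) (auto simp: period_def vec_eq_iff)
    fix c assume "c \<in> ?C"
    then obtain \<alpha> where \<alpha>: "harmonic_form g \<alpha>" "c = period \<alpha>" by auto
    have cl: "closed_form \<alpha>" using \<alpha> by (simp add: harmonic_form_def)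
    show "c + d \<in> ?C" if "d \<in> ?C" for d
    proof -
      obtain \<beta> where \<beta>: "harmonic_form g \<beta>" "d = period \<beta>" using \<open>d \<in> ?C\<close> by auto
      have "closed_form \<beta>" using \<beta> by (simp add: harmonic_form_def)
      then show ?thesis
        using harmonic_linear_combination[OF \<alpha>(1) \<beta>(1), of 1] period_linear[OF cl, of \<beta> 1] \<alpha> \<beta>
        by (intro image_eqI[of _ _ "\<lambda>p. \<alpha> p + 1 *\<^sub>R \<beta> p"]) auto
    qed
    fix r
    show "r *\<^sub>R c \<in> ?C"
      using harmonic_linear_combination[OF harmonic_zero \<alpha>(1), of r] period_linear[OF closed_form_const[of 0] cl, of r] \<alpha>
      by (intro image_eqI[of _ _ "\<lambda>p. 0 + r *\<^sub>R \<alpha> p"]) (auto simp: period_def vec_eq_iff)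
  qed
  then obtain B where B: "B \<subseteq> ?C" "pairwise orthogonal B" "\<And>b. b \<in> B \<Longrightarrow> norm b = 1" "independent B" "span B = ?C"
    using orthonormal_basis_subspace by metis
  have fB: "finite B" using B(4) by (rule independent_imp_finite)
  have "\<forall>b\<in>B. \<exists>\<alpha>. harmonic_form g \<alpha> \<and> period \<alpha> = b" using B(1) by auto
  from bchoice[OF this] obtain \<beta> where \<beta>: "\<And>b. b \<in> B \<Longrightarrow> harmonic_form g (\<beta> b)" "\<And>b. b \<in> B \<Longrightarrow> period (\<beta> b) = b" by blast
  have "\<forall>b\<in>B. \<exists>M. \<forall>x. \<bar>potential (\<beta> b) x\<bar> \<le> M"
  proof
    fix b assume "b \<in> B"
    then have cl: "closed_form (\<beta> b)" using \<beta>(1) by (simp add: harmonic_form_def)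
    obtain M where "\<And>x. norm (potential (\<beta> b) x) \<le> M"
      using periodic_continuous_bounded[OF periodic_potential[OF cl] smooth_continuous[OF smooth_potential[OF cl]]] by blast
    then show "\<exists>M. \<forall>x. \<bar>potential (\<beta> b) x\<bar> \<le> M" by auto
  qed
  from bchoice[OF this] obtain M where M: "\<And>b x. b \<in> B \<Longrightarrow> \<bar>potential (\<beta> b) x\<bar> \<le> M b" by blast
  have M0: "M b \<ge> 0" if "b \<in> B" for b using M[OF that, of 0] by linarith
  define K where "K = (\<Sum>b\<in>B. M b) / sqrt m"
  have S0: "(\<Sum>b\<in>B. M b) \<ge> 0" by (intro sum_nonneg M0)
  show thesis
  proof (rule that[of K])
    show "K \<ge> 0" using S0 m by (simp add: K_def)
    fix \<alpha> x assume h: "harmonic_form g \<alpha>"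
    then have cl: "closed_form \<alpha>" by (simp add: harmonic_form_def)
    let ?r = "\<lambda>b. period \<alpha> \<bullet> b" and ?s = "\<lambda>p. \<Sum>b\<in>B. (period \<alpha> \<bullet> b) *\<^sub>R \<beta> b p"
    have hs: "harmonic_form g ?s" "period ?s = (\<Sum>b\<in>B. ?r b *\<^sub>R period (\<beta> b))"
      "potential ?s x = (\<Sum>b\<in>B. ?r b * potential (\<beta> b) x)"
      using harmonic_sum[OF fB, of \<beta> ?r x] \<beta>(1) by auto
    have "period \<alpha> \<in> span B" using B(5) h by auto
    then have "period \<alpha> = (\<Sum>b\<in>B. ?r b *\<^sub>R b)"
      using orthonormal_basis_expand[of B "period \<alpha>"] B(2,3) fB by simp
    then have ps: "period ?s = period \<alpha>" using hs(2) \<beta>(2) by simp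
    have cs: "closed_form ?s" using hs(1) by (simp add: harmonic_form_def)
    have "harmonic_form g (\<lambda>p. \<alpha> p + (- 1) *\<^sub>R ?s p)" by (rule harmonic_linear_combination[OF h hs(1)])
    moreover have "period (\<lambda>p. \<alpha> p + (- 1) *\<^sub>R ?s p) = 0" by (simp only: period_linear[OF cl cs] ps) simp
    ultimately have "\<alpha> p + (- 1) *\<^sub>R ?s p = 0" for p by (rule harmonic_period_zero)
    then have "\<alpha> = ?s" by (intro ext) simp
    then have "\<bar>potential \<alpha> x\<bar> = \<bar>\<Sum>b\<in>B. ?r b * potential (\<beta> b) x\<bar>" using hs(3) by simp
    also have "\<dots> \<le> (\<Sum>b\<in>B. norm (period \<alpha>) * M b)"
    proof (rule order_trans[OF sum_abs sum_mono])
      fix b assume b: "b \<in> B"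
      have "\<bar>?r b\<bar> \<le> norm (period \<alpha>) * norm b" by (rule Cauchy_Schwarz_ineq2)
      then show "\<bar>?r b * potential (\<beta> b) x\<bar> \<le> norm (period \<alpha>) * M b"
        unfolding abs_mult using M[OF b] B(3)[OF b] M0[OF b] by (intro mult_mono) auto
    qed
    also have "\<dots> = norm (period \<alpha>) * (\<Sum>b\<in>B. M b)" by (simp add: sum_distrib_left)
    also have "\<dots> \<le> L2_norm_form g \<alpha> / sqrt m * (\<Sum>b\<in>B. M b)"
      by (rule mult_right_mono[OF period_L2[OF cl] S0])
    finally show "\<bar>potential \<alpha> x\<bar> \<le> K * L2_norm_form g \<alpha>" by (simp add: K_def mult.commute)
  qed
qed

end

section \<open>Reduction to Hamiltonian isotopies\<close>

lemma osc_le: "(\<And>p q. f p - f q \<le> B) \<Longrightarrow> osc f \<le> B"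
proof -
  assume B: "\<And>p q. f p - f q \<le> B"
  have "f p - B \<le> (INF q. f q)" for p by (rule cINF_greatest) (use B[of p] in \<open>auto simp: algebra_simps\<close>)
  then have "(SUP p. f p) \<le> B + (INF q. f q)" by (intro cSUP_least) (auto simp: algebra_simps)
  then show ?thesis by (simp add: osc_def)
qed

lemma diff_le_osc: "continuous_on UNIV f \<Longrightarrow> f p - f q \<le> osc f"
proof -
  assume "continuous_on UNIV f"
  then have "bounded (range f)" using compact_UNIV_torus compact_continuous_image compact_imp_bounded by blast
  then have "f p \<le> (SUP p. f p)" "(INF p. f p) \<le> f q"
    using bounded_imp_bdd_above bounded_imp_bdd_below by (auto intro: cSUP_upper cINF_lower)
  then show ?thesis by (simp add: osc_def)
qed

lemma smooth_family_slice:
  assumes "smooth_family U" "t \<in> {0..1}"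
  shows "smooth_torus (U t)"
proof -
  obtain G :: "real \<times> (real^2) \<Rightarrow> 'a" where G: "smooth G" "\<And>t x. t \<in> {0..1} \<Longrightarrow> U t (proj x) = G (t, x)"
    using assms(1) by (auto simp: smooth_family_def)
  show ?thesis unfolding smooth_torus_def G(2)[OF assms(2)] by (rule smooth_slice(1)[OF G(1)])
qed

text \<open>Continuity in time makes the energy integrand integrable. Otherwise the integral would
  be 0 by convention, and a bound on the length would say nothing.\<close>

lemma continuous_osc:
  assumes "smooth_family U" shows "continuous_on {0..1} (\<lambda>t. osc (U t))"
proof -
  obtain G :: "real \<times> (real^2) \<Rightarrow> real" where G: "smooth G" "\<And>t x. t \<in> {0..1} \<Longrightarrow> U t (proj x) = G (t, x)"
    using assms by (auto simp: smooth_family_def)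
  have "uniformly_continuous_on ({0..1} \<times> cbox 0 1) G"
    by (intro compact_uniformly_continuous compact_Times continuous_on_subset[OF smooth_continuous[OF G(1)]]) auto
  note uc = this[unfolded uniformly_continuous_on_def]
  show ?thesis
    unfolding continuous_on_iff
  proof (intro ballI allI impI)
    fix t e :: real assume t: "t \<in> {0..1}" and e: "e > 0"
    obtain d where d: "d > 0" "\<And>z z'. z \<in> {0..1} \<times> cbox 0 1 \<Longrightarrow> z' \<in> {0..1} \<times> cbox 0 1 \<Longrightarrow>
        dist z' z < d \<Longrightarrow> dist (G z') (G z) < e / 4"
      using uc[rule_format, of "e / 4"] e by auto
    show "\<exists>d>0. \<forall>s\<in>{0..1}. dist s t < d \<longrightarrow> dist (osc (U s)) (osc (U t)) < e"
    proof (intro exI[of _ d] conjI ballI impI d(1))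
      fix s assume s: "s \<in> {0..1}" "dist s t < d"
      have close: "\<bar>U s p - U t p\<bar> < e / 4" for p
      proof -
        obtain k where k: "k \<in> lattice2" "rep_torus p - k \<in> cbox 0 1" by (rule cbox_representative)
        have p: "proj (rep_torus p - k) = p" using proj_add_lattice[OF lattice2_minus[OF k(1)], of "rep_torus p"] by simp
        have "dist (G (s, rep_torus p - k)) (G (t, rep_torus p - k)) < e / 4"
          by (rule d(2)) (use s t k(2) in \<open>auto simp: dist_Pair_Pair\<close>)
        then show ?thesis using G(2)[of _ "rep_torus p - k"] s t by (simp add: p dist_real_def)
      qed
      have cont: "continuous_on UNIV (U r)" if "r \<in> {0..1}" for r
        by (rule smooth_torus_continuous[OF smooth_family_slice[OF assms that]])
      have "osc (U s) \<le> osc (U t) + e / 2"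
      proof (rule osc_le)
        show "U s p - U s q \<le> osc (U t) + e / 2" for p q
          using close[of p] close[of q] diff_le_osc[OF cont[OF t], of p q] by linarith
      qed
      moreover have "osc (U t) \<le> osc (U s) + e / 2"
      proof (rule osc_le)
        show "U t p - U t q \<le> osc (U s) + e / 2" for p q
          using close[of p] close[of q] diff_le_osc[OF cont[OF s(1)], of p q] by linarith
      qed
      ultimately show "dist (osc (U s)) (osc (U t)) < e" using e by (simp add: dist_real_def)
    qed
  qed
qed

lemma (in riemannian_torus) continuous_L2_norm_form:
  assumes "smooth_family \<H>" shows "continuous_on {0..1} (\<lambda>t. L2_norm_form g (\<H> t))"
proof -
  obtain A :: "real \<times> (real^2) \<Rightarrow> real^2" where A: "smooth A" "\<And>t x. t \<in> {0..1} \<Longrightarrow> \<H> t (proj x) = A (t, x)"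
    using assms by (auto simp: smooth_family_def)
  let ?K = "\<lambda>z. A z \<bullet> (matrix_inv (g (proj (snd z))) *v A z) * sqrt (det (g (proj (snd z))))"
  have cA: "continuous_on UNIV A" by (rule smooth_continuous[OF A(1)])
  have ci: "continuous_on UNIV (\<lambda>z::real \<times> (real^2). matrix_inv (g (proj (snd z))) $ i $ j)" for i j
    by (rule continuous_on_compose2[OF smooth_continuous[OF smooth_inverse_entry]]) (auto intro: continuous_intros)
  have cd: "continuous_on UNIV (\<lambda>z::real \<times> (real^2). det (g (proj (snd z))))"
    by (rule continuous_on_compose2[OF smooth_continuous[OF smooth_det]]) (auto intro: continuous_intros)
  have cK: "continuous_on UNIV ?K"
    unfolding quadratic_form by (intro continuous_intros ci cd cA)
  have "continuous_on {0..1} (\<lambda>t. sqrt (integral (cbox 0 1) (\<lambda>x. ?K (t, x))))"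
    by (intro continuous_intros continuous_on_subset[OF continuous_on_integral_parameter[OF cK] subset_UNIV])
  moreover have "L2_norm_form g (\<H> t) = sqrt (integral (cbox 0 1) (\<lambda>x. ?K (t, x)))" if "t \<in> {0..1}" for t
    using L2_norm_form_eq[OF smooth_torus_continuous[OF smooth_family_slice[OF assms that]]]
    by (simp add: density_vector_def A(2)[OF that] mult.commute)
  ultimately show ?thesis by (simp cong: continuous_on_cong_simp)
qed

section \<open>Translations and area preserving lifts\<close>

definition shift :: "real^2 \<Rightarrow> torus \<Rightarrow> torus" where
  "shift v p = proj (rep_torus p + v)"

lemma shift_proj: "shift v (proj x) = proj (x + v)"
  unfolding shift_def by (rule proj_add_cong) simp

lemma shift_0: "shift 0 p = p"
  by (simp add: shift_def)

lemma shift_shift: "shift u (shift v p) = shift (v + u) p"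
proof -
  obtain x where "p = proj x" by (rule proj_cases)
  then show ?thesis by (simp add: shift_proj add.assoc)
qed

text \<open>The vector whose contraction with \<omega> is \<open>c\<close>: the velocity of the
  translations generated by the constant form \<open>c\<close>.\<close>

definition hamiltonian_vector :: "real^2 \<Rightarrow> real^2" where
  "hamiltonian_vector c = (\<chi> i. if i = 1 then c $ 2 else - c $ 1)"

lemma contract_omega_nth: "contract_omega X $ 1 = - X $ 2" "contract_omega X $ 2 = X $ 1"
  by (simp_all add: contract_omega_def omega_def axis_nth2)

lemma contract_omega_diff_hamiltonian_vector:
  "contract_omega (X - hamiltonian_vector c) = contract_omega X - c"
  by (simp add: vec_eq_iff forall_2 contract_omega_nth hamiltonian_vector_def)

lemma smooth_hamiltonian_vector:
  assumes "smooth f" shows "smooth (\<lambda>x. hamiltonian_vector (f x))"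
  unfolding hamiltonian_vector_def
proof (rule smooth_vec_lambda)
  show "smooth (\<lambda>x. if i = 1 then f x $ 2 else - f x $ 1)" for i :: 2
    by (cases "i = 1") (auto intro: smooth_minus smooth_vec_nth[OF assms])
qed

text \<open>For an area preserving lift \<open>F\<close> of a map isotopic to the identity, \<open>(\<partial>\<^sub>1 W) \<circ> F\<close> is
  \<open>\<partial>\<^sub>2 F\<^sub>2 \<partial>\<^sub>1 u - \<partial>\<^sub>1 F\<^sub>2 \<partial>\<^sub>2 u\<close> with \<open>u = W \<circ> F\<close>, and similarly for \<open>(\<partial>\<^sub>2 W) \<circ> F\<close>; these have mean zero
  because \<open>F\<close> is the identity up to a periodic function.\<close>

lemma integral_gradient_lift:
  fixes W :: "real^2 \<Rightarrow> real" and F :: "real^2 \<Rightarrow> real^2"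
  assumes W: "smooth W" "periodic W" and F: "smooth F" "\<And>x k. k \<in> lattice2 \<Longrightarrow> F (x + k) = F x + k"
    and area: "\<And>x u v. omega (frechet_derivative F (at x) u) (frechet_derivative F (at x) v) = omega u v"
  shows "integral (cbox 0 1) (\<lambda>x. frechet_derivative W (at (F x)) (axis i 1)) = 0"
proof -
  let ?u = "\<lambda>x. W (F x)" and ?f = "\<lambda>k x. F x $ k - x $ k"
  let ?D = "\<lambda>i f x. frechet_derivative f (at x) (axis i 1 :: real^2) :: real"
  let ?F = "\<lambda>j x. frechet_derivative F (at x) (axis j 1 :: real^2)"
  have su: "smooth ?u" by (rule smooth_compose[OF W(1) F(1)])
  have sf: "smooth (?f k)" for k by (intro smooth_diff smooth_vec_nth F smooth_ident)
  have pu: "periodic ?u" using F(2) W(2) by (simp add: periodic_def)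
  have pf: "periodic (?f k)" for k using F(2) by (simp add: periodic_def)
  have Df: "?D j (?f k) x = ?F j x $ k - (if j = k then 1 else 0)" for j k x
  proof -
    have "(?f k has_derivative (\<lambda>v. frechet_derivative F (at x) v $ k - v $ k)) (at x)"
      by (intro has_derivative_diff bounded_linear.has_derivative[OF bounded_linear_vec_nth]
          smooth_has_derivative[OF F(1)] has_derivative_ident)
    from fun_cong[OF frechet_derivative_at[OF this], of "axis j 1"]
    have "?D j (?f k) x = ?F j x $ k - axis j 1 $ k" by (rule sym)
    then show ?thesis by (auto simp: axis_nth2)
  qed
  have Du: "?D j ?u x = ?D 1 W (F x) * ?F j x $ 1 + ?D 2 W (F x) * ?F j x $ 2" for j x
  proof -
    have DW: "(W has_derivative frechet_derivative W (at (F x))) (at (F x))" by (rule smooth_has_derivative[OF W(1)])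
    have "?D j ?u x = frechet_derivative W (at (F x)) (?F j x)"
      using fun_cong[OF frechet_derivative_at[OF has_derivative_compose[OF smooth_has_derivative[OF F(1)] DW]]] by simp
    then show ?thesis
      using linear_real2[OF has_derivative_linear[OF DW], of "?F j x"] by (simp add: mult.commute)
  qed
  have det: "?F 1 x $ 1 * ?F 2 x $ 2 - ?F 1 x $ 2 * ?F 2 x $ 1 = 1" for x
    using area[of x "axis 1 1" "axis 2 1"] by (simp add: omega_def axis_nth2)
  have c: "continuous_on S (?D j ?u)" "continuous_on S (?D j (?f k))" for S j k
    by (rule continuous_on_subset[OF _ subset_UNIV], rule smooth_frechet_continuous, rule su sf)+
  \<comment> \<open>Here \<open>?f k\<close> is a component of the displacement. The identity part
    of \<open>F\<close> contributes a partial derivative of \<open>u\<close>, the displacement a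
    Jacobian of two periodic functions; both integrate to zero.\<close>
  have "integral (cbox 0 1) (\<lambda>x. ?D j ?u x + (?D k (?f k) x * ?D j ?u x - ?D j (?f k) x * ?D k ?u x)) = 0" for j k
  proof -
    have "integral (cbox 0 1) (\<lambda>x. ?D j ?u x + (?D k (?f k) x * ?D j ?u x - ?D j (?f k) x * ?D k ?u x)) =
      integral (cbox 0 1) (?D j ?u) + (integral (cbox 0 1) (\<lambda>x. ?D k (?f k) x * ?D j ?u x)
        - integral (cbox 0 1) (\<lambda>x. ?D j (?f k) x * ?D k ?u x))"
      by (simp add: Henstock_Kurzweil_Integration.integral_add Henstock_Kurzweil_Integration.integral_diff
          integrable_continuous integrable_diff continuous_on_mult c)
    then show ?thesis
      using integral_periodic_partial[OF su pu, of j] integral_partial_partial[OF sf pf su pu, of k j k] by simp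
  qed
  moreover have "?D 1 W (F x) = ?D 1 ?u x + (?D 2 (?f 2) x * ?D 1 ?u x - ?D 1 (?f 2) x * ?D 2 ?u x)" for x
  proof -
    have "?D 1 W (F x) = ?D 1 W (F x) * (?F 1 x $ 1 * ?F 2 x $ 2 - ?F 1 x $ 2 * ?F 2 x $ 1)" by (simp only: det mult_1_right)
    then show ?thesis unfolding Df Du by (simp add: algebra_simps)
  qed
  moreover have "?D 2 W (F x) = ?D 2 ?u x + (?D 1 (?f 1) x * ?D 2 ?u x - ?D 2 (?f 1) x * ?D 1 ?u x)" for x
  proof -
    have "?D 2 W (F x) = ?D 2 W (F x) * (?F 1 x $ 1 * ?F 2 x $ 2 - ?F 1 x $ 2 * ?F 2 x $ 1)" by (simp only: det mult_1_right)
    then show ?thesis unfolding Df Du by (simp add: algebra_simps)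
  qed
  ultimately show ?thesis using exhaust_2[of i] by (elim disjE) simp_all
qed

section \<open>Removing the harmonic part of an isotopy\<close>

definition normalized_lift :: "(real \<times> (real^2) \<Rightarrow> real^2) \<Rightarrow> (real \<Rightarrow> torus \<Rightarrow> torus) \<Rightarrow> bool" where
  "normalized_lift G \<Phi> \<longleftrightarrow> smooth G \<and> (\<forall>x. G (0, x) = x) \<and> (\<forall>t\<in>{0..1}. \<forall>x. proj (G (t, x)) = \<Phi> t (proj x)) \<and>
    (\<forall>t\<in>{0..1}. \<forall>x. \<forall>k\<in>lattice2. G (t, x + k) = G (t, x) + k)"

text \<open>\<open>symplectic_diffeo\<close> provides a separate lift for each time. It differs from
  \<open>G\<close> at that time by a constant, so area preservation passes to the lift that is
  smooth in time.\<close>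

lemma normalized_lift_area:
  assumes G: "normalized_lift G \<Phi>" and \<Phi>: "symplectic_isotopy \<Phi>" and t: "t \<in> {0..1}"
  shows "omega (frechet_derivative (\<lambda>x. G (t, x)) (at x) u) (frechet_derivative (\<lambda>x. G (t, x)) (at x) v) = omega u v"
proof -
  obtain F where F: "smooth F" "\<And>x. proj (F x) = \<Phi> t (proj x)"
    and area: "\<And>x u v. omega (frechet_derivative F (at x) u) (frechet_derivative F (at x) v) = omega u v"
    using \<Phi> t unfolding symplectic_isotopy_def symplectic_diffeo_def is_lift_def by blast
  have sG: "smooth (\<lambda>x. G (t, x))" using G by (simp add: normalized_lift_def smooth_slice)
  have "F y - G (t, y) = F 0 - G (t, 0)" for y
  proof (rule lattice2_valued_constant[of UNIV "\<lambda>y. F y - G (t, y)"])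
    show "continuous_on UNIV (\<lambda>y. F y - G (t, y))"
      by (rule continuous_on_diff[OF smooth_continuous[OF F(1)] smooth_continuous[OF sG]])
    show "F y - G (t, y) \<in> lattice2" for y
      using F(2)[of y] G t by (simp add: normalized_lift_def flip: proj_eq_lattice)
  qed auto
  then have "F = (\<lambda>y. G (t, y) + (F 0 - G (t, 0)))" by (auto simp: fun_eq_iff algebra_simps)
  moreover have "((\<lambda>y. G (t, y) + (F 0 - G (t, 0))) has_derivative frechet_derivative (\<lambda>y. G (t, y)) (at x)) (at x)"
    using has_derivative_add[OF smooth_has_derivative[OF sG] has_derivative_const] by simp
  ultimately have "frechet_derivative (\<lambda>y. G (t, y)) (at x) = frechet_derivative F (at x)"
    by (intro frechet_derivative_at) simp
  then show ?thesis using area by simp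
qed

lemma velocity_normalized_lift:
  assumes "normalized_lift G \<Phi>" "t \<in> {0..1}"
  shows "velocity (\<lambda>s. \<Phi> s (proj x)) t = frechet_derivative G (at (t, x)) (1, 0)"
proof (rule velocity_lift[of "\<lambda>s. G (s, x)"])
  have G: "smooth G" using assms by (simp add: normalized_lift_def)
  show "continuous_on {0..1} (\<lambda>s. G (s, x))"
    by (rule continuous_on_subset[OF smooth_continuous[OF smooth_slice(2)[OF G]]]) simp
  show "((\<lambda>s. G (s, x)) has_vector_derivative frechet_derivative G (at (t, x)) (1, 0)) (at t within {0..1})"
    by (rule has_vector_derivative_at_within[OF has_vector_derivative_slice[OF G]])
qed (use assms in \<open>auto simp: normalized_lift_def\<close>)

text \<open>The time derivative of the mean displacement is the mean of the velocity field along the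
  lift. Up to sign its components are partial derivatives of \<open>U t\<close> evaluated along an
  area preserving lift, and these have mean zero.\<close>

lemma mean_displacement_hamiltonian:
  assumes G: "normalized_lift G \<Psi>" and \<Psi>: "symplectic_isotopy \<Psi>" and gen: "generated_by \<Psi> U (\<lambda>t p. 0)"
  shows "integral (cbox 0 1) (\<lambda>x. G (1, x) - x) = 0"
proof -
  have sG: "smooth G" using G by (simp add: normalized_lift_def)
  let ?m = "\<lambda>t. integral (cbox 0 1) (\<lambda>x. G (t, x) - x)"
  let ?X = "\<lambda>t x. frechet_derivative G (at (t, x)) (1, 0)"
  have dm: "(?m has_derivative (\<lambda>h. 0)) (at t)" if t: "t \<in> {0..1}" for t
  proof -
    have sK: "smooth (\<lambda>z. G z - snd z)" by (intro smooth_diff sG smooth_snd smooth_ident)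
    have "((\<lambda>s. G (s, x) - x) has_derivative (\<lambda>h. h *\<^sub>R ?X t x)) (at t)" for x
    proof -
      have "((\<lambda>s. G (s, x) - x) has_vector_derivative ?X t x - 0) (at t)"
        by (rule has_vector_derivative_diff[OF has_vector_derivative_slice[OF sG] has_vector_derivative_const])
      then show ?thesis by (simp add: has_vector_derivative_def)
    qed
    then have "(?m has_derivative (\<lambda>h. integral (cbox 0 1) (\<lambda>x. h *\<^sub>R ?X t x))) (at t)"
      using has_derivative_integral_parameter_eq[OF sK, of "\<lambda>x h. h *\<^sub>R ?X t x" t 0 1] by simp
    moreover have "integral (cbox 0 1) (?X t) = 0"
    proof -
      let ?W = "\<lambda>x. U t (proj x)"
      have sW: "smooth ?W"
        using smooth_family_slice[OF _ t, of U] gen by (simp add: generated_by_def smooth_torus_def)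
      have F: "smooth (\<lambda>x. G (t, x))" "\<And>x k. k \<in> lattice2 \<Longrightarrow> G (t, x + k) = G (t, x) + k"
        using G t smooth_slice(1)[OF sG] by (auto simp: normalized_lift_def)
      have zero: "integral (cbox 0 1) (\<lambda>x. frechet_derivative ?W (at (G (t, x))) (axis i 1)) = 0" for i
        by (rule integral_gradient_lift[OF sW periodic_proj F normalized_lift_area[OF G \<Psi> t]])
      have X: "contract_omega (?X t x) $ i = frechet_derivative ?W (at (G (t, x))) (axis i 1)" for x i
      proof -
        have "\<forall>p. contract_omega (velocity (\<lambda>s. \<Psi> s p) t) = differential (U t) (\<Psi> t p) + 0"
          using gen t unfolding generated_by_def by blast
        from spec[OF this, of "proj x"] have "contract_omega (?X t x) = differential (U t) (\<Psi> t (proj x))"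
          by (simp add: velocity_normalized_lift[OF G t])
        moreover have "\<Psi> t (proj x) = proj (G (t, x))" using G t by (simp add: normalized_lift_def)
        ultimately show ?thesis by (simp add: differential_def partial_proj)
      qed
      have cX: "continuous_on (cbox 0 1) (?X t)"
        using continuous_on_compose2[OF smooth_frechet_continuous[OF sG, of "(1, 0)"], of "cbox 0 1" "\<lambda>x. (t, x)"]
        by (simp add: continuous_intros)
      have comp: "integral (cbox 0 1) (?X t) $ i = integral (cbox 0 1) (\<lambda>x. ?X t x $ i)" for i
        using integral_linear[OF integrable_continuous[OF cX] bounded_linear_vec_nth[of i]] by (simp add: o_def)
      have "?X t x $ 1 = frechet_derivative ?W (at (G (t, x))) (axis 2 1)"
        "?X t x $ 2 = - frechet_derivative ?W (at (G (t, x))) (axis 1 1)" for x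
        using X[of x 1] X[of x 2] by (simp_all add: contract_omega_nth)
      then show ?thesis by (simp add: vec_eq_iff forall_2 comp zero)
    qed
    ultimately show ?thesis by simp
  qed
  have "\<exists>c. \<forall>t\<in>{0..1}. ?m t = c"
  proof (rule has_derivative_zero_constant)
    show "(?m has_derivative (\<lambda>h. 0)) (at t within {0..1})" if "t \<in> {0..1}" for t
      by (rule has_derivative_at_withinI[OF dm[OF that]])
  qed simp
  then obtain c where "\<And>t. t \<in> {0..1} \<Longrightarrow> ?m t = c" by blast
  then have "?m 1 = ?m 0" by simp
  then show ?thesis using G by (simp add: normalized_lift_def)
qed

text \<open>\<Psi> is \<Phi> followed by the translation by \<open>- v t\<close>, where
  \<open>v\<close> moves with the velocity belonging to the periods \<open>c\<close> of
  \<open>\<H>\<close>. Constant forms are invariant under translations, so \<Psi> is generated by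
  the translate of \<open>dU + \<H> - c\<close>, in which \<open>\<H> - c\<close> is exact.\<close>

lemma symplectic_to_hamiltonian:
  assumes G: "normalized_lift G \<Phi>" and \<Phi>: "symplectic_isotopy \<Phi>" and gen: "generated_by \<Phi> U \<H>"
    and closed: "\<And>t. t \<in> {0..1} \<Longrightarrow> closed_form (\<H> t)"
  obtains \<Psi> U' v where "symplectic_isotopy \<Psi>" "generated_by \<Psi> U' (\<lambda>t p. 0)"
    "\<And>x. \<Psi> 1 (proj x) = proj (G (1, x) - v)" "integral (cbox 0 1) (\<lambda>x. G (1, x) - x) = v"
    "\<And>t p. t \<in> {0..1} \<Longrightarrow> \<exists>x. U' t p = U t (proj x) + potential (\<H> t) x"
proof -
  have sG: "smooth G" using G by (simp add: normalized_lift_def)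
  obtain u :: "real \<times> (real^2) \<Rightarrow> real" where u: "smooth u" "\<And>t x. t \<in> {0..1} \<Longrightarrow> U t (proj x) = u (t, x)"
    using gen by (auto simp: generated_by_def smooth_family_def)
  obtain A :: "real \<times> (real^2) \<Rightarrow> real^2" where A: "smooth A" "\<And>t x. t \<in> {0..1} \<Longrightarrow> \<H> t (proj x) = A (t, x)"
    using gen by (auto simp: generated_by_def smooth_family_def)
  \<comment> \<open>On the unit interval this is the period of \<open>\<H> t\<close>. Taking the
    extension \<open>A\<close> instead of \<open>\<H>\<close> gives a function smooth for all times,
    as the lift of a smooth isotopy requires.\<close>
  define c where "c t = (\<chi> i. integral (cbox 0 1) (\<lambda>s. A (t, s *\<^sub>R axis i 1) $ i))" for t
  have sc: "smooth c"
    unfolding c_def[abs_def]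
  proof (rule smooth_vec_lambda)
    fix i
    have "smooth (\<lambda>z::real \<times> real. A (fst z, snd z *\<^sub>R axis i 1) $ i)"
      by (intro smooth_vec_nth smooth_compose[OF A(1)] smooth_Pair smooth_fst smooth_scaleR smooth_snd smooth_const smooth_ident)
    from smooth_integral[OF this, of 0 1] show "smooth (\<lambda>t. integral (cbox 0 1) (\<lambda>s. A (t, s *\<^sub>R axis i 1) $ i))" by simp
  qed
  have ct: "c t = period (\<H> t)" if "t \<in> {0..1}" for t
    by (simp add: c_def period_def A(2)[OF that])
  define v where "v t = t *\<^sub>R integral {0..1} (\<lambda>r. hamiltonian_vector (c (t * r)))" for t
  have sh: "smooth (\<lambda>t. hamiltonian_vector (c t))" by (rule smooth_hamiltonian_vector[OF sc])
  have sv: "smooth v"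
  proof -
    have "smooth (\<lambda>z::real \<times> real. hamiltonian_vector (c (fst z * snd z)))"
      by (rule smooth_compose[OF sh smooth_mult[OF smooth_fst[OF smooth_ident] smooth_snd[OF smooth_ident]]])
    from smooth_scaleR[OF smooth_ident smooth_integral[OF this, of 0 1]] show ?thesis
      unfolding v_def[abs_def] by simp
  qed
  have dv: "(v has_vector_derivative hamiltonian_vector (c t)) (at t)" for t
    unfolding v_def[abs_def] by (rule has_vector_derivative_primitive[OF smooth_continuous[OF sh]])
  have v0: "v 0 = 0" by (simp add: v_def)
  define f where "f z = integral (cbox 0 1) (\<lambda>s. (A (fst z, s *\<^sub>R snd z) - c (fst z)) \<bullet> snd z)" for z
  have sf: "smooth f"
  proof -
    have "smooth (\<lambda>z::(real \<times> (real^2)) \<times> real. (A (fst (fst z), snd z *\<^sub>R snd (fst z)) - c (fst (fst z))) \<bullet> snd (fst z))"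
      by (intro smooth_inner smooth_diff smooth_compose[OF A(1)] smooth_compose[OF sc] smooth_Pair smooth_scaleR
          smooth_fst smooth_snd smooth_ident)
    from smooth_integral[OF this, of 0 1] show ?thesis unfolding f_def[abs_def] by simp
  qed
  have ft: "f (t, x) = potential (\<H> t) x" if "t \<in> {0..1}" for t x
    by (simp add: f_def potential_def A(2)[OF that] ct[OF that])
  define W where "W z = u z + f z" for z
  have Wt: "W (t, x) = U t (proj x) + potential (\<H> t) x" if "t \<in> {0..1}" for t x
    by (simp add: W_def u(2)[OF that] ft[OF that])
  have pW: "periodic (\<lambda>x. W (t, x))" if "t \<in> {0..1}" for t
    using periodic_potential[OF closed[OF that]] by (simp add: Wt[OF that] periodic_def)
  \<comment> \<open>At the new position \<open>\<Phi> t p - v t\<close> the function must take the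
    value of \<open>W\<close> at the old position, hence the shift by \<open>v t\<close>.\<close>
  define U' where "U' t p = W (t, rep_torus p + v t)" for t p
  have U't: "U' t (proj x) = W (t, x + v t)" if "t \<in> {0..1}" for t x
    unfolding U'_def by (rule periodic_rep_torus[OF periodic_translate[OF pW[OF that]]])
  define \<Psi> where "\<Psi> t p = shift (- v t) (\<Phi> t p)" for t p
  define G' where "G' z = G z - v (fst z)" for z
  have sG': "smooth G'" unfolding G'_def[abs_def] by (intro smooth_diff sG smooth_compose[OF sv] smooth_fst smooth_ident)
  have G': "normalized_lift G' \<Psi>"
    unfolding normalized_lift_def
  proof (intro conjI allI ballI sG')
    show "G' (0, x) = x" for x using G by (simp add: G'_def v0 normalized_lift_def)
    show "proj (G' (t, x)) = \<Psi> t (proj x)" if "t \<in> {0..1}" for t x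
      using G that shift_proj[of "- v t" "G (t, x)"] by (simp add: G'_def \<Psi>_def normalized_lift_def)
    show "G' (t, x + k) = G' (t, x) + k" if "t \<in> {0..1}" "k \<in> lattice2" for t x k
      using G that by (simp add: G'_def normalized_lift_def)
  qed
  have smooth_shift: "smooth (\<lambda>x. F (x + a))" if "smooth F" for F :: "real^2 \<Rightarrow> real^2" and a
    by (rule smooth_compose[OF that smooth_add[OF smooth_ident smooth_const]])
  have diffeo: "diffeo (\<Psi> t)" if t: "t \<in> {0..1}" for t
  proof -
    have "diffeo (\<Phi> t)" using \<Phi> t by (simp add: symplectic_isotopy_def symplectic_diffeo_def)
    then obtain k K where k: "\<And>p. k (\<Phi> t p) = p" "\<And>p. \<Phi> t (k p) = p" and K: "smooth K" "\<And>x. proj (K x) = k (proj x)"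
      unfolding diffeo_def smooth_map_def is_lift_def by blast
    have "smooth_map (\<Psi> t)"
      unfolding smooth_map_def is_lift_def
      using G' t smooth_slice(1)[OF sG', of t] by (intro exI[of _ "\<lambda>x. G' (t, x)"]) (simp add: normalized_lift_def)
    moreover have "smooth_map (\<lambda>p. k (shift (v t) p))"
      unfolding smooth_map_def is_lift_def
      using K smooth_shift[OF K(1), of "v t"] by (intro exI[of _ "\<lambda>x. K (x + v t)"]) (simp add: shift_proj)
    ultimately show ?thesis
      unfolding diffeo_def
      by (intro conjI exI[of _ "\<lambda>p. k (shift (v t) p)"]) (simp_all add: \<Psi>_def shift_shift shift_0 k)
  qed
  have symp: "symplectic_isotopy \<Psi>"
    unfolding symplectic_isotopy_def smooth_isotopy_def
  proof (intro conjI ballI exI[of _ G'] diffeo sG')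
    show "\<Psi> 0 = id" using \<Phi> by (simp add: \<Psi>_def v0 shift_0 fun_eq_iff symplectic_isotopy_def smooth_isotopy_def)
    show "is_lift (\<lambda>x. G' (t, x)) (\<Psi> t)" if "t \<in> {0..1}" for t
      using G' that by (simp add: is_lift_def normalized_lift_def)
    show "symplectic_diffeo (\<Psi> t)" if t: "t \<in> {0..1}" for t
      unfolding symplectic_diffeo_def
    proof (intro conjI exI[of _ "\<lambda>x. G' (t, x)"] allI diffeo[OF t])
      show "smooth (\<lambda>x. G' (t, x))" by (rule smooth_slice(1)[OF sG'])
      show "is_lift (\<lambda>x. G' (t, x)) (\<Psi> t)" using G' t by (simp add: is_lift_def normalized_lift_def)
      fix x a b
      have "((\<lambda>x. G' (t, x)) has_derivative (\<lambda>v. frechet_derivative (\<lambda>x. G (t, x)) (at x) v - 0)) (at x)"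
        unfolding G'_def fst_conv
        by (rule has_derivative_diff[OF smooth_has_derivative[OF smooth_slice(1)[OF sG]] has_derivative_const])
      then have "frechet_derivative (\<lambda>x. G' (t, x)) (at x) = frechet_derivative (\<lambda>x. G (t, x)) (at x)"
        by (intro frechet_derivative_at[symmetric]) simp
      then show "omega (frechet_derivative (\<lambda>x. G' (t, x)) (at x) a) (frechet_derivative (\<lambda>x. G' (t, x)) (at x) b) = omega a b"
        using normalized_lift_area[OF G \<Phi> t] by simp
    qed
  qed
  have gen': "generated_by \<Psi> U' (\<lambda>t p. 0)"
    unfolding generated_by_def
  proof (intro conjI ballI allI)
    have "smooth (\<lambda>z. W (fst z, snd z + v (fst z)))"
    proof -
      have "smooth W" unfolding W_def[abs_def] by (rule smooth_add[OF u(1) sf])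
      then show ?thesis
        by (rule smooth_compose) (intro smooth_Pair smooth_add smooth_compose[OF sv] smooth_fst smooth_snd smooth_ident)
    qed
    then show "smooth_family U'"
      unfolding smooth_family_def by (intro exI[of _ "\<lambda>z. W (fst z, snd z + v (fst z))"]) (simp add: U't)
    show "smooth_family (\<lambda>(t::real) (p::torus). 0 :: real^2)"
      unfolding smooth_family_def by (intro exI[of _ "\<lambda>_. 0"]) (simp add: smooth_const)
    fix t :: real and p assume t: "t \<in> {0..1}"
    obtain x where p: "p = proj x" by (rule proj_cases)
    let ?y = "G (t, x)"
    have X: "frechet_derivative G' (at (t, x)) (1, 0) = frechet_derivative G (at (t, x)) (1, 0) - hamiltonian_vector (c t)"
    proof -
      have "((\<lambda>s. G' (s, x)) has_vector_derivative frechet_derivative G (at (t, x)) (1, 0) - hamiltonian_vector (c t)) (at t)"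
        unfolding G'_def fst_conv by (rule has_vector_derivative_diff[OF has_vector_derivative_slice[OF sG] dv])
      from vector_derivative_unique_at[OF has_vector_derivative_slice[OF sG'] this] show ?thesis .
    qed
    have \<Phi>y: "\<Phi> t p = proj ?y" and \<Psi>y: "\<Psi> t p = proj (?y - v t)"
      using G G' t by (auto simp: p normalized_lift_def G'_def)
    have "contract_omega (velocity (\<lambda>s. \<Psi> s p) t) = contract_omega (velocity (\<lambda>s. \<Phi> s p) t) - c t"
      unfolding p velocity_normalized_lift[OF G' t] velocity_normalized_lift[OF G t] X
      by (rule contract_omega_diff_hamiltonian_vector)
    also have "\<dots> = differential (U t) (proj ?y) + (\<H> t (proj ?y) - c t)"
      using gen t by (simp add: generated_by_def flip: \<Phi>y)
    also have "\<dots> = differential (U' t) (\<Psi> t p)"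
    proof -
      have "((\<lambda>z. U' t (proj z)) has_derivative
          (\<lambda>w. frechet_derivative (\<lambda>z. U t (proj z)) (at ?y) w + (\<H> t (proj ?y) - c t) \<bullet> w)) (at (?y - v t))"
      proof -
        have sU: "smooth (\<lambda>z. U t (proj z))"
          using smooth_family_slice[OF _ t, of U] gen by (simp add: generated_by_def smooth_torus_def)
        have "((\<lambda>z. U t (proj z) + potential (\<H> t) z) has_derivative
            (\<lambda>w. frechet_derivative (\<lambda>z. U t (proj z)) (at ?y) w + (\<H> t (proj ?y) - c t) \<bullet> w)) (at ((?y - v t) + v t))"
          using has_derivative_add[OF smooth_has_derivative[OF sU] has_derivative_potential[OF closed[OF t]], of ?y]
          by (simp add: ct[OF t])
        then show ?thesis
          unfolding has_derivative_translate by (simp add: U't[OF t] Wt[OF t])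
      qed
      note D = fun_cong[OF frechet_derivative_at[OF this], symmetric]
      show ?thesis
        unfolding \<Psi>y by (simp add: vec_eq_iff differential_def partial_proj D inner_axis)
    qed
    finally show "contract_omega (velocity (\<lambda>s. \<Psi> s p) t) = differential (U' t) (\<Psi> t p) + 0" by simp
  qed
  \<comment> \<open>\<Psi> is Hamiltonian. This identifies \<open>v 1\<close>, defined through the
    generator, with the mean displacement of the time-one lift, which can be compared with the limit
    map.\<close>
  have "integral (cbox 0 1) (\<lambda>x. G' (1, x) - x) = 0"
    by (rule mean_displacement_hamiltonian[OF G' symp gen'])
  moreover have "integral (cbox 0 1) (\<lambda>x. G' (1, x) - x) = integral (cbox 0 1) (\<lambda>x. (G (1, x) - x) - v 1)"
    by (rule Henstock_Kurzweil_Integration.integral_cong) (simp add: G'_def)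
  moreover have "\<dots> = integral (cbox 0 1) (\<lambda>x. G (1, x) - x) - v 1"
  proof -
    have "(\<lambda>x. G (1, x) - x) integrable_on cbox 0 1"
      by (intro integrable_continuous continuous_on_subset[OF smooth_continuous[OF smooth_diff[OF smooth_slice(1)[OF sG] smooth_ident]] subset_UNIV])
    then show ?thesis
      by (simp add: Henstock_Kurzweil_Integration.integral_diff integrable_const content_unit_cell)
  qed
  ultimately have mean: "integral (cbox 0 1) (\<lambda>x. G (1, x) - x) = v 1" by simp
  have time1: "\<Psi> 1 (proj x) = proj (G (1, x) - v 1)" for x
    using G' by (simp add: normalized_lift_def G'_def)
  have "\<exists>x. U' t p = U t (proj x) + potential (\<H> t) x" if "t \<in> {0..1}" for t p
    unfolding U'_def Wt[OF that] by blast
  then show thesis using that symp gen' time1 mean by blast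
qed

text \<open>Oscillation is invariant under translations of the argument, which is why the relation
  between \<open>U'\<close> and \<open>U\<close> is recorded only as an existential statement about
  values.\<close>

lemma (in riemannian_torus) hofer_length_bound:
  assumes "\<kappa> > 0"
  obtains K where "K \<ge> 0" "\<And>U \<H> U'. smooth_family U \<Longrightarrow> smooth_family \<H> \<Longrightarrow> (\<And>t. t \<in> {0..1} \<Longrightarrow> harmonic_form g (\<H> t)) \<Longrightarrow>
    (\<And>t p. t \<in> {0..1} \<Longrightarrow> \<exists>x. U' t p = U t (proj x) + potential (\<H> t) x) \<Longrightarrow>
    hofer_length U' \<le> K * hofer_like_length g \<kappa> U \<H>"
proof -
  obtain K where K: "K \<ge> 0" and pot: "\<And>\<alpha> x. harmonic_form g \<alpha> \<Longrightarrow> \<bar>potential \<alpha> x\<bar> \<le> K * L2_norm_form g \<alpha>"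
    by (rule harmonic_potential_bound) blast
  \<comment> \<open>The entry 1 serves the oscillation of \<open>U\<close>. A potential bounded by
    \<open>K\<close> times the norm oscillates by at most twice that, and the division by \<kappa>
    expresses it through the second term of the length.\<close>
  define C where "C = max 1 (2 * K / \<kappa>)"
  have "hofer_length U' \<le> C * hofer_like_length g \<kappa> U \<H>"
    if U: "smooth_family U" and \<H>: "smooth_family \<H>" and harm: "\<And>t. t \<in> {0..1} \<Longrightarrow> harmonic_form g (\<H> t)"
      and U': "\<And>t p. t \<in> {0..1} \<Longrightarrow> \<exists>x. U' t p = U t (proj x) + potential (\<H> t) x" for U \<H> U'
  proof -
    let ?e = "\<lambda>t. osc (U t) + \<kappa> * L2_norm_form g (\<H> t)"
    have int: "?e integrable_on {0..1}"
      by (intro integrable_continuous_real continuous_intros continuous_osc U continuous_L2_norm_form \<H>)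
    have o0: "osc (U t) \<ge> 0" if "t \<in> {0..1}" for t
      using diff_le_osc[OF smooth_torus_continuous[OF smooth_family_slice[OF U that]], of undefined undefined] by simp
    have l0: "L2_norm_form g (\<H> t) \<ge> 0" if "t \<in> {0..1}" for t
    proof -
      obtain m where m: "m > 0" "\<And>\<alpha> p. \<alpha> p \<bullet> density_vector \<alpha> p \<ge> m * (norm (\<alpha> p))\<^sup>2"
        by (rule energy_density_bound) blast
      have "\<H> t p \<bullet> density_vector (\<H> t) p \<ge> 0" for p
        using m(2)[of "\<H> t" p] mult_nonneg_nonneg[OF less_imp_le[OF m(1)] zero_le_power2[of "norm (\<H> t p)"]] by linarith
      moreover have "(\<lambda>x. \<H> t (proj x) \<bullet> density_vector (\<H> t) (proj x)) integrable_on cbox 0 1"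
      proof -
        have "closed_form (\<H> t)" using harm[OF that] by (simp add: harmonic_form_def)
        from continuous_on_subset[OF continuous_energy_density[OF this] subset_UNIV]
        show ?thesis by (rule integrable_continuous)
      qed
      ultimately show ?thesis
        using L2_norm_form_eq[OF smooth_torus_continuous[OF smooth_family_slice[OF \<H> that]]]
        by (simp add: Henstock_Kurzweil_Integration.integral_nonneg)
    qed
    have e0: "?e t \<ge> 0" if "t \<in> {0..1}" for t using o0[OF that] l0[OF that] \<open>\<kappa> > 0\<close> by simp
    have le: "osc (U' t) \<le> C * ?e t" if t: "t \<in> {0..1}" for t
    proof -
      have "osc (U' t) \<le> osc (U t) + 2 * K * L2_norm_form g (\<H> t)"
      proof (rule osc_le)
        fix p q
        obtain x y where "U' t p = U t (proj x) + potential (\<H> t) x" "U' t q = U t (proj y) + potential (\<H> t) y"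
          using U'[OF t] by meson
        then show "U' t p - U' t q \<le> osc (U t) + 2 * K * L2_norm_form g (\<H> t)"
          using pot[OF harm[OF t], of x] pot[OF harm[OF t], of y]
            diff_le_osc[OF smooth_torus_continuous[OF smooth_family_slice[OF U t]], of "proj x" "proj y"] by linarith
      qed
      also have "\<dots> \<le> C * osc (U t) + C * \<kappa> * L2_norm_form g (\<H> t)"
      proof (rule add_mono)
        show "osc (U t) \<le> C * osc (U t)" using mult_right_mono[of 1 C "osc (U t)"] o0[OF t] by (simp add: C_def)
        have "2 * K \<le> C * \<kappa>" using \<open>\<kappa> > 0\<close> by (simp add: C_def max_mult_distrib_right)
        then show "2 * K * L2_norm_form g (\<H> t) \<le> C * \<kappa> * L2_norm_form g (\<H> t)"
          by (rule mult_right_mono[OF _ l0[OF t]])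
      qed
      finally show ?thesis by (simp add: algebra_simps)
    qed
    show ?thesis
    proof (cases "(\<lambda>t. osc (U' t)) integrable_on {0..1}")
      case True
      have "hofer_length U' \<le> integral {0..1} (\<lambda>t. C * ?e t)"
        unfolding hofer_length_def
        by (rule integral_le[OF True integrable_on_mult_right[OF int] le])
      then show ?thesis by (simp add: hofer_like_length_def)
    next
      \<comment> \<open>Here \<open>hofer_length\<close> is 0 by convention, below a nonnegative
        right-hand side.\<close>
      case False
      have "0 \<le> integral {0..1} ?e" by (rule Henstock_Kurzweil_Integration.integral_nonneg[OF int e0])
      moreover have "C \<ge> 0" by (simp add: C_def)
      ultimately show ?thesis
        using False by (simp add: hofer_length_def hofer_like_length_def not_integrable_integral)
    qed
  qed
  moreover have "C \<ge> 0" by (simp add: C_def)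
  ultimately show thesis using that by blast
qed

text \<open>Closeness on the torus gives, at each point, a lattice vector near
  \<open>D x - w x\<close>. The bound 1/4 separates the candidates, so by connectedness of the plane
  one vector serves all points, and averaging yields the estimate.\<close>

lemma mean_near_lattice:
  fixes D w :: "real^2 \<Rightarrow> real^2"
  assumes D: "continuous_on UNIV D" and w: "continuous_on UNIV w" "integral (cbox 0 1) w = 0"
    and e: "e \<le> 1/4" and close: "\<And>x. dist (proj (x + D x)) (proj (x + w x)) < e"
  obtains k where "k \<in> lattice2" "norm (integral (cbox 0 1) D - k) \<le> e"
proof -
  let ?u = "\<lambda>x. D x - w x"
  have near: "\<exists>k\<in>lattice2. norm (?u x - k) < e" for x
  proof -
    obtain y where y: "proj y = proj (x + w x)" "dist (x + D x) y < e"
      using dist_proj_ltE[OF close] by blast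
    have "y - (x + w x) \<in> lattice2" using y(1) by (simp add: proj_eq_lattice)
    moreover have "?u x - (y - (x + w x)) = (x + D x) - y" by simp
    ultimately show ?thesis using y(2) by (metis dist_norm)
  qed
  obtain k where k: "k \<in> lattice2" "norm (?u 0 - k) < e" using near by blast
  have cu: "continuous_on UNIV ?u" by (intro continuous_intros D w)
  \<comment> \<open>If \<open>?u x\<close> is within 1/2 of \<open>k\<close> and within 1/4 of a
    lattice vector \<open>l\<close>, then \<open>l = k\<close>. Equality of an open and a closed
    condition makes the set clopen.\<close>
  have "{x. norm (?u x - k) < e} = {x. norm (?u x - k) \<le> 1/2}"
  proof (rule Collect_cong, rule iffI)
    show "norm (?u x - k) \<le> 1/2" if "norm (?u x - k) < e" for x using that e by linarith
    fix x assume x: "norm (?u x - k) \<le> 1/2"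
    obtain l where l: "l \<in> lattice2" "norm (?u x - l) < e" using near by blast
    have "norm (l - k) \<le> norm (?u x - k) + norm (?u x - l)"
      using norm_triangle_ineq4[of "?u x - k" "?u x - l"] by simp
    then have "norm (l - k) < 1" using x l(2) e by linarith
    then have "l - k = 0" using norm_lattice2_ge_1[OF lattice2_diff[OF l(1) k(1)]] by force
    then show "norm (?u x - k) < e" using l(2) by simp
  qed
  moreover have "open {x. norm (?u x - k) < e}" by (intro open_Collect_less continuous_intros cu)
  moreover have "closed {x. norm (?u x - k) \<le> 1/2}" by (intro closed_Collect_le continuous_intros cu)
  ultimately have "{x. norm (?u x - k) < e} = UNIV" using k(2) clopen[of "{x. norm (?u x - k) < e}"] by auto
  then have all: "norm (?u x - k) \<le> e" for x by (simp add: set_eq_iff less_imp_le)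
  have iD: "D integrable_on cbox 0 1" and iw: "w integrable_on cbox 0 1"
    by (intro integrable_continuous continuous_on_subset[OF D subset_UNIV] continuous_on_subset[OF w(1) subset_UNIV])+
  have "integral (cbox 0 1) D - k = integral (cbox 0 1) (\<lambda>x. ?u x - k)"
    using iD iw w(2) by (simp add: Henstock_Kurzweil_Integration.integral_diff integrable_diff integrable_const content_unit_cell)
  also have "norm \<dots> \<le> integral (cbox 0 (1 :: real^2)) (\<lambda>x. e)"
    by (rule integral_norm_bound_integral) (use iD iw all in \<open>auto intro!: integrable_diff\<close>)
  also have "\<dots> = e" by (simp add: content_unit_cell)
  finally show thesis using that k(1) by blast
qed

theorem lemma3p17:
  fixes g :: metric_tensor and \<kappa> \<delta> :: real and h :: "torus \<Rightarrow> torus"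
  assumes "riemannian_metric g" and "\<kappa> > 0"
    and "0 < \<delta>" and "\<delta> < injectivity_radius g"
    and "finite_energy_symplectic g \<kappa> h"
    and "flux g \<delta> h = \<one>\<^bsub>H1 Mod flux_group g \<delta>\<^esub>"
  shows "finite_energy_hamiltonian h"
proof -
  interpret riemannian_torus g by unfold_locales (rule assms)
  obtain w :: "torus \<Rightarrow> real^2" where w: "continuous_on UNIV w" "\<And>x. proj (x + w (proj x)) = h (proj x)"
    "integral (cbox 0 1) (\<lambda>x. w (proj x)) = 0"
    using trivial_flux_mean_displacement[OF assms(1,4,6)] by blast
  obtain \<Phi> U \<H> C where \<Phi>: "\<And>i::nat. symplectic_isotopy (\<Phi> i)" "\<And>i. generated_by (\<Phi> i) (U i) (\<H> i)"
    and harm: "\<And>i t. t \<in> {0..1} \<Longrightarrow> harmonic_form g (\<H> i t)"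
    and lim: "uniform_limit UNIV (\<lambda>i. \<Phi> i 1) h sequentially"
    and C: "\<And>i. hofer_like_length g \<kappa> (U i) (\<H> i) \<le> C" and homeo: "torus_homeo h"
    using assms(5) unfolding finite_energy_symplectic_def by blast
  obtain K where K: "K \<ge> 0" and len: "\<And>U \<H> U'. smooth_family U \<Longrightarrow> smooth_family \<H> \<Longrightarrow> (\<And>t. t \<in> {0..1} \<Longrightarrow> harmonic_form g (\<H> t)) \<Longrightarrow>
    (\<And>t p. t \<in> {0..1} \<Longrightarrow> \<exists>x. U' t p = U t (proj x) + potential (\<H> t) x) \<Longrightarrow>
    hofer_length U' \<le> K * hofer_like_length g \<kappa> U \<H>"
    using hofer_length_bound[OF assms(2)] by blast
  let ?P = "\<lambda>i \<Psi> U'. symplectic_isotopy \<Psi> \<and> generated_by \<Psi> U' (\<lambda>t p. 0) \<and> hofer_length U' \<le> K * C \<and>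
      (\<exists>D :: real^2 \<Rightarrow> real^2. continuous_on UNIV D \<and> (\<forall>x. \<Phi> i 1 (proj x) = proj (x + D x)) \<and>
        (\<forall>x. \<Psi> 1 (proj x) = proj (x + D x - integral (cbox 0 1) D)))"
  have ex: "\<exists>\<Psi> U'. ?P i \<Psi> U'" for i
  proof -
    have "smooth_isotopy (\<Phi> i)" using \<Phi>(1) by (simp add: symplectic_isotopy_def)
    then obtain G where G: "normalized_lift G (\<Phi> i)"
      unfolding normalized_lift_def by (rule smooth_isotopy_lift) blast
    have sG: "smooth G" using G by (simp add: normalized_lift_def)
    have "closed_form (\<H> i t)" if "t \<in> {0..1}" for t using harm[OF that] by (simp add: harmonic_form_def)
    from symplectic_to_hamiltonian[OF G \<Phi>(1) \<Phi>(2) this]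
    obtain \<Psi> U' v where \<Psi>: "symplectic_isotopy \<Psi>" "generated_by \<Psi> U' (\<lambda>t p. 0)"
      "\<And>x. \<Psi> 1 (proj x) = proj (G (1, x) - v)" "integral (cbox 0 1) (\<lambda>x. G (1, x) - x) = v"
      and U': "\<And>t p. t \<in> {0..1} \<Longrightarrow> \<exists>x. U' t p = U i t (proj x) + potential (\<H> i t) x" by blast
    have "smooth_family (U i)" "smooth_family (\<H> i)" using \<Phi>(2)[of i] by (auto simp: generated_by_def)
    then have "hofer_length U' \<le> K * hofer_like_length g \<kappa> (U i) (\<H> i)" by (rule len[OF _ _ harm U'])
    also have "\<dots> \<le> K * C" by (rule mult_left_mono[OF C K])
    finally have "hofer_length U' \<le> K * C" .
    moreover have "continuous_on UNIV (\<lambda>x. G (1, x) - x)"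
      by (rule smooth_continuous[OF smooth_diff[OF smooth_slice(1)[OF sG] smooth_ident]])
    moreover have "\<Phi> i 1 (proj x) = proj (x + (G (1, x) - x))" for x using G by (simp add: normalized_lift_def)
    ultimately show ?thesis
      using \<Psi> by (intro exI[of _ \<Psi>] exI[of _ U'] conjI exI[of _ "\<lambda>x. G (1, x) - x"]) auto
  qed
  then have "\<forall>i. \<exists>q. ?P i (fst q) (snd q)" by simp
  from choice[OF this] obtain q where q: "\<And>i. ?P i (fst (q i)) (snd (q i))" by blast
  have "uniform_limit UNIV (\<lambda>i. fst (q i) 1) h sequentially"
    unfolding uniform_limit_iff
  proof (intro allI impI)
    fix e :: real assume e: "e > 0"
    \<comment> \<open>1/4 is what \<open>mean_near_lattice\<close> asks for. With
      \<open>e / 3\<close> the two errors, from the convergence and from the translation, add up to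
      less than \<open>e\<close>.\<close>
    define d where "d = min (e / 3) (1 / 4)"
    have d: "d > 0" "d \<le> 1/4" "d \<le> e / 3" using e by (auto simp: d_def)
    have "\<forall>\<^sub>F i in sequentially. \<forall>p\<in>UNIV. dist (\<Phi> i 1 p) (h p) < d"
      using lim d(1) unfolding uniform_limit_iff by blast
    then show "\<forall>\<^sub>F i in sequentially. \<forall>p\<in>UNIV. dist (fst (q i) 1 p) (h p) < e"
    proof (rule eventually_mono)
      fix i assume close: "\<forall>p\<in>UNIV. dist (\<Phi> i 1 p) (h p) < d"
      obtain D :: "real^2 \<Rightarrow> real^2" where D: "continuous_on UNIV D" "\<And>x. \<Phi> i 1 (proj x) = proj (x + D x)"
        "\<And>x. fst (q i) 1 (proj x) = proj (x + D x - integral (cbox 0 1) D)" using q[of i] by blast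
      have "dist (proj (x + D x)) (proj (x + w (proj x))) < d" for x
        using bspec[OF close UNIV_I, of "proj x"] by (simp only: w(2) D(2))
      then obtain k where k: "k \<in> lattice2" "norm (integral (cbox 0 1) D - k) \<le> d"
        using mean_near_lattice[OF D(1) _ w(3) d(2)] w(1) unfolding continuous_on_torus_iff by blast
      show "\<forall>p\<in>UNIV. dist (fst (q i) 1 p) (h p) < e"
      proof
        fix p
        obtain x where p: "p = proj x" by (rule proj_cases)
        let ?v = "integral (cbox 0 1) D"
        \<comment> \<open>The translation matters only modulo the lattice: \<open>?v\<close> may be
          large, but \<open>?v - k\<close> is small and induces the same map.\<close>
        have "proj (x + D x - ?v) = proj (x + D x - ?v + k)" using k(1) by simp
        then have "dist (fst (q i) 1 p) (\<Phi> i 1 p) \<le> dist (x + D x - ?v + k) (x + D x)"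
          unfolding p D(2,3) by (simp only: dist_proj_le)
        also have "\<dots> = norm (?v - k)" by (simp add: dist_norm norm_minus_commute)
        finally have "dist (fst (q i) 1 p) (\<Phi> i 1 p) \<le> d" using k(2) by simp
        moreover have "dist (\<Phi> i 1 p) (h p) < d" using close by simp
        ultimately show "dist (fst (q i) 1 p) (h p) < e"
          using dist_triangle[of "fst (q i) 1 p" "h p" "\<Phi> i 1 p"] d by linarith
      qed
    qed
  qed
  then show ?thesis
    unfolding finite_energy_hamiltonian_def
    using homeo q by (intro conjI exI[of _ "\<lambda>i. fst (q i)"] exI[of _ "\<lambda>i. snd (q i)"] exI[of _ "K * C"]) blast+
qed

end
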